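(* Let $\mathbb{K}$ be a nonzero commutative ring, $A$ a central $\mathbb{K}$-ring and $B$ a dg central $\mathbb{K}$-ring. The functor $\Phi:\mathcal{C}(B,A\text{-}\mathsf{Mod})\to\mathcal{C}(A\otimes B)$, which sends a dg $B$-module $M$ in $A\text{-}\mathsf{Mod}$ to the same graded $\mathbb{K}$-module with the same differential and with the action $(\alpha\otimes f).x=\alpha(f.x)$ ($\alpha\in A$, $f\in B$, $x\in M$), and which sends a morphism $u$ to the same underlying map, is an isomorphism of dg categories.
   Context: A central $\mathbb{K}$-ring is a unital associative $\mathbb{K}$-algebra. A dg central $\mathbb{K}$-ring $B=(\bigoplus_{i\in\mathbb{Z}}B^i,b)$ is a graded unital associative $\mathbb{K}$-algebra with a $\mathbb{K}$-linear square-zero differential $b$ of degree $+1$ satisfying $b(fg)=b(f)g+(-1)^pf\,b(g)$ for $f\in B^p$. Modules are left modules; $\otimes=\otimes_{\mathbb{K}}$. $\mathcal{C}(B,A\text{-}\mathsf{Mod})$: an object is a graded $B$-module $M=(M^q)_{q\in\mathbb{Z}}$ such that each $M^q$ is an $A$-module, $\alpha(f.x)=f.(\alpha x)$ for $\alpha\in A$, $f\in B$, $x\in M$, endowed with a square-zero differential $d_M:M^q\to M^{q+1}$ of $A$-modules satisfying $d_M(f.x)=b(f).x+(-1)^pf.d_M(x)$ for $f\in B^p$. A morphism $u:M\to M'$ of degree $r$ is a family of $A$-module maps $M^q\to M'^{q+r}$ with $u(f.x)=(-1)^{pr}f.u(x)$ for $f\in B^p$; morphisms are finite sums of homogeneous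 ones, and the differential of the morphism complex is $d(u)=d_{M'}\circ u-(-1)^ru\circ d_M$. $A\otimes B$ is the dg central $\mathbb{K}$-ring with $A$ in degree $0$ with zero differential: product $(\alpha\otimes f)(\beta\otimes g)=\alpha\beta\otimes fg$ and differential $\alpha\otimes f\mapsto\alpha\otimes b(f)$. $\mathcal{C}(A\otimes B)$ is the dg category of dg (left) $(A\otimes B)$-modules, with morphisms and differentials of morphisms defined by the same sign conventions. *)

theory Defs
  imports "HOL-Algebra.Module" "HOL-Algebra.Free_Abelian_Groups"
begin

section \<open>Central rings, linear maps and signs\<close>

text \<open>The library locale \<^locale>\<open>algebra\<close> requires commutativity, and the library locale
  \<^locale>\<open>module\<close> requires a commutative ring of scalars, hence the next two locales.\<close>

locale central_ring = module K A + Alg: ring A for K :: "('k, 'z) ring_scheme" and A :: "('k, 'a) module" +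
  assumes smult_mult_left:
      "\<lbrakk>k \<in> carrier K; a \<in> carrier A; b \<in> carrier A\<rbrakk> \<Longrightarrow>
        (k \<odot>\<^bsub>A\<^esub> a) \<otimes>\<^bsub>A\<^esub> b = k \<odot>\<^bsub>A\<^esub> (a \<otimes>\<^bsub>A\<^esub> b)"
    and smult_mult_right:
      "\<lbrakk>k \<in> carrier K; a \<in> carrier A; b \<in> carrier A\<rbrakk> \<Longrightarrow>
        a \<otimes>\<^bsub>A\<^esub> (k \<odot>\<^bsub>A\<^esub> b) = k \<odot>\<^bsub>A\<^esub> (a \<otimes>\<^bsub>A\<^esub> b)"

locale left_module = Alg: ring A + Mod: abelian_group N
  for A :: "('a, 'y) ring_scheme" and N :: "('m, 'z) ring_scheme" +
  fixes act :: "'a \<Rightarrow> 'm \<Rightarrow> 'm"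
  assumes act_closed: "\<lbrakk>a \<in> carrier A; x \<in> carrier N\<rbrakk> \<Longrightarrow> act a x \<in> carrier N"
    and act_add_left:
      "\<lbrakk>a \<in> carrier A; b \<in> carrier A; x \<in> carrier N\<rbrakk> \<Longrightarrow>
        act (a \<oplus>\<^bsub>A\<^esub> b) x = act a x \<oplus>\<^bsub>N\<^esub> act b x"
    and act_add_right:
      "\<lbrakk>a \<in> carrier A; x \<in> carrier N; y \<in> carrier N\<rbrakk> \<Longrightarrow>
        act a (x \<oplus>\<^bsub>N\<^esub> y) = act a x \<oplus>\<^bsub>N\<^esub> act a y"
    and act_mult:
      "\<lbrakk>a \<in> carrier A; b \<in> carrier A; x \<in> carrier N\<rbrakk> \<Longrightarrow> act (a \<otimes>\<^bsub>A\<^esub> b) x = act a (act b x)"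
    and act_one: "x \<in> carrier N \<Longrightarrow> act \<one>\<^bsub>A\<^esub> x = x"

definition linear_maps ::
    "('k, 'z) ring_scheme \<Rightarrow> ('k, 'm) module \<Rightarrow> ('k, 'n) module \<Rightarrow> ('m \<Rightarrow> 'n) set" where
  "linear_maps K M N =
    {h \<in> carrier M \<rightarrow> carrier N.
      (\<forall>x\<in>carrier M. \<forall>y\<in>carrier M. h (x \<oplus>\<^bsub>M\<^esub> y) = h x \<oplus>\<^bsub>N\<^esub> h y) \<and>
      (\<forall>k\<in>carrier K. \<forall>x\<in>carrier M. h (k \<odot>\<^bsub>M\<^esub> x) = k \<odot>\<^bsub>N\<^esub> h x)}"

definition signed :: "('m, 'z) ring_scheme \<Rightarrow> int \<Rightarrow> 'm \<Rightarrow> 'm" where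
  \<comment> \<open>\<open>(-1)\<^sup>n x\<close>\<close>
  "signed N n x = (if even n then x else \<ominus>\<^bsub>N\<^esub> x)"


section \<open>Tensor products of \<open>K\<close>-modules\<close>

definition tensor_relations ::
    "('k, 'z) ring_scheme \<Rightarrow> ('k, 'a) module \<Rightarrow> ('k, 'b) module \<Rightarrow> ('a \<times> 'b \<Rightarrow>\<^sub>0 int) set" where
  "tensor_relations K X Y =
    {frag_of (x \<oplus>\<^bsub>X\<^esub> x', y) - frag_of (x, y) - frag_of (x', y) | x x' y.
       x \<in> carrier X \<and> x' \<in> carrier X \<and> y \<in> carrier Y} \<union>
    {frag_of (x, y \<oplus>\<^bsub>Y\<^esub> y') - frag_of (x, y) - frag_of (x, y') | x y y'.
       x \<in> carrier X \<and> y \<in> carrier Y \<and> y' \<in> carrier Y} \<union>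
    {frag_of (k \<odot>\<^bsub>X\<^esub> x, y) - frag_of (x, k \<odot>\<^bsub>Y\<^esub> y) | k x y.
       k \<in> carrier K \<and> x \<in> carrier X \<and> y \<in> carrier Y}"

definition tensor_kernel ::
    "('k, 'z) ring_scheme \<Rightarrow> ('k, 'a) module \<Rightarrow> ('k, 'b) module \<Rightarrow> ('a \<times> 'b \<Rightarrow>\<^sub>0 int) set" where
  "tensor_kernel K X Y =
    generate (free_Abelian_group (carrier X \<times> carrier Y)) (tensor_relations K X Y)"

definition pure_tensor ::
    "('k, 'z) ring_scheme \<Rightarrow> ('k, 'a) module \<Rightarrow> ('k, 'b) module \<Rightarrow> 'a \<Rightarrow> 'b \<Rightarrow> ('a \<times> 'b \<Rightarrow>\<^sub>0 int) set" where
  "pure_tensor K X Y x y =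
    tensor_kernel K X Y #>\<^bsub>free_Abelian_group (carrier X \<times> carrier Y)\<^esub> frag_of (x, y)"

text \<open>The quotient group of the free abelian group, with \<open>k (x \<otimes> y) = k x \<otimes> y\<close>. The fields
  \<^const>\<open>mult\<close> and \<^const>\<open>one\<close> of the record are not used for modules.\<close>

definition tensor ::
    "('k, 'z) ring_scheme \<Rightarrow> ('k, 'a) module \<Rightarrow> ('k, 'b) module \<Rightarrow>
      ('k, ('a \<times> 'b \<Rightarrow>\<^sub>0 int) set) module" where
  "tensor K X Y =
    (let F = free_Abelian_group (carrier X \<times> carrier Y); Q = F Mod tensor_kernel K X Y in
     \<lparr>carrier = carrier Q, mult = (\<lambda>_ _. undefined), one = undefined,
      ring.zero = \<one>\<^bsub>Q\<^esub>, add = (\<otimes>\<^bsub>Q\<^esub>),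
      smult = (\<lambda>k T. \<Union>c\<in>T. tensor_kernel K X Y #>\<^bsub>F\<^esub> frag_extend (\<lambda>(x, y). frag_of (k \<odot>\<^bsub>X\<^esub> x, y)) c)\<rparr>)"

text \<open>The \<open>K\<close>-linear map on \<open>X \<otimes> Y\<close> determined by its values \<open>\<phi> x y\<close> on the pure tensors
  \<open>x \<otimes> y\<close>; it exists and is unique when \<open>\<phi>\<close> is \<open>K\<close>-bilinear.\<close>

definition tensor_lift ::
    "('k, 'z) ring_scheme \<Rightarrow> ('k, 'a) module \<Rightarrow> ('k, 'b) module \<Rightarrow> ('k, 'n) module \<Rightarrow>
      ('a \<Rightarrow> 'b \<Rightarrow> 'n) \<Rightarrow> ('a \<times> 'b \<Rightarrow>\<^sub>0 int) set \<Rightarrow> 'n" where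
  "tensor_lift K X Y N \<phi> =
    (THE h. h \<in> linear_maps K (tensor K X Y) N \<inter> extensional (carrier (tensor K X Y)) \<and>
      (\<forall>x\<in>carrier X. \<forall>y\<in>carrier Y. h (pure_tensor K X Y x y) = \<phi> x y))"


section \<open>Dg central \<open>K\<close>-rings\<close>

text \<open>Graded \<open>K\<close>-modules (and later the morphism complexes of dg categories) are given by the
  families of their homogeneous components, indexed by the integers; a general element is a finite
  sum of homogeneous ones, so multilinear operations are given on homogeneous elements. They take
  the degrees of their arguments as additional arguments, because the carriers of the components
  are not required to be disjoint.\<close>

record ('k, 'b) dg_ring =
  rgr :: "int \<Rightarrow> ('k, 'b) module"
  rmult :: "int \<Rightarrow> int \<Rightarrow> 'b \<Rightarrow> 'b \<Rightarrow> 'b"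
  rone :: 'b
  rdiff :: "int \<Rightarrow> 'b \<Rightarrow> 'b"

locale dg_central_ring = cring K for K :: "('k, 'z) ring_scheme" +
  fixes B :: "('k, 'b) dg_ring"
  assumes rgr_module: "module K (rgr B p)"
    and rmult_linear_right: "f \<in> carrier (rgr B p) \<Longrightarrow>
        rmult B p q f \<in> linear_maps K (rgr B q) (rgr B (p + q))"
    and rmult_linear_left: "g \<in> carrier (rgr B q) \<Longrightarrow>
        (\<lambda>f. rmult B p q f g) \<in> linear_maps K (rgr B p) (rgr B (p + q))"
    and rmult_assoc:
      "\<lbrakk>f \<in> carrier (rgr B p); g \<in> carrier (rgr B q); h \<in> carrier (rgr B r)\<rbrakk> \<Longrightarrow>
        rmult B (p + q) r (rmult B p q f g) h = rmult B p (q + r) f (rmult B q r g h)"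
    and rone_closed: "rone B \<in> carrier (rgr B 0)"
    and rone_left: "f \<in> carrier (rgr B p) \<Longrightarrow> rmult B 0 p (rone B) f = f"
    and rone_right: "f \<in> carrier (rgr B p) \<Longrightarrow> rmult B p 0 f (rone B) = f"
    and rdiff_linear: "rdiff B p \<in> linear_maps K (rgr B p) (rgr B (p + 1))"
    and rdiff_square: "f \<in> carrier (rgr B p) \<Longrightarrow>
        rdiff B (p + 1) (rdiff B p f) = \<zero>\<^bsub>rgr B (p + 2)\<^esub>"
    and rdiff_mult: "\<lbrakk>f \<in> carrier (rgr B p); g \<in> carrier (rgr B q)\<rbrakk> \<Longrightarrow>
        rdiff B (p + q) (rmult B p q f g) =
          rmult B (p + 1) q (rdiff B p f) g
          \<oplus>\<^bsub>rgr B (p + q + 1)\<^esub> signed (rgr B (p + q + 1)) p (rmult B p (q + 1) f (rdiff B q g))"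

definition tensor_dg_ring ::
    "('k, 'z) ring_scheme \<Rightarrow> ('k, 'a) module \<Rightarrow> ('k, 'b) dg_ring \<Rightarrow>
      ('k, ('a \<times> 'b \<Rightarrow>\<^sub>0 int) set) dg_ring" where
  "tensor_dg_ring K A B =
    \<lparr>rgr = (\<lambda>p. tensor K A (rgr B p)),
     rmult = (\<lambda>p q s t.
       tensor_lift K A (rgr B p) (tensor K A (rgr B (p + q)))
         (\<lambda>\<alpha> f. tensor_lift K A (rgr B q) (tensor K A (rgr B (p + q)))
           (\<lambda>\<beta> g. pure_tensor K A (rgr B (p + q)) (\<alpha> \<otimes>\<^bsub>A\<^esub> \<beta>) (rmult B p q f g)) t) s),
     rone = pure_tensor K A (rgr B 0) \<one>\<^bsub>A\<^esub> (rone B),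
     rdiff = (\<lambda>p. tensor_lift K A (rgr B p) (tensor K A (rgr B (p + 1)))
       (\<lambda>\<alpha> f. pure_tensor K A (rgr B (p + 1)) \<alpha> (rdiff B p f)))\<rparr>"


section \<open>Dg categories\<close>

record ('k, 'o, 'h) dg_cat =
  Obj :: "'o set"
  Hom :: "'o \<Rightarrow> 'o \<Rightarrow> int \<Rightarrow> ('k, 'h) module"
  Hdiff :: "'o \<Rightarrow> 'o \<Rightarrow> int \<Rightarrow> 'h \<Rightarrow> 'h"
  Comp :: "'o \<Rightarrow> 'o \<Rightarrow> 'o \<Rightarrow> int \<Rightarrow> int \<Rightarrow> 'h \<Rightarrow> 'h \<Rightarrow> 'h"
    \<comment> \<open>\<open>Comp C X Y Z s r v u\<close> is \<open>v \<circ> u\<close> for \<open>v : Y \<rightarrow> Z\<close> of degree \<open>s\<close>, \<open>u : X \<rightarrow> Y\<close> of degree \<open>r\<close>\<close>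
  Ident :: "'o \<Rightarrow> 'h"

locale dg_category = cring K for K :: "('k, 'z) ring_scheme" +
  fixes C :: "('k, 'o, 'h) dg_cat"
  assumes Hom_module: "\<lbrakk>X \<in> Obj C; Y \<in> Obj C\<rbrakk> \<Longrightarrow> module K (Hom C X Y r)"
    and Hdiff_linear: "\<lbrakk>X \<in> Obj C; Y \<in> Obj C\<rbrakk> \<Longrightarrow>
        Hdiff C X Y r \<in> linear_maps K (Hom C X Y r) (Hom C X Y (r + 1))"
    and Hdiff_square: "\<lbrakk>X \<in> Obj C; Y \<in> Obj C; u \<in> carrier (Hom C X Y r)\<rbrakk> \<Longrightarrow>
        Hdiff C X Y (r + 1) (Hdiff C X Y r u) = \<zero>\<^bsub>Hom C X Y (r + 2)\<^esub>"
    and Comp_linear_right: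
      "\<lbrakk>X \<in> Obj C; Y \<in> Obj C; Z \<in> Obj C; v \<in> carrier (Hom C Y Z s)\<rbrakk> \<Longrightarrow>
        Comp C X Y Z s r v \<in> linear_maps K (Hom C X Y r) (Hom C X Z (s + r))"
    and Comp_linear_left:
      "\<lbrakk>X \<in> Obj C; Y \<in> Obj C; Z \<in> Obj C; u \<in> carrier (Hom C X Y r)\<rbrakk> \<Longrightarrow>
        (\<lambda>v. Comp C X Y Z s r v u) \<in> linear_maps K (Hom C Y Z s) (Hom C X Z (s + r))"
    and Comp_assoc:
      "\<lbrakk>W \<in> Obj C; X \<in> Obj C; Y \<in> Obj C; Z \<in> Obj C; w \<in> carrier (Hom C Y Z t);
        v \<in> carrier (Hom C X Y s); u \<in> carrier (Hom C W X r)\<rbrakk> \<Longrightarrow>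
        Comp C W X Z (t + s) r (Comp C X Y Z t s w v) u =
        Comp C W Y Z t (s + r) w (Comp C W X Y s r v u)"
    and Ident_closed: "X \<in> Obj C \<Longrightarrow> Ident C X \<in> carrier (Hom C X X 0)"
    and Ident_left: "\<lbrakk>X \<in> Obj C; Y \<in> Obj C; u \<in> carrier (Hom C X Y r)\<rbrakk> \<Longrightarrow>
        Comp C X Y Y 0 r (Ident C Y) u = u"
    and Ident_right: "\<lbrakk>X \<in> Obj C; Y \<in> Obj C; u \<in> carrier (Hom C X Y r)\<rbrakk> \<Longrightarrow>
        Comp C X X Y r 0 u (Ident C X) = u"
    and Hdiff_Comp:
      "\<lbrakk>X \<in> Obj C; Y \<in> Obj C; Z \<in> Obj C; v \<in> carrier (Hom C Y Z s); u \<in> carrier (Hom C X Y r)\<rbrakk> \<Longrightarrow>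
        Hdiff C X Z (s + r) (Comp C X Y Z s r v u) =
          Comp C X Y Z (s + 1) r (Hdiff C Y Z s v) u
          \<oplus>\<^bsub>Hom C X Z (s + r + 1)\<^esub>
          signed (Hom C X Z (s + r + 1)) s (Comp C X Y Z s (r + 1) v (Hdiff C X Y r u))"

locale dg_functor = source: dg_category K C + target: dg_category K D
  for K :: "('k, 'z) ring_scheme" and C :: "('k, 'o, 'h) dg_cat" and D :: "('k, 'p, 'i) dg_cat" +
  fixes Fo :: "'o \<Rightarrow> 'p" and Fh :: "'o \<Rightarrow> 'o \<Rightarrow> int \<Rightarrow> 'h \<Rightarrow> 'i"
  assumes Fo_closed: "X \<in> Obj C \<Longrightarrow> Fo X \<in> Obj D"
    and Fh_linear: "\<lbrakk>X \<in> Obj C; Y \<in> Obj C\<rbrakk> \<Longrightarrow>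
        Fh X Y r \<in> linear_maps K (Hom C X Y r) (Hom D (Fo X) (Fo Y) r)"
    and Fh_Hdiff: "\<lbrakk>X \<in> Obj C; Y \<in> Obj C; u \<in> carrier (Hom C X Y r)\<rbrakk> \<Longrightarrow>
        Fh X Y (r + 1) (Hdiff C X Y r u) = Hdiff D (Fo X) (Fo Y) r (Fh X Y r u)"
    and Fh_Comp:
      "\<lbrakk>X \<in> Obj C; Y \<in> Obj C; Z \<in> Obj C; v \<in> carrier (Hom C Y Z s); u \<in> carrier (Hom C X Y r)\<rbrakk> \<Longrightarrow>
        Fh X Z (s + r) (Comp C X Y Z s r v u) =
        Comp D (Fo X) (Fo Y) (Fo Z) s r (Fh Y Z s v) (Fh X Y r u)"
    and Fh_Ident: "X \<in> Obj C \<Longrightarrow> Fh X X 0 (Ident C X) = Ident D (Fo X)"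

definition dg_isomorphism ::
    "('k, 'z) ring_scheme \<Rightarrow> ('k, 'o, 'h) dg_cat \<Rightarrow> ('k, 'p, 'i) dg_cat \<Rightarrow>
      ('o \<Rightarrow> 'p) \<Rightarrow> ('o \<Rightarrow> 'o \<Rightarrow> int \<Rightarrow> 'h \<Rightarrow> 'i) \<Rightarrow> bool" where
  "dg_isomorphism K C D Fo Fh \<longleftrightarrow>
    dg_functor K C D Fo Fh \<and>
    (\<exists>Go Gh. dg_functor K D C Go Gh \<and>
      (\<forall>X\<in>Obj C. Go (Fo X) = X) \<and>
      (\<forall>X\<in>Obj D. Fo (Go X) = X) \<and>
      (\<forall>X\<in>Obj C. \<forall>Y\<in>Obj C. \<forall>r. \<forall>u\<in>carrier (Hom C X Y r). Gh (Fo X) (Fo Y) r (Fh X Y r u) = u) \<and>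
      (\<forall>X\<in>Obj D. \<forall>Y\<in>Obj D. \<forall>r. \<forall>u\<in>carrier (Hom D X Y r). Fh (Go X) (Go Y) r (Gh X Y r u) = u))"


section \<open>Dg modules\<close>

record ('k, 'b, 'm) dg_mod =
  mgr :: "int \<Rightarrow> ('k, 'm) module"
  mact :: "int \<Rightarrow> int \<Rightarrow> 'b \<Rightarrow> 'm \<Rightarrow> 'm"
    \<comment> \<open>\<open>mact M p q f x\<close> is \<open>f.x\<close> for \<open>f\<close> of degree \<open>p\<close> and \<open>x\<close> of degree \<open>q\<close>\<close>
  mdiff :: "int \<Rightarrow> 'm \<Rightarrow> 'm"

text \<open>An isomorphism of categories is bijective on objects. So that two records are equal when
  they describe the same dg module, the values of all operations outside their domains (and the
  unused fields \<^const>\<open>mult\<close> and \<^const>\<open>one\<close>) are fixed to be \<^const>\<open>undefined\<close>.\<close>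

definition normal_module :: "('k, 'z) ring_scheme \<Rightarrow> ('k, 'm) module \<Rightarrow> bool" where
  "normal_module K N \<longleftrightarrow>
    mult N = (\<lambda>_ _. undefined) \<and> one N = undefined \<and>
    case_prod (add N) \<in> extensional (carrier N \<times> carrier N) \<and>
    case_prod (smult N) \<in> extensional (carrier K \<times> carrier N)"

locale dg_module = dg_central_ring K B for K :: "('k, 'z) ring_scheme" and B :: "('k, 'b) dg_ring" +
  fixes M :: "('k, 'b, 'm, 'y) dg_mod_scheme"
  assumes mgr_module: "module K (mgr M q)"
    and mact_linear_right: "f \<in> carrier (rgr B p) \<Longrightarrow>
        mact M p q f \<in> linear_maps K (mgr M q) (mgr M (p + q))"
    and mact_linear_left: "x \<in> carrier (mgr M q) \<Longrightarrow>
        (\<lambda>f. mact M p q f x) \<in> linear_maps K (rgr B p) (mgr M (p + q))"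
    and mact_mult:
      "\<lbrakk>f \<in> carrier (rgr B p); g \<in> carrier (rgr B p'); x \<in> carrier (mgr M q)\<rbrakk> \<Longrightarrow>
        mact M (p + p') q (rmult B p p' f g) x = mact M p (p' + q) f (mact M p' q g x)"
    and mact_one: "x \<in> carrier (mgr M q) \<Longrightarrow> mact M 0 q (rone B) x = x"
    and mdiff_linear: "mdiff M q \<in> linear_maps K (mgr M q) (mgr M (q + 1))"
    and mdiff_square: "x \<in> carrier (mgr M q) \<Longrightarrow>
        mdiff M (q + 1) (mdiff M q x) = \<zero>\<^bsub>mgr M (q + 2)\<^esub>"
    and mdiff_mact: "\<lbrakk>f \<in> carrier (rgr B p); x \<in> carrier (mgr M q)\<rbrakk> \<Longrightarrow>
        mdiff M (p + q) (mact M p q f x) =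
          mact M (p + 1) q (rdiff B p f) x
          \<oplus>\<^bsub>mgr M (p + q + 1)\<^esub> signed (mgr M (p + q + 1)) p (mact M p (q + 1) f (mdiff M q x))"
    and mgr_normal: "normal_module K (mgr M q)"
    and mact_normal: "case_prod (mact M p q) \<in> extensional (carrier (rgr B p) \<times> carrier (mgr M q))"
    and mdiff_normal: "mdiff M q \<in> extensional (carrier (mgr M q))"

text \<open>Dg \<open>B\<close>-modules in \<open>A-Mod\<close>. The condition \<open>(k \<alpha>) x = k (\<alpha> x)\<close> says that the actions of \<open>A\<close> and
  \<open>B\<close> induce the same \<open>K\<close>-module structure on \<open>M\<close>, i.e. that \<open>B\<close> acts \<open>K\<close>-linearly in the
  \<open>K\<close>-linear category \<open>A-Mod\<close>.\<close>

record ('k, 'a, 'b, 'm) dg_mod_in = "('k, 'b, 'm) dg_mod" +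
  mactA :: "int \<Rightarrow> 'a \<Rightarrow> 'm \<Rightarrow> 'm"

locale dg_module_in = dg_module K B M + A: central_ring K A
  for K :: "('k, 'z) ring_scheme" and A :: "('k, 'a) module" and B :: "('k, 'b) dg_ring"
    and M :: "('k, 'a, 'b, 'm) dg_mod_in" +
  assumes mactA_module: "left_module A (mgr M q) (mactA M q)"
    and mactA_smult: "\<lbrakk>k \<in> carrier K; \<alpha> \<in> carrier A; x \<in> carrier (mgr M q)\<rbrakk> \<Longrightarrow>
        mactA M q (k \<odot>\<^bsub>A\<^esub> \<alpha>) x = k \<odot>\<^bsub>mgr M q\<^esub> mactA M q \<alpha> x"
    and mactA_mact:
      "\<lbrakk>\<alpha> \<in> carrier A; f \<in> carrier (rgr B p); x \<in> carrier (mgr M q)\<rbrakk> \<Longrightarrow>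
        mactA M (p + q) \<alpha> (mact M p q f x) = mact M p q f (mactA M q \<alpha> x)"
    and mdiff_mactA: "\<lbrakk>\<alpha> \<in> carrier A; x \<in> carrier (mgr M q)\<rbrakk> \<Longrightarrow>
        mdiff M q (mactA M q \<alpha> x) = mactA M (q + 1) \<alpha> (mdiff M q x)"
    and mactA_normal: "case_prod (mactA M q) \<in> extensional (carrier A \<times> carrier (mgr M q))"


section \<open>The dg categories of dg modules\<close>

text \<open>A morphism of degree \<open>r\<close> is a family of maps \<open>u q\<close> from degree \<open>q\<close> to degree \<open>q + r\<close>.\<close>

definition dg_homs ::
    "('k, 'z) ring_scheme \<Rightarrow> ('k, 'b) dg_ring \<Rightarrow> ('k, 'b, 'm, 'y) dg_mod_scheme \<Rightarrow>
      ('k, 'b, 'm, 'y) dg_mod_scheme \<Rightarrow> int \<Rightarrow> (int \<Rightarrow> 'm \<Rightarrow> 'm) set" where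
  "dg_homs K B M M' r =
    {u. (\<forall>q. u q \<in> linear_maps K (mgr M q) (mgr M' (q + r)) \<inter> extensional (carrier (mgr M q))) \<and>
      (\<forall>p q. \<forall>f\<in>carrier (rgr B p). \<forall>x\<in>carrier (mgr M q).
        u (p + q) (mact M p q f x) = signed (mgr M' (p + q + r)) (p * r) (mact M' p (q + r) f (u q x)))}"

definition dg_homs_in ::
    "('k, 'z) ring_scheme \<Rightarrow> ('k, 'a) module \<Rightarrow> ('k, 'b) dg_ring \<Rightarrow> ('k, 'a, 'b, 'm) dg_mod_in \<Rightarrow>
      ('k, 'a, 'b, 'm) dg_mod_in \<Rightarrow> int \<Rightarrow> (int \<Rightarrow> 'm \<Rightarrow> 'm) set" where
  "dg_homs_in K A B M M' r =
    {u \<in> dg_homs K B M M' r.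
      \<forall>q. \<forall>\<alpha>\<in>carrier A. \<forall>x\<in>carrier (mgr M q). u q (mactA M q \<alpha> x) = mactA M' (q + r) \<alpha> (u q x)}"

definition hom_module ::
    "(int \<Rightarrow> 'm \<Rightarrow> 'm) set \<Rightarrow> ('k, 'b, 'm, 'y) dg_mod_scheme \<Rightarrow>
      ('k, 'b, 'm, 'y) dg_mod_scheme \<Rightarrow> int \<Rightarrow> ('k, int \<Rightarrow> 'm \<Rightarrow> 'm) module" where
  "hom_module H M M' r =
    \<lparr>carrier = H, mult = (\<lambda>_ _. undefined), one = undefined,
     ring.zero = (\<lambda>q. \<lambda>x\<in>carrier (mgr M q). \<zero>\<^bsub>mgr M' (q + r)\<^esub>),
     add = (\<lambda>u v q. \<lambda>x\<in>carrier (mgr M q). u q x \<oplus>\<^bsub>mgr M' (q + r)\<^esub> v q x),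
     smult = (\<lambda>k u q. \<lambda>x\<in>carrier (mgr M q). k \<odot>\<^bsub>mgr M' (q + r)\<^esub> u q x)\<rparr>"

definition hom_diff ::
    "('k, 'b, 'm, 'y) dg_mod_scheme \<Rightarrow> ('k, 'b, 'm, 'y) dg_mod_scheme \<Rightarrow> int \<Rightarrow>
      (int \<Rightarrow> 'm \<Rightarrow> 'm) \<Rightarrow> int \<Rightarrow> 'm \<Rightarrow> 'm" where
  "hom_diff M M' r u = (\<lambda>q. \<lambda>x\<in>carrier (mgr M q).
    mdiff M' (q + r) (u q x)
    \<ominus>\<^bsub>mgr M' (q + r + 1)\<^esub> signed (mgr M' (q + r + 1)) r (u (q + 1) (mdiff M q x)))"

definition hom_comp ::
    "('k, 'b, 'm, 'y) dg_mod_scheme \<Rightarrow> int \<Rightarrow> (int \<Rightarrow> 'm \<Rightarrow> 'm) \<Rightarrow> (int \<Rightarrow> 'm \<Rightarrow> 'm) \<Rightarrow> int \<Rightarrow> 'm \<Rightarrow> 'm" where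
  "hom_comp M r v u = (\<lambda>q. compose (carrier (mgr M q)) (v (q + r)) (u q))"

definition hom_ident :: "('k, 'b, 'm, 'y) dg_mod_scheme \<Rightarrow> int \<Rightarrow> 'm \<Rightarrow> 'm" where
  "hom_ident M = (\<lambda>q. \<lambda>x\<in>carrier (mgr M q). x)"

definition dg_modules ::
    "('k, 'z) ring_scheme \<Rightarrow> ('k, 'b) dg_ring \<Rightarrow> ('k, ('k, 'b, 'm) dg_mod, int \<Rightarrow> 'm \<Rightarrow> 'm) dg_cat" where
  \<comment> \<open>\<open>\<C>(B)\<close>\<close>
  "dg_modules K B =
    \<lparr>Obj = {M. dg_module K B M},
     Hom = (\<lambda>M M' r. hom_module (dg_homs K B M M' r) M M' r),
     Hdiff = hom_diff,
     Comp = (\<lambda>M M' M'' s r. hom_comp M r),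
     Ident = hom_ident\<rparr>"

definition dg_modules_in ::
    "('k, 'z) ring_scheme \<Rightarrow> ('k, 'a) module \<Rightarrow> ('k, 'b) dg_ring \<Rightarrow>
      ('k, ('k, 'a, 'b, 'm) dg_mod_in, int \<Rightarrow> 'm \<Rightarrow> 'm) dg_cat" where
  \<comment> \<open>\<open>\<C>(B, A-Mod)\<close>\<close>
  "dg_modules_in K A B =
    \<lparr>Obj = {M. dg_module_in K A B M},
     Hom = (\<lambda>M M' r. hom_module (dg_homs_in K A B M M' r) M M' r),
     Hdiff = hom_diff,
     Comp = (\<lambda>M M' M'' s r. hom_comp M r),
     Ident = hom_ident\<rparr>"


section \<open>The functor \<open>\<Phi> : \<C>(B, A-Mod) \<rightarrow> \<C>(A \<otimes> B)\<close>\<close>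

definition Phi_obj ::
    "('k, 'z) ring_scheme \<Rightarrow> ('k, 'a) module \<Rightarrow> ('k, 'b) dg_ring \<Rightarrow> ('k, 'a, 'b, 'm) dg_mod_in \<Rightarrow>
      ('k, ('a \<times> 'b \<Rightarrow>\<^sub>0 int) set, 'm) dg_mod" where
  \<comment> \<open>\<open>(\<alpha> \<otimes> f).x = \<alpha> (f.x)\<close>\<close>
  "Phi_obj K A B M =
    \<lparr>mgr = mgr M,
     mact = (\<lambda>p q t x.
       if t \<in> carrier (tensor K A (rgr B p)) \<and> x \<in> carrier (mgr M q)
       then tensor_lift K A (rgr B p) (mgr M (p + q)) (\<lambda>\<alpha> f. mactA M (p + q) \<alpha> (mact M p q f x)) t
       else undefined),
     mdiff = mdiff M\<rparr>"

definition Phi_hom ::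
    "('k, 'a, 'b, 'm) dg_mod_in \<Rightarrow> ('k, 'a, 'b, 'm) dg_mod_in \<Rightarrow> int \<Rightarrow>
      (int \<Rightarrow> 'm \<Rightarrow> 'm) \<Rightarrow> int \<Rightarrow> 'm \<Rightarrow> 'm" where
  "Phi_hom M M' r u = u"

end

(* A dg (A (x) B)-module N carries the commuting actions alpha x = (alpha (x) 1).x and
   f.x = (1 (x) f).x, and alpha (x) f = (alpha (x) 1)(1 (x) f) shows that they determine the given
   action; this inverts Phi on objects. Since pure tensors generate A (x) B, a graded map is
   (A (x) B)-linear with the Koszul sign iff it is A-linear and B-linear with the same sign
   (A sits in degree 0). Hence the morphism complexes of M, M' and of Phi M, Phi M' are literally
   equal, with the same differential and composition, so the dg category axioms need to be
   checked only for C(A (x) B) and carry over to C(B, A-Mod). *)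

theory Submission
  imports Defs
begin

section \<open>Linear and bilinear maps\<close>

text \<open>The tensor product is a concrete quotient of a free abelian group, and the product, the
  differential and the action of A \<otimes> B are given by \<open>tensor_lift\<close>, a definite
  description. Nothing can be computed with them before the universal property is known for these
  cosets; afterwards an identity between multilinear expressions is tested on pure tensors. The
  product is a lift inside a lift, so linearity in its inner argument needs an argument of its own.
  Two facts are hidden in the correspondence of objects. The lift of \<alpha>(f.x) makes sense only
  if this expression is K-bilinear in \<alpha> and f, which rests on the agreement of the
  K-structures coming from A and from B. Conversely, the differential commutes with the action of
  \<alpha> \<otimes> 1 only because b(1) = 0. Objects are compared as records, so values outside the
  domains have to match as well. Degrees are integers and not part of the types: the modules in
  degrees p + (q + r) and p + q + r coincide only after arithmetic, which is the purpose of the many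
  rewritings with \<open>add.assoc\<close> and \<open>ac_simps\<close>.\<close>

lemma linear_mapsI:
  assumes "\<And>x. x \<in> carrier M \<Longrightarrow> h x \<in> carrier N"
    and "\<And>x y. \<lbrakk>x \<in> carrier M; y \<in> carrier M\<rbrakk> \<Longrightarrow> h (x \<oplus>\<^bsub>M\<^esub> y) = h x \<oplus>\<^bsub>N\<^esub> h y"
    and "\<And>k x. \<lbrakk>k \<in> carrier K; x \<in> carrier M\<rbrakk> \<Longrightarrow> h (k \<odot>\<^bsub>M\<^esub> x) = k \<odot>\<^bsub>N\<^esub> h x"
  shows "h \<in> linear_maps K M N"
  using assms by (simp add: linear_maps_def)

lemma linear_maps_closed: "\<lbrakk>h \<in> linear_maps K M N; x \<in> carrier M\<rbrakk> \<Longrightarrow> h x \<in> carrier N"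
  by (auto simp: linear_maps_def)

lemma linear_maps_add:
  "\<lbrakk>h \<in> linear_maps K M N; x \<in> carrier M; y \<in> carrier M\<rbrakk> \<Longrightarrow> h (x \<oplus>\<^bsub>M\<^esub> y) = h x \<oplus>\<^bsub>N\<^esub> h y"
  by (auto simp: linear_maps_def)

lemma linear_maps_smult:
  "\<lbrakk>h \<in> linear_maps K M N; k \<in> carrier K; x \<in> carrier M\<rbrakk> \<Longrightarrow> h (k \<odot>\<^bsub>M\<^esub> x) = k \<odot>\<^bsub>N\<^esub> h x"
  by (auto simp: linear_maps_def)

text \<open>Additivity and homogeneity also involve the values at sums and multiples, which lie in
  the carrier because \<open>M\<close> is a module. Used to pass between a map and its restriction,
  or a formula valid on the carrier only.\<close>

lemma linear_maps_cong:
  assumes "module K M" and "\<And>x. x \<in> carrier M \<Longrightarrow> h x = h' x"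
  shows "h \<in> linear_maps K M N \<longleftrightarrow> h' \<in> linear_maps K M N"
proof -
  interpret module K M by fact
  show ?thesis
    using assms(2) by (auto simp: linear_maps_def Pi_def)
qed

lemma linear_maps_congI:
  assumes "module K M" and "h' \<in> linear_maps K M N" and "\<And>x. x \<in> carrier M \<Longrightarrow> h x = h' x"
  shows "h \<in> linear_maps K M N"
  using linear_maps_cong[OF assms(1), of h h' N] assms(2,3) by simp

lemma linear_maps_compose:
  "\<lbrakk>g \<in> linear_maps K N P; h \<in> linear_maps K M N\<rbrakk> \<Longrightarrow> (\<lambda>x. g (h x)) \<in> linear_maps K M P"
  by (auto simp: linear_maps_def Pi_def)

lemma linear_maps_zero:
  assumes "module K M" "module K N" "h \<in> linear_maps K M N"
  shows "h \<zero>\<^bsub>M\<^esub> = \<zero>\<^bsub>N\<^esub>"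
proof -
  interpret M: module K M by fact
  interpret N: module K N by fact
  have "h (\<zero>\<^bsub>K\<^esub> \<odot>\<^bsub>M\<^esub> \<zero>\<^bsub>M\<^esub>) = \<zero>\<^bsub>K\<^esub> \<odot>\<^bsub>N\<^esub> h \<zero>\<^bsub>M\<^esub>"
    by (intro linear_maps_smult[OF assms(3)]) auto
  then show ?thesis
    using linear_maps_closed[OF assms(3)] by simp
qed

lemma linear_maps_minus:
  assumes "module K M" "module K N" "h \<in> linear_maps K M N" "x \<in> carrier M"
  shows "h (\<ominus>\<^bsub>M\<^esub> x) = \<ominus>\<^bsub>N\<^esub> h x"
proof -
  interpret M: module K M by fact
  interpret N: module K N by fact
  have "h x \<oplus>\<^bsub>N\<^esub> h (\<ominus>\<^bsub>M\<^esub> x) = h (x \<oplus>\<^bsub>M\<^esub> \<ominus>\<^bsub>M\<^esub> x)"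
    using assms by (simp add: linear_maps_add[OF assms(3)])
  then have "h x \<oplus>\<^bsub>N\<^esub> h (\<ominus>\<^bsub>M\<^esub> x) = \<zero>\<^bsub>N\<^esub>"
    using assms by (simp add: M.r_neg linear_maps_zero)
  then show ?thesis
    using assms linear_maps_closed[OF assms(3)]
    by (metis M.M.a_inv_closed N.M.minus_equality N.M.add.m_comm)
qed

lemma linear_maps_signed:
  assumes "module K M" "module K N" "h \<in> linear_maps K M N" "x \<in> carrier M"
  shows "h (signed M n x) = signed N n (h x)"
  using assms by (simp add: signed_def linear_maps_minus)

lemma linear_maps_plus:
  assumes "module K N" "g \<in> linear_maps K M N" "h \<in> linear_maps K M N"
  shows "(\<lambda>x. g x \<oplus>\<^bsub>N\<^esub> h x) \<in> linear_maps K M N"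
proof -
  interpret N: module K N by fact
  show ?thesis
    by (rule linear_mapsI)
      (simp_all add: linear_maps_closed[OF assms(2)] linear_maps_closed[OF assms(3)]
        linear_maps_add[OF assms(2)] linear_maps_add[OF assms(3)] linear_maps_smult[OF assms(2)]
        linear_maps_smult[OF assms(3)] N.smult_r_distr N.M.add.m_assoc N.M.add.m_lcomm)
qed

text \<open>Commutativity of \<open>K\<close> enters here: l(k h(x)) and k(l h(x)) must
  agree.\<close>

lemma linear_maps_scale:
  assumes "module K N" "h \<in> linear_maps K M N" "k \<in> carrier K"
  shows "(\<lambda>x. k \<odot>\<^bsub>N\<^esub> h x) \<in> linear_maps K M N"
proof -
  interpret N: module K N by fact
  show ?thesis
    by (rule linear_mapsI)
      (use assms(3) in \<open>simp_all add: linear_maps_closed[OF assms(2)]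
        linear_maps_add[OF assms(2)] linear_maps_smult[OF assms(2)] N.smult_r_distr
        N.smult_assoc1[symmetric] N.R.m_comm\<close>)
qed

lemma linear_maps_uminus:
  assumes "module K N"
  shows "a_inv N \<in> linear_maps K N N"
proof -
  interpret N: module K N by fact
  show ?thesis
    by (rule linear_mapsI) (simp_all add: N.M.minus_add N.smult_r_minus)
qed

lemma linear_maps_diff:
  assumes "module K N" "g \<in> linear_maps K M N" "h \<in> linear_maps K M N"
  shows "(\<lambda>x. g x \<ominus>\<^bsub>N\<^esub> h x) \<in> linear_maps K M N"
  unfolding a_minus_def
  by (rule linear_maps_plus[OF assms(1,2) linear_maps_compose[OF linear_maps_uminus[OF assms(1)] assms(3)]])

lemma linear_maps_a_minus:
  assumes "module K M" "module K N" "h \<in> linear_maps K M N" "x \<in> carrier M" "y \<in> carrier M"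
  shows "h (x \<ominus>\<^bsub>M\<^esub> y) = h x \<ominus>\<^bsub>N\<^esub> h y"
proof -
  interpret M: module K M by fact
  show ?thesis
    using assms by (simp add: a_minus_def linear_maps_add[OF assms(3)] linear_maps_minus)
qed

text \<open>Treating a sign as a linear map brings it under the composition lemmas and avoids a
  parity split in each later proof.\<close>

lemma linear_maps_sign:
  assumes "module K N"
  shows "signed N n \<in> linear_maps K N N"
proof (cases "even n")
  case True
  then show ?thesis by (auto simp: signed_def linear_maps_def)
next
  case False
  then have "signed N n = a_inv N" by (auto simp: signed_def)
  then show ?thesis using linear_maps_uminus[OF assms] by simp
qed

lemma signed_closed:
  fixes N :: "('k, 'n) module"
  assumes "module K N" "x \<in> carrier N"
  shows "signed N n x \<in> carrier N"
  using linear_maps_closed[OF linear_maps_sign[OF assms(1)] assms(2)] .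

lemma signed_signed:
  assumes "module K N" "x \<in> carrier N"
  shows "signed N m (signed N n x) = signed N (m + n) x"
proof -
  interpret N: module K N by fact
  show ?thesis using assms(2) by (auto simp: signed_def)
qed

text \<open>Curried and split into the two partial maps, so that membership is proved by composing
  linear maps in one argument at a time.\<close>

definition bilinear_maps ::
    "('k, 'z) ring_scheme \<Rightarrow> ('k, 'a) module \<Rightarrow> ('k, 'b) module \<Rightarrow> ('k, 'n) module \<Rightarrow> ('a \<Rightarrow> 'b \<Rightarrow> 'n) set" where
  "bilinear_maps K X Y N =
    {\<phi>. (\<forall>x\<in>carrier X. \<phi> x \<in> linear_maps K Y N) \<and> (\<forall>y\<in>carrier Y. (\<lambda>x. \<phi> x y) \<in> linear_maps K X N)}"

lemma bilinear_mapsI: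
  assumes "\<And>x. x \<in> carrier X \<Longrightarrow> \<phi> x \<in> linear_maps K Y N"
    and "\<And>y. y \<in> carrier Y \<Longrightarrow> (\<lambda>x. \<phi> x y) \<in> linear_maps K X N"
  shows "\<phi> \<in> bilinear_maps K X Y N"
  using assms by (simp add: bilinear_maps_def)

lemma bilinear_maps_left: "\<lbrakk>\<phi> \<in> bilinear_maps K X Y N; y \<in> carrier Y\<rbrakk> \<Longrightarrow> (\<lambda>x. \<phi> x y) \<in> linear_maps K X N"
  and bilinear_maps_right: "\<lbrakk>\<phi> \<in> bilinear_maps K X Y N; x \<in> carrier X\<rbrakk> \<Longrightarrow> \<phi> x \<in> linear_maps K Y N"
  by (simp_all add: bilinear_maps_def)


section \<open>The tensor product of modules\<close>

locale module_pair = X: module K X + Y: module K Y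
  for K :: "('k, 'z) ring_scheme" and X :: "('k, 'a) module" and Y :: "('k, 'b) module"
begin

abbreviation F where "F \<equiv> free_Abelian_group (carrier X \<times> carrier Y)"
abbreviation N where "N \<equiv> tensor_kernel K X Y"
abbreviation T where "T \<equiv> tensor K X Y"
abbreviation cls where "cls c \<equiv> N #>\<^bsub>F\<^esub> c"
abbreviation pt where "pt \<equiv> pure_tensor K X Y"
abbreviation scale where "scale k \<equiv> frag_extend (\<lambda>(x, y). frag_of (k \<odot>\<^bsub>X\<^esub> x, y))"

sublocale F: comm_group F
  by (rule abelian_free_Abelian_group)

lemma tensor_relationsE:
  assumes "r \<in> tensor_relations K X Y"
  obtains
    (1) x x' y where "r = frag_of (x \<oplus>\<^bsub>X\<^esub> x', y) - frag_of (x, y) - frag_of (x', y)"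
      "x \<in> carrier X" "x' \<in> carrier X" "y \<in> carrier Y"
  | (2) x y y' where "r = frag_of (x, y \<oplus>\<^bsub>Y\<^esub> y') - frag_of (x, y) - frag_of (x, y')"
      "x \<in> carrier X" "y \<in> carrier Y" "y' \<in> carrier Y"
  | (3) k x y where "r = frag_of (k \<odot>\<^bsub>X\<^esub> x, y) - frag_of (x, k \<odot>\<^bsub>Y\<^esub> y)"
      "k \<in> carrier K" "x \<in> carrier X" "y \<in> carrier Y"
  using assms unfolding tensor_relations_def by blast

lemma tensor_relations_subset: "tensor_relations K X Y \<subseteq> carrier F"
  unfolding tensor_relations_def
  by (auto simp: keys_frag_of dest!: subsetD[OF keys_diff])

lemma kernel_subgroup: "subgroup N F"
  unfolding tensor_kernel_def by (rule F.generate_is_subgroup[OF tensor_relations_subset])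

lemma kernel_normal: "N \<lhd> F"
  using kernel_subgroup by (rule F.subgroup_imp_normal)

lemma kernel_relation: "r \<in> tensor_relations K X Y \<Longrightarrow> r \<in> N"
  unfolding tensor_kernel_def by (rule generate.incl)

lemma kernel_subset: "N \<subseteq> carrier F"
  using kernel_subgroup by (rule subgroup.subset)

text \<open>The group operation of \<open>F\<close> is addition of finitely supported functions, so
  the product of c with the inverse of d is \<open>c - d\<close>.\<close>

lemma cls_eq_iff:
  assumes "c \<in> carrier F" "d \<in> carrier F"
  shows "cls c = cls d \<longleftrightarrow> c - d \<in> N"
proof
  assume "cls c = cls d"
  then have "c \<in> cls d" using F.rcos_self[OF assms(1) kernel_subgroup] by simp
  then show "c - d \<in> N" by (auto simp: r_coset_def)
next
  assume "c - d \<in> N"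
  then have "c \<in> cls d" by (force simp: r_coset_def intro!: bexI[of _ "c - d"])
  then show "cls c = cls d" using F.repr_independence[OF _ assms(2) kernel_subgroup] by simp
qed

lemma carrier_tensor: "carrier T = cls ` carrier F"
  by (simp add: tensor_def Let_def carrier_FactGroup)

lemma cls_closed: "c \<in> carrier F \<Longrightarrow> cls c \<in> carrier T"
  by (auto simp: carrier_tensor)

lemma tensor_add:
  assumes "c \<in> carrier F" "d \<in> carrier F" shows "cls c \<oplus>\<^bsub>T\<^esub> cls d = cls (c + d)"
  using normal.rcos_sum[OF kernel_normal assms] by (simp add: tensor_def Let_def)

lemma tensor_zero: "\<zero>\<^bsub>T\<^esub> = cls 0"
  using F.coset_join2[OF _ kernel_subgroup] subgroup.one_closed[OF kernel_subgroup]
  by (simp add: tensor_def Let_def)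

lemma tensor_comm_group: "comm_group (add_monoid T)"
proof -
  interpret Q: comm_group "F Mod N"
    using F.abelian_FactGroup[OF kernel_subgroup] .
  have eq: "carrier T = carrier (F Mod N)" "add T = (\<otimes>\<^bsub>F Mod N\<^esub>)" "\<zero>\<^bsub>T\<^esub> = \<one>\<^bsub>F Mod N\<^esub>"
    by (simp_all add: tensor_def Let_def)
  show ?thesis
    by (rule comm_groupI)
      (simp_all add: eq Q.m_assoc Q.l_inv_ex Q.m_closed del: mult_FactGroup one_FactGroup, rule Q.m_comm)
qed

lemma scale_hom:
  assumes "k \<in> carrier K" shows "scale k \<in> hom F F"
proof (rule homI)
  fix c assume "c \<in> carrier F"
  then have "Poly_Mapping.keys c \<subseteq> carrier X \<times> carrier Y" by simp
  then show "scale k c \<in> carrier F"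
    using keys_frag_extend[of "\<lambda>(x, y). frag_of (k \<odot>\<^bsub>X\<^esub> x, y)" c] assms
    by (fastforce simp: keys_frag_of)
qed (simp add: frag_extend_add)

lemma scale_closed: "\<lbrakk>k \<in> carrier K; c \<in> carrier F\<rbrakk> \<Longrightarrow> scale k c \<in> carrier F"
  using hom_in_carrier[OF scale_hom] by blast

text \<open>Scalar multiplication of a coset is defined through all its representatives; this makes
  it well defined. Scaling the first factor is additive and sends each defining relation to a
  defining relation, hence preserves the subgroup they generate.\<close>

lemma scale_kernel:
  assumes k: "k \<in> carrier K" and "c \<in> N" shows "scale k c \<in> N"
proof -
  have rel: "scale k r \<in> N" if "r \<in> tensor_relations K X Y" for r
  proof (rule kernel_relation)
    from that show "scale k r \<in> tensor_relations K X Y"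
    proof (cases rule: tensor_relationsE)
      case (1 x x' y)
      then have "scale k r = frag_of (k \<odot>\<^bsub>X\<^esub> x \<oplus>\<^bsub>X\<^esub> k \<odot>\<^bsub>X\<^esub> x', y) - frag_of (k \<odot>\<^bsub>X\<^esub> x, y) - frag_of (k \<odot>\<^bsub>X\<^esub> x', y)"
        using k by (simp add: frag_extend_diff X.smult_r_distr)
      moreover have "k \<odot>\<^bsub>X\<^esub> x \<in> carrier X" "k \<odot>\<^bsub>X\<^esub> x' \<in> carrier X" using 1 k by auto
      ultimately show ?thesis using 1(4) unfolding tensor_relations_def by blast
    next
      case (2 x y y')
      then have "scale k r = frag_of (k \<odot>\<^bsub>X\<^esub> x, y \<oplus>\<^bsub>Y\<^esub> y') - frag_of (k \<odot>\<^bsub>X\<^esub> x, y) - frag_of (k \<odot>\<^bsub>X\<^esub> x, y')"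
        by (simp add: frag_extend_diff)
      moreover have "k \<odot>\<^bsub>X\<^esub> x \<in> carrier X" using 2 k by auto
      ultimately show ?thesis using 2(3,4) unfolding tensor_relations_def by blast
    next
      \<comment> \<open>The relation for (l, x, y) goes to the one for (l, kx, y); this uses kl = lk
        in \<open>K\<close>.\<close>
      case (3 l x y)
      then have "scale k r = frag_of (l \<odot>\<^bsub>X\<^esub> (k \<odot>\<^bsub>X\<^esub> x), y) - frag_of (k \<odot>\<^bsub>X\<^esub> x, l \<odot>\<^bsub>Y\<^esub> y)"
        using k by (simp add: frag_extend_diff X.smult_assoc1[symmetric] X.R.m_comm)
      moreover have "k \<odot>\<^bsub>X\<^esub> x \<in> carrier X" using 3 k by auto
      ultimately show ?thesis using 3(2,4) unfolding tensor_relations_def by blast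
    qed
  qed
  from \<open>c \<in> N\<close> show ?thesis
    unfolding tensor_kernel_def
  proof induction
    case one
    then show ?case by (simp add: generate.one[of F, simplified])
  next
    case (incl h)
    then show ?case using rel unfolding tensor_kernel_def by blast
  next
    case (inv h)
    then have h: "h \<in> carrier F" using tensor_relations_subset by blast
    then have "scale k (inv\<^bsub>F\<^esub> h) = inv\<^bsub>F\<^esub> (scale k h)"
      using scale_closed[OF k h] by (simp add: frag_extend_minus)
    then show ?case
      using rel[OF inv] subgroup.m_inv_closed[OF kernel_subgroup] unfolding tensor_kernel_def by simp
  next
    case (eng c d)
    then show ?case by (simp add: frag_extend_add generate.eng[of _ F, simplified])
  qed
qed

text \<open>By \<open>scale_kernel\<close> every representative yields the same coset, so the union
  in the definition collapses.\<close>

lemma tensor_smult: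
  assumes k: "k \<in> carrier K" and c: "c \<in> carrier F"
  shows "k \<odot>\<^bsub>T\<^esub> cls c = cls (scale k c)"
proof -
  have "cls (scale k d) = cls (scale k c)" if d: "d \<in> cls c" for d
  proof -
    obtain n where n: "n \<in> N" "d = n + c" using d unfolding r_coset_def by auto
    then have "d \<in> carrier F" using F.m_closed[of n c] kernel_subset c
      by (auto simp del: carrier_free_Abelian_group_iff)
    moreover have "scale k d - scale k c \<in> N"
      using n scale_kernel[OF k n(1)] by (simp add: frag_extend_add)
    ultimately show ?thesis
      using cls_eq_iff scale_closed k c by blast
  qed
  moreover have "c \<in> cls c" using F.rcos_self[OF c kernel_subgroup] .
  ultimately have "(\<Union>d\<in>cls c. cls (scale k d)) = cls (scale k c)" by blast
  then show ?thesis by (simp add: tensor_def Let_def)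
qed

lemma frag_of_closed: "\<lbrakk>x \<in> carrier X; y \<in> carrier Y\<rbrakk> \<Longrightarrow> frag_of (x, y) \<in> carrier F"
  by (simp add: keys_frag_of)

lemma pure_tensor_closed: "\<lbrakk>x \<in> carrier X; y \<in> carrier Y\<rbrakk> \<Longrightarrow> pt x y \<in> carrier T"
  unfolding pure_tensor_def by (intro cls_closed frag_of_closed)

lemma frag_sum_closed: "\<lbrakk>c \<in> carrier F; d \<in> carrier F\<rbrakk> \<Longrightarrow> c + d \<in> carrier F"
  using F.m_closed[of c d] by (simp only: mult_free_Abelian_group)

lemma pure_tensor_add_left:
  assumes "x \<in> carrier X" "x' \<in> carrier X" "y \<in> carrier Y"
  shows "pt (x \<oplus>\<^bsub>X\<^esub> x') y = pt x y \<oplus>\<^bsub>T\<^esub> pt x' y"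
proof -
  have "frag_of (x \<oplus>\<^bsub>X\<^esub> x', y) - (frag_of (x, y) + frag_of (x', y)) \<in> N"
    using assms by (intro kernel_relation) (auto simp: tensor_relations_def algebra_simps)
  then show ?thesis
    using assms unfolding pure_tensor_def
    by (simp only: tensor_add frag_of_closed) (intro iffD2[OF cls_eq_iff] frag_sum_closed frag_of_closed X.M.a_closed)
qed

lemma pure_tensor_add_right:
  assumes "x \<in> carrier X" "y \<in> carrier Y" "y' \<in> carrier Y"
  shows "pt x (y \<oplus>\<^bsub>Y\<^esub> y') = pt x y \<oplus>\<^bsub>T\<^esub> pt x y'"
proof -
  have "frag_of (x, y \<oplus>\<^bsub>Y\<^esub> y') - (frag_of (x, y) + frag_of (x, y')) \<in> N"
    using assms by (intro kernel_relation) (auto simp: tensor_relations_def algebra_simps)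
  then show ?thesis
    using assms unfolding pure_tensor_def
    by (simp only: tensor_add frag_of_closed) (intro iffD2[OF cls_eq_iff] frag_sum_closed frag_of_closed Y.M.a_closed)
qed

lemma pure_tensor_smult_left:
  assumes "k \<in> carrier K" "x \<in> carrier X" "y \<in> carrier Y"
  shows "pt (k \<odot>\<^bsub>X\<^esub> x) y = k \<odot>\<^bsub>T\<^esub> pt x y"
  using assms unfolding pure_tensor_def by (simp only: tensor_smult frag_of_closed) simp

lemma pure_tensor_smult_right:
  assumes "k \<in> carrier K" "x \<in> carrier X" "y \<in> carrier Y"
  shows "pt x (k \<odot>\<^bsub>Y\<^esub> y) = k \<odot>\<^bsub>T\<^esub> pt x y"
proof -
  have "frag_of (k \<odot>\<^bsub>X\<^esub> x, y) - frag_of (x, k \<odot>\<^bsub>Y\<^esub> y) \<in> N"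
    using assms by (intro kernel_relation) (auto simp: tensor_relations_def)
  then have "pt (k \<odot>\<^bsub>X\<^esub> x) y = pt x (k \<odot>\<^bsub>Y\<^esub> y)"
    using assms unfolding pure_tensor_def by (intro iffD2[OF cls_eq_iff] frag_of_closed) auto
  then show ?thesis using pure_tensor_smult_left[OF assms] by simp
qed

sublocale T: abelian_group T
  using tensor_comm_group
  by (simp add: abelian_group_def abelian_group_axioms_def abelian_monoid_def comm_group_def)

lemma tensor_minus:
  assumes "c \<in> carrier F" shows "\<ominus>\<^bsub>T\<^esub> cls c = cls (- c)"
proof (rule T.minus_equality)
  have "- c \<in> carrier F" using assms by simp
  then show "cls (- c) \<oplus>\<^bsub>T\<^esub> cls c = \<zero>\<^bsub>T\<^esub>" "cls c \<in> carrier T" "cls (- c) \<in> carrier T"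
    using assms by (auto simp add: tensor_add tensor_zero simp del: carrier_free_Abelian_group_iff intro: cls_closed)
qed

lemma pure_tensor_zero_left: "y \<in> carrier Y \<Longrightarrow> pt \<zero>\<^bsub>X\<^esub> y = \<zero>\<^bsub>T\<^esub>"
  using pure_tensor_add_left[of "\<zero>\<^bsub>X\<^esub>" "\<zero>\<^bsub>X\<^esub>" y] pure_tensor_closed[of "\<zero>\<^bsub>X\<^esub>" y]
  by simp

lemma pure_tensor_minus_left:
  assumes "x \<in> carrier X" "y \<in> carrier Y" shows "pt (\<ominus>\<^bsub>X\<^esub> x) y = \<ominus>\<^bsub>T\<^esub> pt x y"
proof -
  have "pt (\<ominus>\<^bsub>X\<^esub> x) y \<oplus>\<^bsub>T\<^esub> pt x y = \<zero>\<^bsub>T\<^esub>"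
    using assms pure_tensor_add_left[of "\<ominus>\<^bsub>X\<^esub> x" x y]
    by (simp add: X.M.l_neg pure_tensor_zero_left)
  then show ?thesis
    using T.minus_equality pure_tensor_closed assms by (metis X.M.a_inv_closed)
qed

text \<open>No cases for zero or negatives arise: 0 is the pure tensor of zeros, and the negative of
  x \<otimes> y is (-x) \<otimes> y, so sums of pure tensors exhaust the quotient.\<close>

lemma tensor_induct [consumes 1, case_names pure add]:
  assumes t: "t \<in> carrier T"
    and pure: "\<And>x y. \<lbrakk>x \<in> carrier X; y \<in> carrier Y\<rbrakk> \<Longrightarrow> P (pt x y)"
    and add: "\<And>s t. \<lbrakk>s \<in> carrier T; t \<in> carrier T; P s; P t\<rbrakk> \<Longrightarrow> P (s \<oplus>\<^bsub>T\<^esub> t)"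
  shows "P t"
proof -
  obtain c where c: "c \<in> carrier F" "t = cls c" using t by (auto simp: carrier_tensor)
  \<comment> \<open>\<open>frag_induction\<close> builds elements by differences, so the claim is
    carried for a class and for its negative together.\<close>
  have "c \<in> carrier F \<and> P (cls c) \<and> P (\<ominus>\<^bsub>T\<^esub> cls c)"
    using c(1)[unfolded carrier_free_Abelian_group_iff]
  proof (induction c rule: frag_induction)
    case zero
    have "P (pt \<zero>\<^bsub>X\<^esub> \<zero>\<^bsub>Y\<^esub>)" by (intro pure) auto
    moreover have "\<ominus>\<^bsub>T\<^esub> \<zero>\<^bsub>T\<^esub> = \<zero>\<^bsub>T\<^esub>" by (rule T.minus_equality) simp_all
    ultimately have "P \<zero>\<^bsub>T\<^esub> \<and> P (\<ominus>\<^bsub>T\<^esub> \<zero>\<^bsub>T\<^esub>)" by (simp only: pure_tensor_zero_left Y.M.zero_closed simp_thms)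
    then show ?case by (simp flip: tensor_zero)
  next
    case (one z)
    then obtain x y where z: "z = (x, y)" "x \<in> carrier X" "y \<in> carrier Y" by auto
    have "P (pt x y)" "P (pt (\<ominus>\<^bsub>X\<^esub> x) y)" using z by (auto intro!: pure)
    then show ?case
      using z frag_of_closed[of x y] by (simp only: pure_tensor_minus_left) (simp add: pure_tensor_def)
  next
    case (diff c d)
    then have cd: "c \<in> carrier F" "d \<in> carrier F" "- c \<in> carrier F" "- d \<in> carrier F" "c - d \<in> carrier F"
      using keys_diff[of c d] by auto
    then have "cls (c - d) = cls c \<oplus>\<^bsub>T\<^esub> (\<ominus>\<^bsub>T\<^esub> cls d)"
      by (simp only: tensor_minus tensor_add) simp
    moreover have "\<ominus>\<^bsub>T\<^esub> (cls c \<oplus>\<^bsub>T\<^esub> (\<ominus>\<^bsub>T\<^esub> cls d)) = (\<ominus>\<^bsub>T\<^esub> cls c) \<oplus>\<^bsub>T\<^esub> cls d"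
      using cd by (simp only: T.minus_add T.a_inv_closed cls_closed T.minus_minus)
    moreover have "P (cls c \<oplus>\<^bsub>T\<^esub> (\<ominus>\<^bsub>T\<^esub> cls d))" "P ((\<ominus>\<^bsub>T\<^esub> cls c) \<oplus>\<^bsub>T\<^esub> cls d)"
      using cd diff by (auto intro!: add cls_closed T.a_inv_closed simp del: carrier_free_Abelian_group_iff)
    ultimately show ?case
      using cd(5) by (simp del: carrier_free_Abelian_group_iff)
  qed
  then show ?thesis using c by simp
qed

text \<open>Distributivity over sums of tensors comes from additivity of \<open>scale\<close> on
  representatives. The other scalar equations are inherited from \<open>X\<close> at pure tensors,
  and the addition step of each induction uses that distributivity.\<close>

sublocale T: module K T
proof (intro_locales, unfold_locales)
  have closed: "k \<odot>\<^bsub>T\<^esub> t \<in> carrier T" if "k \<in> carrier K" "t \<in> carrier T" for k t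
    using that unfolding carrier_tensor using tensor_smult scale_closed by fastforce
  have distr: "k \<odot>\<^bsub>T\<^esub> (s \<oplus>\<^bsub>T\<^esub> t) = k \<odot>\<^bsub>T\<^esub> s \<oplus>\<^bsub>T\<^esub> k \<odot>\<^bsub>T\<^esub> t"
    if k: "k \<in> carrier K" and "s \<in> carrier T" "t \<in> carrier T" for k s t
  proof -
    from that(2,3) obtain c d where "c \<in> carrier F" "d \<in> carrier F" "s = cls c" "t = cls d"
      unfolding carrier_tensor by blast
    then show ?thesis
      using k by (simp only: tensor_add tensor_smult scale_closed frag_sum_closed frag_extend_add)
  qed
  {
    fix k t assume "k \<in> carrier K" "t \<in> carrier T"
    then show "k \<odot>\<^bsub>T\<^esub> t \<in> carrier T" by (rule closed)
  next
    fix k s t assume "k \<in> carrier K" "s \<in> carrier T" "t \<in> carrier T"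
    then show "k \<odot>\<^bsub>T\<^esub> (s \<oplus>\<^bsub>T\<^esub> t) = k \<odot>\<^bsub>T\<^esub> s \<oplus>\<^bsub>T\<^esub> k \<odot>\<^bsub>T\<^esub> t" by (rule distr)
  next
    fix k l t assume k: "k \<in> carrier K" "l \<in> carrier K" and "t \<in> carrier T"
    from this(3) show "(k \<oplus>\<^bsub>K\<^esub> l) \<odot>\<^bsub>T\<^esub> t = k \<odot>\<^bsub>T\<^esub> t \<oplus>\<^bsub>T\<^esub> l \<odot>\<^bsub>T\<^esub> t"
    proof (induction t rule: tensor_induct)
      case (pure x y)
      then show ?case
        using k by (simp add: pure_tensor_smult_left[symmetric] pure_tensor_add_left[symmetric] X.smult_l_distr)
    next
      case (add s t)
      then show ?case
        using k by (simp add: distr closed T.add.m_assoc T.add.m_lcomm)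
    qed
  next
    fix k l t assume k: "k \<in> carrier K" "l \<in> carrier K" and "t \<in> carrier T"
    from this(3) show "(k \<otimes>\<^bsub>K\<^esub> l) \<odot>\<^bsub>T\<^esub> t = k \<odot>\<^bsub>T\<^esub> (l \<odot>\<^bsub>T\<^esub> t)"
    proof (induction t rule: tensor_induct)
      case (pure x y)
      then show ?case
        using k by (simp add: pure_tensor_smult_left[symmetric] X.smult_assoc1)
    next
      case (add s t)
      then show ?case using k by (simp add: distr closed)
    qed
  next
    fix t assume "t \<in> carrier T"
    then show "\<one>\<^bsub>K\<^esub> \<odot>\<^bsub>T\<^esub> t = t"
    proof (induction t rule: tensor_induct)
      case (pure x y)
      then show ?case by (simp add: pure_tensor_smult_left[symmetric])
    next
      case (add s t)
      then show ?case by (simp add: distr)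
    qed
  }
qed

section \<open>The universal property of the tensor product\<close>

lemma tensor_module: "module K T"
  by (rule T.module_axioms)

lemma pure_tensor_bilinear: "pt \<in> bilinear_maps K X Y T"
  by (intro bilinear_mapsI linear_mapsI)
    (auto simp: pure_tensor_closed pure_tensor_add_left pure_tensor_add_right
      pure_tensor_smult_left pure_tensor_smult_right)

text \<open>The uniqueness half of the universal property, and the main tool for identities on
  tensors: both maps are additive, so \<open>tensor_induct\<close> applies.\<close>

lemma linear_maps_tensor_eq:
  assumes "g \<in> linear_maps K T P" "h \<in> linear_maps K T P"
    and "\<And>x y. \<lbrakk>x \<in> carrier X; y \<in> carrier Y\<rbrakk> \<Longrightarrow> g (pt x y) = h (pt x y)"
    and "t \<in> carrier T"
  shows "g t = h t"
  using assms(4)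
  by (induction t rule: tensor_induct)
    (simp_all add: assms(3) linear_maps_add[OF assms(1)] linear_maps_add[OF assms(2)])

text \<open>The existence half. The additive map on the free abelian group kills every defining
  relation by bilinearity and so factors through the quotient group. That argument knows nothing of
  scalars; homogeneity is then checked by moving k into the first factor of a pure tensor.\<close>

lemma tensor_universal:
  assumes "module K P" and \<phi>: "\<phi> \<in> bilinear_maps K X Y P"
  obtains h where "h \<in> linear_maps K T P"
    "\<And>x y. \<lbrakk>x \<in> carrier X; y \<in> carrier Y\<rbrakk> \<Longrightarrow> h (pt x y) = \<phi> x y"
proof -
  interpret P: module K P by fact
  have closed: "\<phi> x y \<in> carrier P" if "x \<in> carrier X" "y \<in> carrier Y" for x y
    using that linear_maps_closed[OF bilinear_maps_right[OF \<phi>]] by blast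
  then have "(\<lambda>(x, y). \<phi> x y) ` (carrier X \<times> carrier Y) \<subseteq> carrier (add_monoid P)" by auto
  then obtain g where g: "g \<in> hom F (add_monoid P)"
    and g_of: "\<And>z. z \<in> carrier X \<times> carrier Y \<Longrightarrow> g (frag_of z) = (\<lambda>(x, y). \<phi> x y) z"
    using comm_group.free_Abelian_group_universal[OF P.M.a_comm_group] by blast
  interpret g: group_hom F "add_monoid P" g
    by (intro group_hom.intro group_hom_axioms.intro F.is_group P.M.a_group g)
  have gdiff: "g (c - d) = g c \<oplus>\<^bsub>P\<^esub> \<ominus>\<^bsub>P\<^esub> g d" if "c \<in> carrier F" "d \<in> carrier F" for c d
  proof -
    have "c - d = c \<otimes>\<^bsub>F\<^esub> inv\<^bsub>F\<^esub> d" using that by simp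
    then have "g (c - d) = g c \<otimes>\<^bsub>add_monoid P\<^esub> inv\<^bsub>add_monoid P\<^esub> g d"
      using that g.hom_mult[OF that(1) F.inv_closed[OF that(2)]] g.hom_inv[OF that(2)] by metis
    then show ?thesis by (simp add: a_inv_def)
  qed
  have diff_closed: "c - d \<in> carrier F" if "c \<in> carrier F" "d \<in> carrier F" for c d
    using keys_diff[of c d] that by auto
  have "tensor_relations K X Y \<subseteq> kernel F (add_monoid P) g"
  proof
    fix r assume r: "r \<in> tensor_relations K X Y"
    have fc: "frag_of z \<in> carrier F" if "z \<in> carrier X \<times> carrier Y" for z
      using that by (auto intro: frag_of_closed)
    note \<phi>_simps = linear_maps_add[OF bilinear_maps_left[OF \<phi>]] linear_maps_add[OF bilinear_maps_right[OF \<phi>]]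
      linear_maps_smult[OF bilinear_maps_left[OF \<phi>]] linear_maps_smult[OF bilinear_maps_right[OF \<phi>]]
    \<comment> \<open>The shape that both additivity relations take after applying g: (a + b) - a -
      b.\<close>
    have cancel: "a \<oplus>\<^bsub>P\<^esub> b \<oplus>\<^bsub>P\<^esub> \<ominus>\<^bsub>P\<^esub> a \<oplus>\<^bsub>P\<^esub> \<ominus>\<^bsub>P\<^esub> b = \<zero>\<^bsub>P\<^esub>" if "a \<in> carrier P" "b \<in> carrier P" for a b
    proof -
      have "a \<oplus>\<^bsub>P\<^esub> b \<oplus>\<^bsub>P\<^esub> \<ominus>\<^bsub>P\<^esub> a = b"
        using that by (simp add: P.M.add.m_comm[of a b] P.M.add.m_assoc P.M.r_neg)
      then show ?thesis using that by (simp add: P.M.r_neg)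
    qed
    from r have "g r = \<zero>\<^bsub>P\<^esub>"
    proof (cases rule: tensor_relationsE)
      case (1 x x' y)
      then have "g r = \<phi> (x \<oplus>\<^bsub>X\<^esub> x') y \<oplus>\<^bsub>P\<^esub> \<ominus>\<^bsub>P\<^esub> \<phi> x y \<oplus>\<^bsub>P\<^esub> \<ominus>\<^bsub>P\<^esub> \<phi> x' y"
        by (simp add: gdiff fc g_of diff_closed del: carrier_free_Abelian_group_iff)
      then show ?thesis using 1 cancel closed by (simp add: \<phi>_simps)
    next
      case (2 x y y')
      then have "g r = \<phi> x (y \<oplus>\<^bsub>Y\<^esub> y') \<oplus>\<^bsub>P\<^esub> \<ominus>\<^bsub>P\<^esub> \<phi> x y \<oplus>\<^bsub>P\<^esub> \<ominus>\<^bsub>P\<^esub> \<phi> x y'"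
        by (simp add: gdiff fc g_of diff_closed del: carrier_free_Abelian_group_iff)
      then show ?thesis using 2 cancel closed by (simp add: \<phi>_simps)
    next
      case (3 k x y)
      then have "g r = \<phi> (k \<odot>\<^bsub>X\<^esub> x) y \<oplus>\<^bsub>P\<^esub> \<ominus>\<^bsub>P\<^esub> \<phi> x (k \<odot>\<^bsub>Y\<^esub> y)"
        by (simp add: gdiff fc g_of del: carrier_free_Abelian_group_iff)
      then show ?thesis using 3 closed by (simp add: \<phi>_simps P.M.r_neg)
    qed
    then show "r \<in> kernel F (add_monoid P) g"
      using tensor_relations_subset r by (auto simp: kernel_def simp del: carrier_free_Abelian_group_iff)
  qed
  then have "N \<subseteq> kernel F (add_monoid P) g"
    unfolding tensor_kernel_def by (rule F.generate_subgroup_incl[OF _ g.subgroup_kernel])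
  then obtain h where h: "h \<in> hom (F Mod N) (add_monoid P)" "\<And>c. c \<in> carrier F \<Longrightarrow> h (cls c) = g c"
    using g.FactGroup_universal_kernel[OF kernel_normal] by blast
  have h_closed: "h t \<in> carrier P" if "t \<in> carrier T" for t
    using that hom_in_carrier[OF h(1)] by (simp add: tensor_def Let_def)
  have h_add: "h (s \<oplus>\<^bsub>T\<^esub> t) = h s \<oplus>\<^bsub>P\<^esub> h t" if "s \<in> carrier T" "t \<in> carrier T" for s t
    using that hom_mult[OF h(1)] by (simp add: tensor_def Let_def)
  have h_pure: "h (pt x y) = \<phi> x y" if "x \<in> carrier X" "y \<in> carrier Y" for x y
    using that h(2)[OF frag_of_closed[OF that]] g_of[of "(x, y)"] by (simp add: pure_tensor_def)
  have "h (k \<odot>\<^bsub>T\<^esub> t) = k \<odot>\<^bsub>P\<^esub> h t" if k: "k \<in> carrier K" and "t \<in> carrier T" for k t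
    using that(2)
  proof (induction t rule: tensor_induct)
    case (pure x y)
    then have "h (k \<odot>\<^bsub>T\<^esub> pt x y) = \<phi> (k \<odot>\<^bsub>X\<^esub> x) y"
      using k by (simp add: pure_tensor_smult_left[symmetric] h_pure)
    then show ?case
      using pure k by (simp add: h_pure linear_maps_smult[OF bilinear_maps_left[OF \<phi>]])
  next
    case (add s t)
    then show ?case using k by (simp add: h_add T.smult_r_distr P.smult_r_distr h_closed)
  qed
  then have "h \<in> linear_maps K T P"
    by (intro linear_mapsI h_closed h_add)
  then show ?thesis using h_pure that by blast
qed

text \<open>Justifies the definite description. Restricting the map from
  \<open>tensor_universal\<close> to the carrier makes it extensional, and among extensional maps
  agreement on the carrier is equality.\<close>

lemma tensor_lift:
  assumes "module K P" and \<phi>: "\<phi> \<in> bilinear_maps K X Y P"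
  shows tensor_lift_linear: "tensor_lift K X Y P \<phi> \<in> linear_maps K T P"
    and tensor_lift_pure:
      "\<And>x y. \<lbrakk>x \<in> carrier X; y \<in> carrier Y\<rbrakk> \<Longrightarrow> tensor_lift K X Y P \<phi> (pt x y) = \<phi> x y"
proof -
  let ?Q = "\<lambda>h. h \<in> linear_maps K T P \<inter> extensional (carrier T) \<and>
      (\<forall>x\<in>carrier X. \<forall>y\<in>carrier Y. h (pt x y) = \<phi> x y)"
  obtain h where h: "h \<in> linear_maps K T P"
    "\<And>x y. \<lbrakk>x \<in> carrier X; y \<in> carrier Y\<rbrakk> \<Longrightarrow> h (pt x y) = \<phi> x y"
    using tensor_universal[OF assms] by metis
  have "\<exists>!h. ?Q h"
  proof (rule ex1I)
    have "restrict h (carrier T) \<in> linear_maps K T P"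
      using h(1) linear_maps_cong[OF tensor_module, of "restrict h (carrier T)" h] by simp
    then show "?Q (restrict h (carrier T))"
      using h(2) by (simp add: pure_tensor_closed)
  next
    fix g assume "?Q g"
    then have g: "g \<in> linear_maps K T P" "g \<in> extensional (carrier T)"
      "\<And>x y. \<lbrakk>x \<in> carrier X; y \<in> carrier Y\<rbrakk> \<Longrightarrow> g (pt x y) = h (pt x y)"
      using h(2) by simp_all
    show "g = restrict h (carrier T)"
      using linear_maps_tensor_eq[OF g(1) h(1) g(3)] by (intro extensionalityI[OF g(2)]) simp_all
  qed
  then have "?Q (tensor_lift K X Y P \<phi>)"
    unfolding tensor_lift_def by (rule theI')
  then show "tensor_lift K X Y P \<phi> \<in> linear_maps K T P"
    "\<And>x y. \<lbrakk>x \<in> carrier X; y \<in> carrier Y\<rbrakk> \<Longrightarrow> tensor_lift K X Y P \<phi> (pt x y) = \<phi> x y"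
    by simp_all
qed

text \<open>A lift is linear in its tensor argument by construction, but it may depend on a
  parameter w as well. Linear maps in w are closed under sums, so linearity in w need only be tested
  at pure tensors. This serves the inner argument of the product on A \<otimes> B and the module
  argument of its action.\<close>

lemma linear_maps_tensor_parameter:
  assumes W: "module K W" and P: "module K P"
    and h: "\<And>w. w \<in> carrier W \<Longrightarrow> h w \<in> linear_maps K T P"
    and pure: "\<And>x y. \<lbrakk>x \<in> carrier X; y \<in> carrier Y\<rbrakk> \<Longrightarrow> (\<lambda>w. h w (pt x y)) \<in> linear_maps K W P"
    and t: "t \<in> carrier T"
  shows "(\<lambda>w. h w t) \<in> linear_maps K W P"
  using t
proof (induction t rule: tensor_induct)
  case (add s t)
  have "h w (s \<oplus>\<^bsub>T\<^esub> t) = h w s \<oplus>\<^bsub>P\<^esub> h w t" if "w \<in> carrier W" for w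
    using linear_maps_add[OF h[OF that]] add by blast
  then show ?case
    using linear_maps_plus[OF P add(3,4)]
      linear_maps_cong[OF W, of "\<lambda>w. h w (s \<oplus>\<^bsub>T\<^esub> t)" "\<lambda>w. h w s \<oplus>\<^bsub>P\<^esub> h w t"] by blast
qed (rule pure)

lemma pure_tensor_zero_right: "x \<in> carrier X \<Longrightarrow> pt x \<zero>\<^bsub>Y\<^esub> = \<zero>\<^bsub>T\<^esub>"
  using linear_maps_zero[OF Y.module_axioms tensor_module bilinear_maps_right[OF pure_tensor_bilinear]] .

text \<open>Moves a sign into the second factor, where the Leibniz rule of the dg ring produces
  it.\<close>

lemma pure_tensor_signed:
  assumes "x \<in> carrier X" "y \<in> carrier Y"
  shows "signed T n (pt x y) = pt x (signed Y n y)"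
  using linear_maps_signed[OF Y.module_axioms tensor_module bilinear_maps_right[OF pure_tensor_bilinear]] assms
  by metis

end

text \<open>Uniqueness applied twice: the second argument varies against a pure first argument, then
  the first argument varies.\<close>

lemma bilinear_maps_tensor_eq:
  assumes X: "module_pair K X Y" and X': "module_pair K X' Y'"
    and \<Phi>: "\<Phi> \<in> bilinear_maps K (tensor K X Y) (tensor K X' Y') P"
    and \<Psi>: "\<Psi> \<in> bilinear_maps K (tensor K X Y) (tensor K X' Y') P"
    and eq: "\<And>x y x' y'. \<lbrakk>x \<in> carrier X; y \<in> carrier Y; x' \<in> carrier X'; y' \<in> carrier Y'\<rbrakk> \<Longrightarrow>
      \<Phi> (pure_tensor K X Y x y) (pure_tensor K X' Y' x' y') = \<Psi> (pure_tensor K X Y x y) (pure_tensor K X' Y' x' y')"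
    and s: "s \<in> carrier (tensor K X Y)" and t: "t \<in> carrier (tensor K X' Y')"
  shows "\<Phi> s t = \<Psi> s t"
proof -
  have "\<Phi> (pure_tensor K X Y x y) t = \<Psi> (pure_tensor K X Y x y) t" if "x \<in> carrier X" "y \<in> carrier Y" for x y
    using that module_pair.pure_tensor_closed[OF X that]
    by (intro module_pair.linear_maps_tensor_eq[OF X' bilinear_maps_right[OF \<Phi>] bilinear_maps_right[OF \<Psi>] _ t] eq)
  then show ?thesis
    using module_pair.linear_maps_tensor_eq[OF X bilinear_maps_left[OF \<Phi> t] bilinear_maps_left[OF \<Psi> t] _ s] by blast
qed


section \<open>The tensor product of a central ring and a dg central ring\<close>

locale tensor_of_rings = A: central_ring K A + B: dg_central_ring K B
  for K :: "('k, 'z) ring_scheme" and A :: "('k, 'a) module" and B :: "('k, 'b) dg_ring"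
begin

abbreviation R where "R \<equiv> tensor_dg_ring K A B"
abbreviation T where "T p \<equiv> tensor K A (rgr B p)"
abbreviation pt where "pt p \<equiv> pure_tensor K A (rgr B p)"

lemma pair: "module_pair K A (rgr B p)"
  by (intro module_pair.intro A.module_axioms B.rgr_module)

lemmas T_module = module_pair.tensor_module[OF pair]
lemmas pt_closed = module_pair.pure_tensor_closed[OF pair]
lemmas pt_bilinear = module_pair.pure_tensor_bilinear[OF pair]
lemmas pt_linear_left = bilinear_maps_left[OF pt_bilinear]
lemmas pt_linear_right = bilinear_maps_right[OF pt_bilinear]
lemmas T_lift_linear = module_pair.tensor_lift_linear[OF pair]
lemmas T_lift_pure = module_pair.tensor_lift_pure[OF pair]

lemma rgr_R: "rgr R p = T p"
  by (simp add: tensor_dg_ring_def)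

lemma mult_linear_right: "\<alpha> \<in> carrier A \<Longrightarrow> (\<lambda>\<beta>. \<alpha> \<otimes>\<^bsub>A\<^esub> \<beta>) \<in> linear_maps K A A"
  and mult_linear_left: "\<beta> \<in> carrier A \<Longrightarrow> (\<lambda>\<alpha>. \<alpha> \<otimes>\<^bsub>A\<^esub> \<beta>) \<in> linear_maps K A A"
  by (auto intro!: linear_mapsI simp: A.Alg.r_distr A.Alg.l_distr A.smult_mult_left A.smult_mult_right)

text \<open>The inner of the two lifts that define the product, that is, left multiplication by
  \<alpha> \<otimes> f. Naming it lets bilinearity in \<alpha> and f be proved before the outer lift
  is taken.\<close>

definition pure_mult where
  "pure_mult p q \<alpha> f = tensor_lift K A (rgr B q) (T (p + q))
    (\<lambda>\<beta> g. pt (p + q) (\<alpha> \<otimes>\<^bsub>A\<^esub> \<beta>) (rmult B p q f g))"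

lemma rmult_R:
  "rmult R p q s t = tensor_lift K A (rgr B p) (T (p + q)) (\<lambda>\<alpha> f. pure_mult p q \<alpha> f t) s"
  by (simp add: tensor_dg_ring_def pure_mult_def)

lemma B_mult_closed:
  "\<lbrakk>f \<in> carrier (rgr B p); g \<in> carrier (rgr B q)\<rbrakk> \<Longrightarrow> rmult B p q f g \<in> carrier (rgr B (p + q))"
  using linear_maps_closed[OF B.rmult_linear_right] .

lemma pure_mult_bilinear:
  assumes "\<alpha> \<in> carrier A" "f \<in> carrier (rgr B p)"
  shows "(\<lambda>\<beta> g. pt (p + q) (\<alpha> \<otimes>\<^bsub>A\<^esub> \<beta>) (rmult B p q f g)) \<in> bilinear_maps K A (rgr B q) (T (p + q))"
  using assms
  by (intro bilinear_mapsI linear_maps_compose[OF pt_linear_right B.rmult_linear_right]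
      linear_maps_compose[OF pt_linear_left mult_linear_right] B_mult_closed A.Alg.m_closed)

lemma pure_mult_linear:
  "\<lbrakk>\<alpha> \<in> carrier A; f \<in> carrier (rgr B p)\<rbrakk> \<Longrightarrow> pure_mult p q \<alpha> f \<in> linear_maps K (T q) (T (p + q))"
  unfolding pure_mult_def by (intro T_lift_linear T_module pure_mult_bilinear)

lemma pure_mult_pure:
  "\<lbrakk>\<alpha> \<in> carrier A; f \<in> carrier (rgr B p); \<beta> \<in> carrier A; g \<in> carrier (rgr B q)\<rbrakk> \<Longrightarrow>
    pure_mult p q \<alpha> f (pt q \<beta> g) = pt (p + q) (\<alpha> \<otimes>\<^bsub>A\<^esub> \<beta>) (rmult B p q f g)"
  unfolding pure_mult_def by (intro T_lift_pure T_module pure_mult_bilinear)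

text \<open>The condition under which the outer lift in \<open>rmult_R\<close> is determined. Here
  \<alpha> or f is the parameter, and t is reduced to a pure tensor.\<close>

lemma pure_mult_args_bilinear:
  assumes t: "t \<in> carrier (T q)"
  shows "(\<lambda>\<alpha> f. pure_mult p q \<alpha> f t) \<in> bilinear_maps K A (rgr B p) (T (p + q))"
proof (rule bilinear_mapsI)
  fix \<alpha> assume \<alpha>: "\<alpha> \<in> carrier A"
  show "(\<lambda>f. pure_mult p q \<alpha> f t) \<in> linear_maps K (rgr B p) (T (p + q))"
  proof (rule module_pair.linear_maps_tensor_parameter[OF pair B.rgr_module T_module _ _ t])
    fix \<beta> g assume \<beta>: "\<beta> \<in> carrier A" "g \<in> carrier (rgr B q)"
    have "(\<lambda>f. pt (p + q) (\<alpha> \<otimes>\<^bsub>A\<^esub> \<beta>) (rmult B p q f g)) \<in> linear_maps K (rgr B p) (T (p + q))"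
      using \<alpha> \<beta> by (intro linear_maps_compose[OF pt_linear_right B.rmult_linear_left] A.Alg.m_closed)
    then show "(\<lambda>f. pure_mult p q \<alpha> f (pt q \<beta> g)) \<in> linear_maps K (rgr B p) (T (p + q))"
      using pure_mult_pure[OF \<alpha> _ \<beta>] by (subst linear_maps_cong[OF B.rgr_module])
  qed (use \<alpha> in \<open>intro pure_mult_linear\<close>)
next
  fix f assume f: "f \<in> carrier (rgr B p)"
  show "(\<lambda>\<alpha>. pure_mult p q \<alpha> f t) \<in> linear_maps K A (T (p + q))"
  proof (rule module_pair.linear_maps_tensor_parameter[OF pair A.module_axioms T_module _ _ t])
    fix \<beta> g assume \<beta>: "\<beta> \<in> carrier A" "g \<in> carrier (rgr B q)"
    have "(\<lambda>\<alpha>. pt (p + q) (\<alpha> \<otimes>\<^bsub>A\<^esub> \<beta>) (rmult B p q f g)) \<in> linear_maps K A (T (p + q))"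
      using f \<beta> by (intro linear_maps_compose[OF pt_linear_left mult_linear_left] B_mult_closed)
    then show "(\<lambda>\<alpha>. pure_mult p q \<alpha> f (pt q \<beta> g)) \<in> linear_maps K A (T (p + q))"
      using pure_mult_pure[OF _ f \<beta>] by (subst linear_maps_cong[OF A.module_axioms])
  qed (use f in \<open>intro pure_mult_linear\<close>)
qed

lemma rmult_R_eq_pure_mult:
  "\<lbrakk>\<alpha> \<in> carrier A; f \<in> carrier (rgr B p); t \<in> carrier (T q)\<rbrakk> \<Longrightarrow>
    rmult R p q (pt p \<alpha> f) t = pure_mult p q \<alpha> f t"
  unfolding rmult_R by (intro T_lift_pure T_module pure_mult_args_bilinear)

lemma rmult_R_pure:
  "\<lbrakk>\<alpha> \<in> carrier A; f \<in> carrier (rgr B p); \<beta> \<in> carrier A; g \<in> carrier (rgr B q)\<rbrakk> \<Longrightarrow>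
    rmult R p q (pt p \<alpha> f) (pt q \<beta> g) = pt (p + q) (\<alpha> \<otimes>\<^bsub>A\<^esub> \<beta>) (rmult B p q f g)"
  by (simp add: rmult_R_eq_pure_mult pure_mult_pure pt_closed)

lemma rmult_R_linear_left:
  "t \<in> carrier (T q) \<Longrightarrow> (\<lambda>s. rmult R p q s t) \<in> linear_maps K (T p) (T (p + q))"
  unfolding rmult_R by (rule T_lift_linear[OF T_module pure_mult_args_bilinear])

text \<open>The roles are exchanged: s is reduced to a pure tensor and t is the parameter. For pure
  s the product is \<open>pure_mult\<close>, which is a lift in t.\<close>

lemma rmult_R_linear_right:
  assumes s: "s \<in> carrier (T p)"
  shows "rmult R p q s \<in> linear_maps K (T q) (T (p + q))"
proof (rule module_pair.linear_maps_tensor_parameter[OF pair T_module T_module _ _ s, where h = "\<lambda>t s. rmult R p q s t"])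
  fix \<alpha> f assume \<alpha>: "\<alpha> \<in> carrier A" "f \<in> carrier (rgr B p)"
  show "(\<lambda>t. rmult R p q (pt p \<alpha> f) t) \<in> linear_maps K (T q) (T (p + q))"
    using pure_mult_linear[OF \<alpha>, of q] rmult_R_eq_pure_mult[OF \<alpha>] by (subst linear_maps_cong[OF T_module])
qed (rule rmult_R_linear_left)

lemma rmult_R_closed: "\<lbrakk>s \<in> carrier (T p); t \<in> carrier (T q)\<rbrakk> \<Longrightarrow> rmult R p q s t \<in> carrier (T (p + q))"
  using linear_maps_closed[OF rmult_R_linear_right] .

lemma rone_R: "rone R = pt 0 \<one>\<^bsub>A\<^esub> (rone B)"
  by (simp add: tensor_dg_ring_def)

lemma rdiff_bilinear: "(\<lambda>\<alpha> f. pt (p + 1) \<alpha> (rdiff B p f)) \<in> bilinear_maps K A (rgr B p) (T (p + 1))"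
  by (intro bilinear_mapsI linear_maps_compose[OF pt_linear_right B.rdiff_linear] pt_linear_left
      linear_maps_closed[OF B.rdiff_linear])

lemma rdiff_R_linear: "rdiff R p \<in> linear_maps K (T p) (T (p + 1))"
  using T_lift_linear[OF T_module rdiff_bilinear] by (simp add: tensor_dg_ring_def)

lemma rdiff_R_pure:
  "\<lbrakk>\<alpha> \<in> carrier A; f \<in> carrier (rgr B p)\<rbrakk> \<Longrightarrow> rdiff R p (pt p \<alpha> f) = pt (p + 1) \<alpha> (rdiff B p f)"
  using T_lift_pure[OF T_module rdiff_bilinear] by (simp add: tensor_dg_ring_def)

lemma B_diff_closed: "f \<in> carrier (rgr B p) \<Longrightarrow> rdiff B p f \<in> carrier (rgr B (p + 1))"
  using linear_maps_closed[OF B.rdiff_linear] .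

text \<open>Both sides are linear in each argument. First s and t become pure with u fixed, then u;
  what remains is associativity in \<open>A\<close> and in \<open>B\<close>.\<close>

lemma rmult_R_assoc:
  assumes s: "s \<in> carrier (T p)" and t: "t \<in> carrier (T q)" and u: "u \<in> carrier (T r)"
  shows "rmult R (p + q) r (rmult R p q s t) u = rmult R p (q + r) s (rmult R q r t u)"
proof (rule bilinear_maps_tensor_eq[OF pair pair _ _ _ s t])
  show "(\<lambda>s t. rmult R (p + q) r (rmult R p q s t) u) \<in> bilinear_maps K (T p) (T q) (T (p + q + r))"
    by (intro bilinear_mapsI linear_maps_compose[OF rmult_R_linear_left[OF u]]
        rmult_R_linear_left rmult_R_linear_right)
  show "(\<lambda>s t. rmult R p (q + r) s (rmult R q r t u)) \<in> bilinear_maps K (T p) (T q) (T (p + q + r))"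
    \<comment> \<open>The target degree becomes p + (q + r), the form in which the right-hand
      product takes its values.\<close>
    unfolding add.assoc
    by (intro bilinear_mapsI linear_maps_compose[OF rmult_R_linear_right rmult_R_linear_left[OF u]]
        rmult_R_linear_left rmult_R_closed u)
next
  fix \<alpha> f \<beta> g
  assume f: "\<alpha> \<in> carrier A" "f \<in> carrier (rgr B p)" and g: "\<beta> \<in> carrier A" "g \<in> carrier (rgr B q)"
  show "rmult R (p + q) r (rmult R p q (pt p \<alpha> f) (pt q \<beta> g)) u =
    rmult R p (q + r) (pt p \<alpha> f) (rmult R q r (pt q \<beta> g) u)"
  proof (rule module_pair.linear_maps_tensor_eq[OF pair _ _ _ u])
    show "(\<lambda>u. rmult R (p + q) r (rmult R p q (pt p \<alpha> f) (pt q \<beta> g)) u) \<in> linear_maps K (T r) (T (p + q + r))"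
      using f g by (intro rmult_R_linear_right rmult_R_closed pt_closed)
    show "(\<lambda>u. rmult R p (q + r) (pt p \<alpha> f) (rmult R q r (pt q \<beta> g) u)) \<in> linear_maps K (T r) (T (p + q + r))"
      unfolding add.assoc
      using f g by (intro linear_maps_compose[OF rmult_R_linear_right rmult_R_linear_right] pt_closed)
  qed (use f g in \<open>simp add: rmult_R_pure B_mult_closed A.Alg.m_assoc B.rmult_assoc add.assoc\<close>)
qed

text \<open>As \<open>A\<close> sits in degree 0 with zero differential, the sign depends on p
  alone: on pure tensors this is the Leibniz rule of \<open>B\<close> with \<alpha>\<beta> as first
  factor.\<close>

lemma rdiff_R_mult:
  assumes s: "s \<in> carrier (T p)" and t: "t \<in> carrier (T q)"
  shows "rdiff R (p + q) (rmult R p q s t) =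
    rmult R (p + 1) q (rdiff R p s) t
    \<oplus>\<^bsub>T (p + q + 1)\<^esub> signed (T (p + q + 1)) p (rmult R p (q + 1) s (rdiff R q t))"
proof (rule bilinear_maps_tensor_eq[OF pair pair _ _ _ s t])
  \<comment> \<open>The two summands land in degrees p + 1 + q and p + (q + 1), which have to be
    recognised as p + q + 1.\<close>
  have eq1: "T (p + q + 1) = T (p + 1 + q)" and eq2: "T (p + q + 1) = T (p + (q + 1))"
    by (simp_all add: algebra_simps)
  show "(\<lambda>s t. rdiff R (p + q) (rmult R p q s t)) \<in> bilinear_maps K (T p) (T q) (T (p + q + 1))"
    by (intro bilinear_mapsI linear_maps_compose[OF rdiff_R_linear] rmult_R_linear_left rmult_R_linear_right)
  have "(\<lambda>t. rmult R (p + 1) q (rdiff R p s) t) \<in> linear_maps K (T q) (T (p + q + 1))"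
    if "s \<in> carrier (T p)" for s
    unfolding eq1 by (intro rmult_R_linear_right linear_maps_closed[OF rdiff_R_linear] that)
  moreover have "(\<lambda>s. rmult R (p + 1) q (rdiff R p s) t) \<in> linear_maps K (T p) (T (p + q + 1))"
    if "t \<in> carrier (T q)" for t
    unfolding eq1 by (rule linear_maps_compose[OF rmult_R_linear_left[OF that] rdiff_R_linear])
  moreover have "(\<lambda>t. rmult R p (q + 1) s (rdiff R q t)) \<in> linear_maps K (T q) (T (p + q + 1))"
    if "s \<in> carrier (T p)" for s
    unfolding eq2 by (rule linear_maps_compose[OF rmult_R_linear_right[OF that] rdiff_R_linear])
  moreover have "(\<lambda>s. rmult R p (q + 1) s (rdiff R q t)) \<in> linear_maps K (T p) (T (p + q + 1))"
    if "t \<in> carrier (T q)" for t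
    unfolding eq2 by (intro rmult_R_linear_left linear_maps_closed[OF rdiff_R_linear] that)
  ultimately show "(\<lambda>s t. rmult R (p + 1) q (rdiff R p s) t
      \<oplus>\<^bsub>T (p + q + 1)\<^esub> signed (T (p + q + 1)) p (rmult R p (q + 1) s (rdiff R q t)))
    \<in> bilinear_maps K (T p) (T q) (T (p + q + 1))"
    by (intro bilinear_mapsI linear_maps_plus linear_maps_compose[OF linear_maps_sign] T_module)
next
  fix \<alpha> f \<beta> g
  assume f: "\<alpha> \<in> carrier A" "f \<in> carrier (rgr B p)" and g: "\<beta> \<in> carrier A" "g \<in> carrier (rgr B q)"
  let ?S = "rgr B (p + q + 1)"
  have c1: "rmult B (p + 1) q (rdiff B p f) g \<in> carrier ?S"
    using B_mult_closed[OF B_diff_closed[OF f(2)] g(2)] by (simp add: algebra_simps)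
  have c2: "rmult B p (q + 1) f (rdiff B q g) \<in> carrier ?S"
    using B_mult_closed[OF f(2) B_diff_closed[OF g(2)]] by (simp add: algebra_simps)
  have d: "p + 1 + q = p + q + 1" "p + (q + 1) = p + q + 1" by simp_all
  have "rdiff R (p + q) (rmult R p q (pt p \<alpha> f) (pt q \<beta> g)) =
      pt (p + q + 1) (\<alpha> \<otimes>\<^bsub>A\<^esub> \<beta>) (rdiff B (p + q) (rmult B p q f g))"
    using f g by (simp add: rmult_R_pure rdiff_R_pure B_mult_closed)
  also have "\<dots> = pt (p + q + 1) (\<alpha> \<otimes>\<^bsub>A\<^esub> \<beta>) (rmult B (p + 1) q (rdiff B p f) g)
      \<oplus>\<^bsub>T (p + q + 1)\<^esub> pt (p + q + 1) (\<alpha> \<otimes>\<^bsub>A\<^esub> \<beta>) (signed ?S p (rmult B p (q + 1) f (rdiff B q g)))"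
    using f g c1 signed_closed[OF B.rgr_module c2]
    by (simp add: B.rdiff_mult linear_maps_add[OF pt_linear_right])
  also have "\<dots> = rmult R (p + 1) q (rdiff R p (pt p \<alpha> f)) (pt q \<beta> g)
      \<oplus>\<^bsub>T (p + q + 1)\<^esub> signed (T (p + q + 1)) p (rmult R p (q + 1) (pt p \<alpha> f) (rdiff R q (pt q \<beta> g)))"
    using f g c2
    by (simp add: rmult_R_pure rdiff_R_pure B_diff_closed module_pair.pure_tensor_signed[OF pair] d)
  finally show "rdiff R (p + q) (rmult R p q (pt p \<alpha> f) (pt q \<beta> g)) =
      rmult R (p + 1) q (rdiff R p (pt p \<alpha> f)) (pt q \<beta> g)
      \<oplus>\<^bsub>T (p + q + 1)\<^esub> signed (T (p + q + 1)) p (rmult R p (q + 1) (pt p \<alpha> f) (rdiff R q (pt q \<beta> g)))" .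
qed

text \<open>The unit laws and the square-zero law are read as equalities with the identity map and
  the zero map, so that they too are tested on pure tensors.\<close>

lemma dg_central_ring_tensor: "dg_central_ring K R"
proof (intro dg_central_ring.intro dg_central_ring_axioms.intro, unfold rgr_R)
  fix p s assume s: "s \<in> carrier (T p)"
  have id: "(\<lambda>s. s) \<in> linear_maps K (T p) (T p)"
    by (simp add: linear_maps_def)
  have one: "rone R \<in> carrier (T 0)"
    by (simp add: rone_R pt_closed B.rone_closed)
  show "rmult R 0 p (rone R) s = s"
  proof (rule module_pair.linear_maps_tensor_eq[OF pair _ id _ s])
    show "rmult R 0 p (rone R) \<in> linear_maps K (T p) (T p)"
      using rmult_R_linear_right[OF one, of p] by simp
  qed (simp add: rone_R rmult_R_pure B.rone_closed B.rone_left)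
  show "rmult R p 0 s (rone R) = s"
  proof (rule module_pair.linear_maps_tensor_eq[OF pair _ id _ s])
    show "(\<lambda>s. rmult R p 0 s (rone R)) \<in> linear_maps K (T p) (T p)"
      using rmult_R_linear_left[OF one, of p] by simp
  qed (simp add: rone_R rmult_R_pure B.rone_closed B.rone_right)
  have zero: "(\<lambda>_. \<zero>\<^bsub>T (p + 2)\<^esub>) \<in> linear_maps K (T p) (T (p + 2))"
  proof -
    interpret module K "T (p + 2)" by (rule T_module)
    show ?thesis by (rule linear_mapsI) simp_all
  qed
  show "rdiff R (p + 1) (rdiff R p s) = \<zero>\<^bsub>T (p + 2)\<^esub>"
  proof (rule module_pair.linear_maps_tensor_eq[OF pair _ zero _ s])
    show "(\<lambda>s. rdiff R (p + 1) (rdiff R p s)) \<in> linear_maps K (T p) (T (p + 2))"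
      using linear_maps_compose[OF rdiff_R_linear rdiff_R_linear, of p] by (simp add: add.assoc)
  qed (simp add: rdiff_R_pure B_diff_closed B.rdiff_square module_pair.pure_tensor_zero_right[OF pair] add.assoc)
qed (simp_all add: A.R.cring_axioms T_module rmult_R_linear_left rmult_R_linear_right rmult_R_assoc rone_R
    pt_closed B.rone_closed rdiff_R_linear rdiff_R_mult)

end

section \<open>The dg category of dg modules\<close>

context abelian_group
begin

text \<open>The two shapes left by the parity cases of \<open>sign_identity_action\<close>.\<close>

lemma add_minus_cancel_left:
  assumes "a \<in> carrier G" "b \<in> carrier G" "c \<in> carrier G"
  shows "a \<oplus> b \<oplus> (\<ominus> a \<oplus> c) = b \<oplus> c" "\<ominus> a \<oplus> b \<oplus> (a \<oplus> c) = b \<oplus> c"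
proof -
  have "a \<oplus> b \<oplus> (\<ominus> a \<oplus> c) = b \<oplus> (a \<oplus> (\<ominus> a \<oplus> c))"
    using assms by (simp add: a_ac)
  then show "a \<oplus> b \<oplus> (\<ominus> a \<oplus> c) = b \<oplus> c" using assms by (simp add: r_neg2)
  have "\<ominus> a \<oplus> b \<oplus> (a \<oplus> c) = b \<oplus> (\<ominus> a \<oplus> (a \<oplus> c))"
    using assms by (simp add: a_ac)
  then show "\<ominus> a \<oplus> b \<oplus> (a \<oplus> c) = b \<oplus> c" using assms by (simp add: r_neg1)
qed

text \<open>The signs of d(u) at f.x, with a = b(f).u(x), b = f.d(u(x)) and c = f.u(d(x)). The
  a-terms cancel because pr and r + (p + 1)r have the same parity; the other two share the sign of
  exponent p(r + 1).\<close>

lemma sign_identity_action: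
  assumes "a \<in> carrier G" "b \<in> carrier G" "c \<in> carrier G"
  shows "signed G (p * r) (a \<oplus> signed G p b) \<ominus>
      signed G r (signed G ((p + 1) * r) a \<oplus> signed G p (signed G (p * r) c)) =
    signed G (p * (r + 1)) (b \<ominus> signed G r c)"
  using assms
  by (cases "even p"; cases "even r")
    (simp_all add: signed_def a_minus_def minus_add add_minus_cancel_left)

text \<open>Here a = d(u(d(x))), which occurs twice with opposite signs; the zeros stand for
  d(d(u(x))) and u(d(d(x))).\<close>

lemma sign_identity_square:
  assumes "a \<in> carrier G"
  shows "(\<zero> \<ominus> signed G r a) \<ominus> signed G (r + 1) (a \<ominus> signed G r \<zero>) = \<zero>"
proof -
  have "\<ominus> \<zero> = \<zero>" by (rule minus_equality) simp_all
  note this [simp]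
  show ?thesis
    using assms by (cases "even r") (simp_all add: signed_def a_minus_def r_neg l_neg)
qed

text \<open>With a = d(v(u(x))), b = v(d(u(x))) and c = v(u(d(x))), the middle term b is subtracted
  and added with the sign (-1)^s.\<close>

lemma sign_identity_comp:
  assumes "a \<in> carrier G" "b \<in> carrier G" "c \<in> carrier G"
  shows "a \<ominus> signed G (s + r) c = (a \<ominus> signed G s b) \<oplus> signed G s (b \<ominus> signed G r c)"
proof -
  have "a \<oplus> \<ominus> b \<oplus> (b \<oplus> d) = a \<oplus> d" "a \<oplus> b \<oplus> (\<ominus> b \<oplus> d) = a \<oplus> d" if "d \<in> carrier G" for d
    using assms that by (simp_all add: a_assoc r_neg1 r_neg2)
  then show ?thesis
    using assms
    by (cases "even s"; cases "even r") (simp_all add: signed_def a_minus_def minus_add)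
qed

end

section \<open>Morphisms of dg modules as families of maps\<close>

lemma carrier_hom_module: "carrier (hom_module H M M' r) = H"
  by (simp add: hom_module_def)

lemma mact_closed:
  "\<lbrakk>dg_module K B M; f \<in> carrier (rgr B p); x \<in> carrier (mgr M q)\<rbrakk> \<Longrightarrow> mact M p q f x \<in> carrier (mgr M (p + q))"
  using linear_maps_closed[OF dg_module.mact_linear_right] .

lemma mdiff_closed:
  "\<lbrakk>dg_module K B M; x \<in> carrier (mgr M q)\<rbrakk> \<Longrightarrow> mdiff M q x \<in> carrier (mgr M (q + 1))"
  using linear_maps_closed[OF dg_module.mdiff_linear] .

lemma dg_homsI:
  assumes "\<And>q. u q \<in> linear_maps K (mgr M q) (mgr M' (q + r))"
    and "\<And>q. u q \<in> extensional (carrier (mgr M q))"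
    and "\<And>p q f x. \<lbrakk>f \<in> carrier (rgr B p); x \<in> carrier (mgr M q)\<rbrakk> \<Longrightarrow>
      u (p + q) (mact M p q f x) = signed (mgr M' (p + q + r)) (p * r) (mact M' p (q + r) f (u q x))"
  shows "u \<in> dg_homs K B M M' r"
  using assms by (simp add: dg_homs_def)

lemma dg_homs_linear: "u \<in> dg_homs K B M M' r \<Longrightarrow> u q \<in> linear_maps K (mgr M q) (mgr M' (q + r))"
  and dg_homs_extensional: "u \<in> dg_homs K B M M' r \<Longrightarrow> u q \<in> extensional (carrier (mgr M q))"
  and dg_homs_mact: "\<lbrakk>u \<in> dg_homs K B M M' r; f \<in> carrier (rgr B p); x \<in> carrier (mgr M q)\<rbrakk> \<Longrightarrow>
      u (p + q) (mact M p q f x) = signed (mgr M' (p + q + r)) (p * r) (mact M' p (q + r) f (u q x))"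
  by (simp_all add: dg_homs_def)

lemmas dg_homs_closed = linear_maps_closed[OF dg_homs_linear]

text \<open>Extensionality fixes the values off the carriers, so agreement on the carriers is
  equality of families.\<close>

lemma dg_homs_eqI:
  assumes "u \<in> dg_homs K B M M' r" "v \<in> dg_homs K B M M' r"
    and "\<And>q x. x \<in> carrier (mgr M q) \<Longrightarrow> u q x = v q x"
  shows "u = v"
  using assms(3) extensionalityI[OF dg_homs_extensional[OF assms(1)] dg_homs_extensional[OF assms(2)]]
  by (intro ext) metis

text \<open>The right-hand side of the action law as a linear map in the value of the morphism. Sums
  and multiples of morphisms then obey the law by linearity.\<close>

lemma mact_sign_linear:
  assumes "dg_module K B M" "f \<in> carrier (rgr B p)"
  shows "(\<lambda>y. signed (mgr M (p + q + r)) n (mact M p (q + r) f y)) \<in> linear_maps K (mgr M (q + r)) (mgr M (p + q + r))"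
  unfolding add.assoc
  using assms by (intro linear_maps_compose[OF linear_maps_sign dg_module.mact_linear_right] dg_module.mgr_module)

text \<open>The operations on morphisms are defined by restricted functions; this reduces membership
  to the unrestricted formula on the carriers.\<close>

lemma dg_homs_restrictI:
  assumes M: "dg_module K B M"
    and u: "\<And>q. u q \<in> linear_maps K (mgr M q) (mgr M' (q + r))"
    and act: "\<And>p q f x. \<lbrakk>f \<in> carrier (rgr B p); x \<in> carrier (mgr M q)\<rbrakk> \<Longrightarrow>
      u (p + q) (mact M p q f x) = signed (mgr M' (p + q + r)) (p * r) (mact M' p (q + r) f (u q x))"
  shows "(\<lambda>q. restrict (u q) (carrier (mgr M q))) \<in> dg_homs K B M M' r"
proof (rule dg_homsI)
  fix q
  show "restrict (u q) (carrier (mgr M q)) \<in> linear_maps K (mgr M q) (mgr M' (q + r))"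
    using u linear_maps_cong[OF dg_module.mgr_module[OF M], of q "restrict (u q) (carrier (mgr M q))" "u q"]
    by simp
qed (simp_all add: act mact_closed[OF M])

section \<open>The complex of morphisms between two dg modules\<close>

context
  fixes K :: "('k, 'z) ring_scheme" and B :: "('k, 'b) dg_ring"
    and M M' :: "('k, 'b, 'm, 'y) dg_mod_scheme"
  assumes M: "dg_module K B M" and M': "dg_module K B M'"
begin

abbreviation (input) hom_cx where "hom_cx r \<equiv> hom_module (dg_homs K B M M' r) M M' r"

lemma hom_add_closed:
  assumes u: "u \<in> dg_homs K B M M' r" and v: "v \<in> dg_homs K B M M' r"
  shows "u \<oplus>\<^bsub>hom_cx r\<^esub> v \<in> dg_homs K B M M' r"
  unfolding hom_module_def ring_record_simps
proof (rule dg_homs_restrictI[OF M])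
  fix q show "(\<lambda>x. u q x \<oplus>\<^bsub>mgr M' (q + r)\<^esub> v q x) \<in> linear_maps K (mgr M q) (mgr M' (q + r))"
    by (intro linear_maps_plus dg_module.mgr_module[OF M'] dg_homs_linear[OF u] dg_homs_linear[OF v])
next
  fix p q f x assume f: "f \<in> carrier (rgr B p)" and x: "x \<in> carrier (mgr M q)"
  show "u (p + q) (mact M p q f x) \<oplus>\<^bsub>mgr M' (p + q + r)\<^esub> v (p + q) (mact M p q f x) =
    signed (mgr M' (p + q + r)) (p * r) (mact M' p (q + r) f (u q x \<oplus>\<^bsub>mgr M' (q + r)\<^esub> v q x))"
    using linear_maps_add[OF mact_sign_linear[OF M' f] dg_homs_closed[OF u x] dg_homs_closed[OF v x]]
    by (simp add: dg_homs_mact[OF u f x] dg_homs_mact[OF v f x])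
qed

lemma hom_smult_closed:
  assumes k: "k \<in> carrier K" and u: "u \<in> dg_homs K B M M' r"
  shows "k \<odot>\<^bsub>hom_cx r\<^esub> u \<in> dg_homs K B M M' r"
  unfolding hom_module_def module.simps
proof (rule dg_homs_restrictI[OF M])
  fix q show "(\<lambda>x. k \<odot>\<^bsub>mgr M' (q + r)\<^esub> u q x) \<in> linear_maps K (mgr M q) (mgr M' (q + r))"
    by (intro linear_maps_scale dg_module.mgr_module[OF M'] dg_homs_linear[OF u] k)
next
  fix p q f x assume f: "f \<in> carrier (rgr B p)" and x: "x \<in> carrier (mgr M q)"
  show "k \<odot>\<^bsub>mgr M' (p + q + r)\<^esub> u (p + q) (mact M p q f x) =
    signed (mgr M' (p + q + r)) (p * r) (mact M' p (q + r) f (k \<odot>\<^bsub>mgr M' (q + r)\<^esub> u q x))"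
    using linear_maps_smult[OF mact_sign_linear[OF M' f] k dg_homs_closed[OF u x]]
    by (simp add: dg_homs_mact[OF u f x])
qed

lemma hom_zero_closed: "\<zero>\<^bsub>hom_cx r\<^esub> \<in> dg_homs K B M M' r"
  unfolding hom_module_def ring_record_simps
proof (rule dg_homs_restrictI[OF M])
  fix q
  interpret module K "mgr M' (q + r)" by (rule dg_module.mgr_module[OF M'])
  show "(\<lambda>x. \<zero>\<^bsub>mgr M' (q + r)\<^esub>) \<in> linear_maps K (mgr M q) (mgr M' (q + r))"
    by (rule linear_mapsI) simp_all
next
  fix p q f x assume f: "f \<in> carrier (rgr B p)"
  show "\<zero>\<^bsub>mgr M' (p + q + r)\<^esub> =
    signed (mgr M' (p + q + r)) (p * r) (mact M' p (q + r) f \<zero>\<^bsub>mgr M' (q + r)\<^esub>)"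
    using linear_maps_zero[OF dg_module.mgr_module[OF M'] dg_module.mgr_module[OF M'] mact_sign_linear[OF M' f]]
    by simp
qed

lemma hom_apply:
  assumes "x \<in> carrier (mgr M q)"
  shows "(u \<oplus>\<^bsub>hom_cx r\<^esub> v) q x = u q x \<oplus>\<^bsub>mgr M' (q + r)\<^esub> v q x"
    and "(k \<odot>\<^bsub>hom_cx r\<^esub> u) q x = k \<odot>\<^bsub>mgr M' (q + r)\<^esub> u q x"
    and "\<zero>\<^bsub>hom_cx r\<^esub> q x = \<zero>\<^bsub>mgr M' (q + r)\<^esub>"
  using assms by (simp_all add: hom_module_def)

lemma hom_module_module: "module K (hom_cx r)"
proof (rule moduleI)
  interpret M': module K "mgr M' q" for q by (rule dg_module.mgr_module[OF M'])
  show "cring K" by (rule M'.cring_axioms)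
  note closed = hom_add_closed hom_smult_closed hom_zero_closed
  note simps = carrier_hom_module closed hom_apply dg_homs_closed
  show "abelian_group (hom_cx r)"
  proof (rule abelian_groupI; unfold carrier_hom_module)
    fix u v w
    assume u: "u \<in> dg_homs K B M M' r" and v: "v \<in> dg_homs K B M M' r" and w: "w \<in> dg_homs K B M M' r"
    show "u \<oplus>\<^bsub>hom_cx r\<^esub> v \<oplus>\<^bsub>hom_cx r\<^esub> w = u \<oplus>\<^bsub>hom_cx r\<^esub> (v \<oplus>\<^bsub>hom_cx r\<^esub> w)"
      by (rule dg_homs_eqI[where M = M and M' = M' and r = r and K = K and B = B]) (use u v w in \<open>simp_all add: simps M'.M.a_assoc\<close>)
  next
    fix u v assume u: "u \<in> dg_homs K B M M' r" and v: "v \<in> dg_homs K B M M' r"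
    show "u \<oplus>\<^bsub>hom_cx r\<^esub> v = v \<oplus>\<^bsub>hom_cx r\<^esub> u"
      by (rule dg_homs_eqI[where M = M and M' = M' and r = r and K = K and B = B]) (use u v in \<open>simp_all add: simps M'.M.a_comm\<close>)
  next
    fix u assume u: "u \<in> dg_homs K B M M' r"
    show "\<zero>\<^bsub>hom_cx r\<^esub> \<oplus>\<^bsub>hom_cx r\<^esub> u = u"
      by (rule dg_homs_eqI[where M = M and M' = M' and r = r and K = K and B = B]) (use u in \<open>simp_all add: simps\<close>)
    \<comment> \<open>The additive inverse is exhibited as (-1)u, whose closure is already
      known.\<close>
    have m1: "\<ominus>\<^bsub>K\<^esub> \<one>\<^bsub>K\<^esub> \<in> carrier K" by simp
    have "(\<ominus>\<^bsub>K\<^esub> \<one>\<^bsub>K\<^esub>) \<odot>\<^bsub>hom_cx r\<^esub> u \<oplus>\<^bsub>hom_cx r\<^esub> u = \<zero>\<^bsub>hom_cx r\<^esub>"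
      by (rule dg_homs_eqI[where M = M and M' = M' and r = r and K = K and B = B]) (use u in \<open>simp_all add: simps M'.smult_l_minus M'.M.l_neg\<close>)
    then show "\<exists>v\<in>dg_homs K B M M' r. v \<oplus>\<^bsub>hom_cx r\<^esub> u = \<zero>\<^bsub>hom_cx r\<^esub>"
      using hom_smult_closed[OF m1 u] by blast
  qed (simp_all add: closed)
next
  interpret M': module K "mgr M' q" for q by (rule dg_module.mgr_module[OF M'])
  note closed = hom_add_closed hom_smult_closed hom_zero_closed
  note simps = carrier_hom_module closed hom_apply dg_homs_closed
  {
    fix k u assume "k \<in> carrier K" "u \<in> carrier (hom_cx r)"
    then show "k \<odot>\<^bsub>hom_cx r\<^esub> u \<in> carrier (hom_cx r)" by (simp add: simps)
  next
    fix u assume "u \<in> carrier (hom_cx r)"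
    then show "\<one>\<^bsub>K\<^esub> \<odot>\<^bsub>hom_cx r\<^esub> u = u"
      by (intro dg_homs_eqI[where M = M and M' = M' and r = r and K = K and B = B]) (simp_all add: simps)
  next
    fix k u v assume "k \<in> carrier K" "u \<in> carrier (hom_cx r)" "v \<in> carrier (hom_cx r)"
    then show "k \<odot>\<^bsub>hom_cx r\<^esub> (u \<oplus>\<^bsub>hom_cx r\<^esub> v) = k \<odot>\<^bsub>hom_cx r\<^esub> u \<oplus>\<^bsub>hom_cx r\<^esub> k \<odot>\<^bsub>hom_cx r\<^esub> v"
      by (intro dg_homs_eqI[where M = M and M' = M' and r = r and K = K and B = B])
        (simp_all add: simps M'.smult_r_distr)
  next
    fix k l u assume "k \<in> carrier K" "l \<in> carrier K" "u \<in> carrier (hom_cx r)"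
    then show "(k \<oplus>\<^bsub>K\<^esub> l) \<odot>\<^bsub>hom_cx r\<^esub> u = k \<odot>\<^bsub>hom_cx r\<^esub> u \<oplus>\<^bsub>hom_cx r\<^esub> l \<odot>\<^bsub>hom_cx r\<^esub> u"
      by (intro dg_homs_eqI[where M = M and M' = M' and r = r and K = K and B = B])
        (simp_all add: simps M'.smult_l_distr)
  next
    fix k l u assume "k \<in> carrier K" "l \<in> carrier K" "u \<in> carrier (hom_cx r)"
    then show "(k \<otimes>\<^bsub>K\<^esub> l) \<odot>\<^bsub>hom_cx r\<^esub> u = k \<odot>\<^bsub>hom_cx r\<^esub> (l \<odot>\<^bsub>hom_cx r\<^esub> u)"
      by (intro dg_homs_eqI[where M = M and M' = M' and r = r and K = K and B = B])
        (simp_all add: simps M'.smult_assoc1)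
  }
qed

lemma hom_diff_apply:
  "x \<in> carrier (mgr M q) \<Longrightarrow> hom_diff M M' r u q x =
    mdiff M' (q + r) (u q x)
    \<ominus>\<^bsub>mgr M' (q + r + 1)\<^esub> signed (mgr M' (q + r + 1)) r (u (q + 1) (mdiff M q x))"
  by (simp add: hom_diff_def)

text \<open>The degree q + 1 + r is read as q + r + 1, so that both terms of the differential have
  the same target.\<close>

lemma hom_mdiff_linear:
  assumes u: "u \<in> dg_homs K B M M' r"
  shows "(\<lambda>x. u (q + 1) (mdiff M q x)) \<in> linear_maps K (mgr M q) (mgr M' (q + r + 1))"
  using linear_maps_compose[OF dg_homs_linear[OF u, of "q + 1"] dg_module.mdiff_linear[OF M, of q]]
  by (simp add: ac_simps)

lemma mdiff_hom_linear:
  assumes u: "u \<in> dg_homs K B M M' r"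
  shows "(\<lambda>x. mdiff M' (q + r) (u q x)) \<in> linear_maps K (mgr M q) (mgr M' (q + r + 1))"
  by (rule linear_maps_compose[OF dg_module.mdiff_linear[OF M'] dg_homs_linear[OF u]])

lemmas hom_mdiff_closed = linear_maps_closed[OF hom_mdiff_linear]
lemmas mdiff_hom_closed = linear_maps_closed[OF mdiff_hom_linear]

text \<open>The terms with b(f) coming from d(u(f.x)) and from u(d(f.x)) cancel, and the remaining
  ones carry the sign required in degree r + 1. This is \<open>sign_identity_action\<close>.\<close>

lemma hom_diff_closed:
  assumes u: "u \<in> dg_homs K B M M' r"
  shows "hom_diff M M' r u \<in> dg_homs K B M M' (r + 1)"
  unfolding hom_diff_def
proof (rule dg_homs_restrictI[OF M])
  fix q
  show "(\<lambda>x. mdiff M' (q + r) (u q x)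
      \<ominus>\<^bsub>mgr M' (q + r + 1)\<^esub> signed (mgr M' (q + r + 1)) r (u (q + 1) (mdiff M q x)))
    \<in> linear_maps K (mgr M q) (mgr M' (q + (r + 1)))"
    unfolding add.assoc[symmetric]
    by (intro linear_maps_diff mdiff_hom_linear[OF u] linear_maps_compose[OF linear_maps_sign hom_mdiff_linear[OF u]]
        dg_module.mgr_module[OF M'])
next
  fix p q f x assume f: "f \<in> carrier (rgr B p)" and x: "x \<in> carrier (mgr M q)"
  \<comment> \<open>One name for the module in degree p + q + r + 1, which is reached through
    differently bracketed sums.\<close>
  define P where "P = mgr M' (p + q + r + 1)"
  have modP: "module K P" unfolding P_def by (rule dg_module.mgr_module[OF M'])
  interpret P: module K P by (rule modP)
  have df: "rdiff B p f \<in> carrier (rgr B (p + 1))"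
    by (rule linear_maps_closed[OF dg_central_ring.rdiff_linear[OF dg_module.axioms(1)[OF M]] f])
  define a where "a = mact M' (p + 1) (q + r) (rdiff B p f) (u q x)"
  define b where "b = mact M' p (q + r + 1) f (mdiff M' (q + r) (u q x))"
  define c where "c = mact M' p (q + r + 1) f (u (q + 1) (mdiff M q x))"
  have ux: "u q x \<in> carrier (mgr M' (q + r))" by (rule dg_homs_closed[OF u x])
  have dx: "mdiff M q x \<in> carrier (mgr M (q + 1))" by (rule mdiff_closed[OF M x])
  have a: "a \<in> carrier P"
    using mact_closed[OF M' df ux] by (simp add: a_def P_def ac_simps)
  have b: "b \<in> carrier P"
    using mact_closed[OF M' f mdiff_closed[OF M' ux]] by (simp add: b_def P_def ac_simps)
  have c: "c \<in> carrier P"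
    using mact_closed[OF M' f hom_mdiff_closed[OF u x]] by (simp add: c_def P_def ac_simps)
  have mf: "mact M' p (q + r) f (u q x) \<in> carrier (mgr M' (p + q + r))"
    using mact_closed[OF M' f ux] by (simp add: ac_simps)
  have "mdiff M' (p + q + r) (u (p + q) (mact M p q f x)) =
      signed P (p * r) (mdiff M' (p + q + r) (mact M' p (q + r) f (u q x)))"
    unfolding P_def dg_homs_mact[OF u f x]
    by (rule linear_maps_signed[OF dg_module.mgr_module[OF M'] dg_module.mgr_module[OF M']
          dg_module.mdiff_linear[OF M'] mf])
  also have "mdiff M' (p + q + r) (mact M' p (q + r) f (u q x)) = a \<oplus>\<^bsub>P\<^esub> signed P p b"
    using dg_module.mdiff_mact[OF M' f ux] by (simp add: a_def b_def P_def ac_simps)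
  finally have 1: "mdiff M' (p + q + r) (u (p + q) (mact M p q f x)) =
      signed P (p * r) (a \<oplus>\<^bsub>P\<^esub> signed P p b)" .
  have c1: "mact M (p + 1) q (rdiff B p f) x \<in> carrier (mgr M (p + q + 1))"
    using mact_closed[OF M df x] by (simp add: ac_simps)
  have c2: "mact M p (q + 1) f (mdiff M q x) \<in> carrier (mgr M (p + q + 1))"
    using mact_closed[OF M f dx] by (simp add: ac_simps)
  have uP: "u (p + q + 1) \<in> linear_maps K (mgr M (p + q + 1)) P"
    using dg_homs_linear[OF u, of "p + q + 1"] by (simp add: P_def ac_simps)
  have u1: "u (p + q + 1) (mact M (p + 1) q (rdiff B p f) x) = signed P ((p + 1) * r) a"
    using dg_homs_mact[OF u df x] by (simp add: a_def P_def ac_simps)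
  have u2: "u (p + q + 1) (mact M p (q + 1) f (mdiff M q x)) = signed P (p * r) c"
    using dg_homs_mact[OF u f dx] by (simp add: c_def P_def ac_simps)
  have "u (p + q + 1) (mdiff M (p + q) (mact M p q f x)) =
      u (p + q + 1) (mact M (p + 1) q (rdiff B p f) x)
      \<oplus>\<^bsub>P\<^esub> u (p + q + 1) (signed (mgr M (p + q + 1)) p (mact M p (q + 1) f (mdiff M q x)))"
    unfolding dg_module.mdiff_mact[OF M f x]
    by (rule linear_maps_add[OF uP c1 signed_closed[OF dg_module.mgr_module[OF M] c2]])
  then have 2: "u (p + q + 1) (mdiff M (p + q) (mact M p q f x)) =
      signed P ((p + 1) * r) a \<oplus>\<^bsub>P\<^esub> signed P p (signed P (p * r) c)"
    by (simp only: linear_maps_signed[OF dg_module.mgr_module[OF M] modP uP c2] u1 u2)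
  let ?L = "mgr M' (q + r + 1)"
  have L: "mact M' p (q + r + 1) f \<in> linear_maps K ?L P"
    using dg_module.mact_linear_right[OF M' f, of "q + r + 1"] by (simp add: P_def ac_simps)
  have "mact M' p (q + r + 1) f (mdiff M' (q + r) (u q x) \<ominus>\<^bsub>?L\<^esub> signed ?L r (u (q + 1) (mdiff M q x))) =
      b \<ominus>\<^bsub>P\<^esub> signed P r c"
    unfolding b_def c_def
    using linear_maps_a_minus[OF dg_module.mgr_module[OF M'] modP L mdiff_hom_closed[OF u x]
        signed_closed[OF dg_module.mgr_module[OF M'] hom_mdiff_closed[OF u x]]]
      linear_maps_signed[OF dg_module.mgr_module[OF M'] modP L hom_mdiff_closed[OF u x]]
    by simp
  then show "mdiff M' (p + q + r) (u (p + q) (mact M p q f x))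
      \<ominus>\<^bsub>mgr M' (p + q + r + 1)\<^esub>
      signed (mgr M' (p + q + r + 1)) r (u (p + q + 1) (mdiff M (p + q) (mact M p q f x))) =
    signed (mgr M' (p + q + (r + 1))) (p * (r + 1))
      (mact M' p (q + (r + 1)) f (mdiff M' (q + r) (u q x) \<ominus>\<^bsub>?L\<^esub> signed ?L r (u (q + 1) (mdiff M q x))))"
    unfolding 1 2 P_def[symmetric] add.assoc[symmetric]
    using P.M.sign_identity_action[OF a b c] by simp
qed

lemma hom_diff_linear: "hom_diff M M' r \<in> linear_maps K (hom_cx r) (hom_cx (r + 1))"
proof (rule linear_mapsI; unfold carrier_hom_module)
  fix u v assume u: "u \<in> dg_homs K B M M' r" and v: "v \<in> dg_homs K B M M' r"
  note uv = hom_add_closed[OF u v]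
  show "hom_diff M M' r (u \<oplus>\<^bsub>hom_cx r\<^esub> v) = hom_diff M M' r u \<oplus>\<^bsub>hom_cx (r + 1)\<^esub> hom_diff M M' r v"
  proof (rule dg_homs_eqI[OF hom_diff_closed[OF uv]])
    show "hom_diff M M' r u \<oplus>\<^bsub>hom_cx (r + 1)\<^esub> hom_diff M M' r v \<in> dg_homs K B M M' (r + 1)"
      by (intro hom_add_closed hom_diff_closed u v)
    fix q x assume x: "x \<in> carrier (mgr M q)"
    let ?P = "mgr M' (q + r + 1)"
    interpret P: module K ?P by (rule dg_module.mgr_module[OF M'])
    note s = linear_maps_add[OF linear_maps_sign[OF P.module_axioms]]
      signed_closed[OF P.module_axioms]
    have sx: "(u \<oplus>\<^bsub>hom_cx r\<^esub> v) (q + 1) (mdiff M q x) = u (q + 1) (mdiff M q x) \<oplus>\<^bsub>?P\<^esub> v (q + 1) (mdiff M q x)"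
      using hom_apply(1)[OF mdiff_closed[OF M x], where u = u and v = v and r = r] by (simp add: ac_simps)
    show "hom_diff M M' r (u \<oplus>\<^bsub>hom_cx r\<^esub> v) q x = (hom_diff M M' r u \<oplus>\<^bsub>hom_cx (r + 1)\<^esub> hom_diff M M' r v) q x"
      using hom_mdiff_closed[OF u x] hom_mdiff_closed[OF v x] mdiff_hom_closed[OF u x] mdiff_hom_closed[OF v x]
        linear_maps_add[OF dg_module.mdiff_linear[OF M'] dg_homs_closed[OF u x] dg_homs_closed[OF v x]] x
      by (simp add: hom_apply(1)[OF x] hom_diff_apply[OF x] sx s add.assoc[symmetric] a_minus_def
          P.M.minus_add P.M.a_ac)
  qed
next
  fix k u assume k: "k \<in> carrier K" and u: "u \<in> dg_homs K B M M' r"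
  note ku = hom_smult_closed[OF k u]
  show "hom_diff M M' r (k \<odot>\<^bsub>hom_cx r\<^esub> u) = k \<odot>\<^bsub>hom_cx (r + 1)\<^esub> hom_diff M M' r u"
  proof (rule dg_homs_eqI[OF hom_diff_closed[OF ku]])
    show "k \<odot>\<^bsub>hom_cx (r + 1)\<^esub> hom_diff M M' r u \<in> dg_homs K B M M' (r + 1)"
      by (intro hom_smult_closed hom_diff_closed k u)
    fix q x assume x: "x \<in> carrier (mgr M q)"
    let ?P = "mgr M' (q + r + 1)"
    interpret P: module K ?P by (rule dg_module.mgr_module[OF M'])
    note s = linear_maps_smult[OF linear_maps_sign[OF P.module_axioms]]
      signed_closed[OF P.module_axioms]
    have sx: "(k \<odot>\<^bsub>hom_cx r\<^esub> u) (q + 1) (mdiff M q x) = k \<odot>\<^bsub>?P\<^esub> u (q + 1) (mdiff M q x)"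
      using hom_apply(2)[OF mdiff_closed[OF M x], where k = k and u = u and r = r] by (simp add: ac_simps)
    show "hom_diff M M' r (k \<odot>\<^bsub>hom_cx r\<^esub> u) q x = (k \<odot>\<^bsub>hom_cx (r + 1)\<^esub> hom_diff M M' r u) q x"
      using hom_mdiff_closed[OF u x] mdiff_hom_closed[OF u x]
        linear_maps_smult[OF dg_module.mdiff_linear[OF M'] k dg_homs_closed[OF u x]] x k
      by (simp add: hom_apply(2)[OF x] hom_diff_apply[OF x] sx s add.assoc[symmetric] a_minus_def
          P.smult_r_distr P.smult_r_minus)
  qed
qed (rule hom_diff_closed)

lemma hom_diff_square:
  assumes u: "u \<in> dg_homs K B M M' r"
  shows "hom_diff M M' (r + 1) (hom_diff M M' r u) = \<zero>\<^bsub>hom_cx (r + 2)\<^esub>"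
proof (rule dg_homs_eqI[OF _ hom_zero_closed])
  show "hom_diff M M' (r + 1) (hom_diff M M' r u) \<in> dg_homs K B M M' (r + 2)"
    using hom_diff_closed[OF hom_diff_closed[OF u]] by (simp add: add.assoc)
  fix q x assume x: "x \<in> carrier (mgr M q)"
  let ?Q = "mgr M' (q + r + 1)"
  define P where "P = mgr M' (q + r + 2)"
  have modP: "module K P" unfolding P_def by (rule dg_module.mgr_module[OF M'])
  interpret P: module K P by (rule modP)
  have dx: "mdiff M q x \<in> carrier (mgr M (q + 1))" by (rule mdiff_closed[OF M x])
  define a where "a = mdiff M' (q + r + 1) (u (q + 1) (mdiff M q x))"
  have dP: "mdiff M' (q + r + 1) \<in> linear_maps K ?Q P"
    using dg_module.mdiff_linear[OF M', of "q + r + 1"] by (simp add: P_def add.assoc)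
  have a: "a \<in> carrier P"
    unfolding a_def by (rule linear_maps_closed[OF dP hom_mdiff_closed[OF u x]])
  have "mdiff M' (q + r + 1) (hom_diff M M' r u q x) =
      mdiff M' (q + r + 1) (mdiff M' (q + r) (u q x)) \<ominus>\<^bsub>P\<^esub>
      mdiff M' (q + r + 1) (signed ?Q r (u (q + 1) (mdiff M q x)))"
    unfolding hom_diff_apply[OF x]
    by (rule linear_maps_a_minus[OF dg_module.mgr_module[OF M'] modP dP mdiff_hom_closed[OF u x]
        signed_closed[OF dg_module.mgr_module[OF M'] hom_mdiff_closed[OF u x]]])
  then have 1: "mdiff M' (q + r + 1) (hom_diff M M' r u q x) = \<zero>\<^bsub>P\<^esub> \<ominus>\<^bsub>P\<^esub> signed P r a"
    using linear_maps_signed[OF dg_module.mgr_module[OF M'] modP dP hom_mdiff_closed[OF u x]]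
      dg_module.mdiff_square[OF M' dg_homs_closed[OF u x]]
    by (simp add: a_def P_def)
  have "u (q + 2) (mdiff M (q + 1) (mdiff M q x)) = \<zero>\<^bsub>P\<^esub>"
    using dg_module.mdiff_square[OF M x] linear_maps_zero[OF dg_module.mgr_module[OF M]
        dg_module.mgr_module[OF M'] dg_homs_linear[OF u, of "q + 2"]]
    by (simp add: P_def ac_simps)
  then have 2: "hom_diff M M' r u (q + 1) (mdiff M q x) = a \<ominus>\<^bsub>P\<^esub> signed P r \<zero>\<^bsub>P\<^esub>"
    using hom_diff_apply[OF dx, of r u] by (simp add: a_def P_def ac_simps)
  have "hom_diff M M' (r + 1) (hom_diff M M' r u) q x = \<zero>\<^bsub>P\<^esub>"
    using P.M.sign_identity_square[OF a, of r] 1 2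
    by (simp add: hom_diff_apply[OF x] P_def add.assoc)
  then show "hom_diff M M' (r + 1) (hom_diff M M' r u) q x = \<zero>\<^bsub>hom_cx (r + 2)\<^esub> q x"
    by (simp add: hom_apply(3)[OF x] P_def add.assoc)
qed

end

section \<open>Composition and the dg category axioms\<close>

lemma hom_comp_apply: "x \<in> carrier (mgr M q) \<Longrightarrow> hom_comp M r v u q x = v (q + r) (u q x)"
  by (simp add: hom_comp_def compose_def)

text \<open>The signs contributed by u and v multiply, since pr + ps = p(s + r).\<close>

lemma hom_comp_closed:
  assumes M: "dg_module K B M" and M': "dg_module K B M'" and M'': "dg_module K B M''"
    and v: "v \<in> dg_homs K B M' M'' s" and u: "u \<in> dg_homs K B M M' r"
  shows "hom_comp M r v u \<in> dg_homs K B M M'' (s + r)"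
  unfolding hom_comp_def compose_def
proof (rule dg_homs_restrictI[OF M])
  have idx: "q + (s + r) = q + r + s" for q by simp
  fix q show "(\<lambda>x. v (q + r) (u q x)) \<in> linear_maps K (mgr M q) (mgr M'' (q + (s + r)))"
    unfolding idx by (rule linear_maps_compose[OF dg_homs_linear[OF v] dg_homs_linear[OF u]])
next
  fix p q f x assume f: "f \<in> carrier (rgr B p)" and x: "x \<in> carrier (mgr M q)"
  have idx: "p + q + (s + r) = p + q + r + s" "q + (s + r) = q + r + s" by simp_all
  have ux: "u q x \<in> carrier (mgr M' (q + r))" by (rule dg_homs_closed[OF u x])
  have m': "mact M' p (q + r) f (u q x) \<in> carrier (mgr M' (p + q + r))"
    using mact_closed[OF M' f ux] by (simp add: add.assoc)
  have m'': "mact M'' p (q + r + s) f (v (q + r) (u q x)) \<in> carrier (mgr M'' (p + q + r + s))"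
    using mact_closed[OF M'' f dg_homs_closed[OF v ux]] by (simp add: add.assoc)
  have "v (p + q + r) (u (p + q) (mact M p q f x)) =
      signed (mgr M'' (p + q + r + s)) (p * r) (v (p + q + r) (mact M' p (q + r) f (u q x)))"
    unfolding dg_homs_mact[OF u f x]
    by (rule linear_maps_signed[OF dg_module.mgr_module[OF M'] dg_module.mgr_module[OF M''] dg_homs_linear[OF v] m'])
  also have "v (p + q + r) (mact M' p (q + r) f (u q x)) =
      signed (mgr M'' (p + q + r + s)) (p * s) (mact M'' p (q + r + s) f (v (q + r) (u q x)))"
    using dg_homs_mact[OF v f ux] by (simp add: add.assoc)
  finally show "v (p + q + r) (u (p + q) (mact M p q f x)) =
      signed (mgr M'' (p + q + (s + r))) (p * (s + r)) (mact M'' p (q + (s + r)) f (v (q + r) (u q x)))"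
    unfolding idx signed_signed[OF dg_module.mgr_module[OF M''] m'']
    by (simp add: distrib_left add.commute)
qed

text \<open>At a point of the carrier the Leibniz rule is \<open>sign_identity_comp\<close>. The
  equality of morphisms is assembled from this in \<open>dg_category_dg_modules\<close>.\<close>

lemma hom_diff_comp:
  assumes M: "dg_module K B M" and M': "dg_module K B M'" and M'': "dg_module K B M''"
    and v: "v \<in> dg_homs K B M' M'' s" and u: "u \<in> dg_homs K B M M' r" and x: "x \<in> carrier (mgr M q)"
  shows "hom_diff M M'' (s + r) (hom_comp M r v u) q x =
    hom_comp M r (hom_diff M' M'' s v) u q x \<oplus>\<^bsub>mgr M'' (q + r + s + 1)\<^esub>
    signed (mgr M'' (q + r + s + 1)) s (hom_comp M (r + 1) v (hom_diff M M' r u) q x)"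
proof -
  define P where "P = mgr M'' (q + r + s + 1)"
  have modP: "module K P" unfolding P_def by (rule dg_module.mgr_module[OF M''])
  interpret P: module K P by (rule modP)
  have ux: "u q x \<in> carrier (mgr M' (q + r))" by (rule dg_homs_closed[OF u x])
  have dx: "mdiff M q x \<in> carrier (mgr M (q + 1))" by (rule mdiff_closed[OF M x])
  define a where "a = mdiff M'' (q + r + s) (v (q + r) (u q x))"
  define b where "b = v (q + r + 1) (mdiff M' (q + r) (u q x))"
  define c where "c = v (q + r + 1) (u (q + 1) (mdiff M q x))"
  have vP: "v (q + r + 1) \<in> linear_maps K (mgr M' (q + r + 1)) P"
    using dg_homs_linear[OF v, of "q + r + 1"] by (simp add: P_def ac_simps)
  have a: "a \<in> carrier P"
    unfolding a_def P_def by (rule mdiff_hom_closed[OF M' M'' v ux])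
  have b: "b \<in> carrier P"
    unfolding b_def by (rule linear_maps_closed[OF vP mdiff_hom_closed[OF M M' u x]])
  have c: "c \<in> carrier P"
    unfolding c_def by (rule linear_maps_closed[OF vP hom_mdiff_closed[OF M M' u x]])
  have 1: "hom_diff M M'' (s + r) (hom_comp M r v u) q x = a \<ominus>\<^bsub>P\<^esub> signed P (s + r) c"
    using hom_comp_apply[OF x, of r v u] hom_comp_apply[OF dx, of r v u]
    by (simp add: hom_diff_apply[OF M M'' x] a_def c_def P_def ac_simps)
  have 2: "hom_comp M r (hom_diff M' M'' s v) u q x = a \<ominus>\<^bsub>P\<^esub> signed P s b"
    by (simp add: hom_comp_apply[OF x] hom_diff_apply[OF M' M'' ux] a_def b_def P_def)
  have "v (q + r + 1) (hom_diff M M' r u q x) = b \<ominus>\<^bsub>P\<^esub> signed P r c"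
    using linear_maps_a_minus[OF dg_module.mgr_module[OF M'] modP vP mdiff_hom_closed[OF M M' u x]
        signed_closed[OF dg_module.mgr_module[OF M'] hom_mdiff_closed[OF M M' u x]]]
      linear_maps_signed[OF dg_module.mgr_module[OF M'] modP vP hom_mdiff_closed[OF M M' u x]]
    by (simp add: hom_diff_apply[OF M M' x] b_def c_def)
  then have 3: "hom_comp M (r + 1) v (hom_diff M M' r u) q x = b \<ominus>\<^bsub>P\<^esub> signed P r c"
    by (simp add: hom_comp_apply[OF x] add.assoc)
  show ?thesis
    using P.M.sign_identity_comp[OF a b c, of s r] unfolding 1 2 P_def[symmetric] 3 .
qed

text \<open>Negation in the morphism module is the abstract additive inverse, with no pointwise
  formula of its own. Evaluation at x is \<open>K\<close>-linear and therefore commutes with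
  it.\<close>

lemma hom_module_signed:
  assumes M: "dg_module K B M" and M': "dg_module K B M'" and u: "u \<in> dg_homs K B M M' r" and x: "x \<in> carrier (mgr M q)"
  shows "signed (hom_module (dg_homs K B M M' r) M M' r) n u q x = signed (mgr M' (q + r)) n (u q x)"
proof -
  let ?H = "hom_module (dg_homs K B M M' r) M M' r"
  have "(\<lambda>u. u q x) \<in> linear_maps K ?H (mgr M' (q + r))"
    by (rule linear_mapsI) (use x in \<open>auto simp: hom_module_def dg_homs_closed[OF _ x]\<close>)
  moreover have "u \<in> carrier ?H" using u by (simp add: carrier_hom_module)
  ultimately show ?thesis
    using linear_maps_signed[OF hom_module_module[OF M M'] dg_module.mgr_module[OF M']] by blast
qed

text \<open>Stated for an arbitrary dg central ring so that it can be applied to A \<otimes> B.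
  Equations between morphisms are reduced to their values on the carriers.\<close>

theorem dg_category_dg_modules:
  assumes B: "dg_central_ring K B"
  shows "dg_category K (dg_modules K B :: ('k, ('k, 'b, 'm) dg_mod, int \<Rightarrow> 'm \<Rightarrow> 'm) dg_cat)"
proof -
  let ?C = "dg_modules K B :: ('k, ('k, 'b, 'm) dg_mod, int \<Rightarrow> 'm \<Rightarrow> 'm) dg_cat"
  let ?H = "\<lambda>M M' r. hom_module (dg_homs K B M M' r) M M' r"
  have C: "Obj ?C = {M. dg_module K B M}" "Hom ?C = ?H" "Hdiff ?C = hom_diff"
    "Comp ?C = (\<lambda>M M' M'' s r. hom_comp M r)" "Ident ?C = hom_ident"
    by (simp_all add: dg_modules_def)
  have ident: "hom_ident M \<in> dg_homs K B M M 0" if M: "dg_module K B M" for M :: "('k, 'b, 'm) dg_mod"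
    unfolding hom_ident_def
    by (rule dg_homs_restrictI[OF M]) (simp_all add: linear_maps_def signed_def)
  show ?thesis
  proof (intro dg_category.intro dg_category_axioms.intro, unfold C mem_Collect_eq carrier_hom_module)
    show "cring K" by (rule dg_central_ring.axioms(1)[OF B])
  next
    fix M M' :: "('k, 'b, 'm) dg_mod" and r
    assume M: "dg_module K B M" and M': "dg_module K B M'"
    show "module K (?H M M' r)" by (rule hom_module_module[OF M M'])
    show "hom_diff M M' r \<in> linear_maps K (?H M M' r) (?H M M' (r + 1))" by (rule hom_diff_linear[OF M M'])
    fix u assume u: "u \<in> dg_homs K B M M' r"
    show "hom_diff M M' (r + 1) (hom_diff M M' r u) = \<zero>\<^bsub>?H M M' (r + 2)\<^esub>" by (rule hom_diff_square[OF M M' u])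
    show "hom_comp M r (hom_ident M') u = u"
    proof (rule dg_homs_eqI[OF _ u])
      show "hom_comp M r (hom_ident M') u \<in> dg_homs K B M M' r"
        using hom_comp_closed[OF M M' M' ident[OF M'] u] by simp
    qed (simp add: hom_comp_apply hom_ident_def dg_homs_closed[OF u])
    show "hom_comp M 0 u (hom_ident M) = u"
    proof (rule dg_homs_eqI[OF _ u])
      show "hom_comp M 0 u (hom_ident M) \<in> dg_homs K B M M' r"
        using hom_comp_closed[OF M M M' u ident[OF M]] by simp
    qed (simp add: hom_comp_apply hom_ident_def)
  next
    fix M :: "('k, 'b, 'm) dg_mod" assume "dg_module K B M"
    then show "hom_ident M \<in> dg_homs K B M M 0" by (rule ident)
  next
    fix M M' M'' :: "('k, 'b, 'm) dg_mod" and s r v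
    assume M: "dg_module K B M" and M': "dg_module K B M'" and M'': "dg_module K B M''"
      and v: "v \<in> dg_homs K B M' M'' s"
    show "hom_comp M r v \<in> linear_maps K (?H M M' r) (?H M M'' (s + r))"
    proof (rule linear_mapsI; unfold carrier_hom_module)
      fix u w assume u: "u \<in> dg_homs K B M M' r" and w: "w \<in> dg_homs K B M M' r"
      show "hom_comp M r v (u \<oplus>\<^bsub>?H M M' r\<^esub> w) = hom_comp M r v u \<oplus>\<^bsub>?H M M'' (s + r)\<^esub> hom_comp M r v w"
      proof (rule dg_homs_eqI)
        show "hom_comp M r v (u \<oplus>\<^bsub>?H M M' r\<^esub> w) \<in> dg_homs K B M M'' (s + r)"
          "hom_comp M r v u \<oplus>\<^bsub>?H M M'' (s + r)\<^esub> hom_comp M r v w \<in> dg_homs K B M M'' (s + r)"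
          by (intro hom_add_closed[OF M M'] hom_add_closed[OF M M''] hom_comp_closed[OF M M' M''] u v w)+
        fix q x assume x: "x \<in> carrier (mgr M q)"
        show "hom_comp M r v (u \<oplus>\<^bsub>?H M M' r\<^esub> w) q x = (hom_comp M r v u \<oplus>\<^bsub>?H M M'' (s + r)\<^esub> hom_comp M r v w) q x"
          using linear_maps_add[OF dg_homs_linear[OF v] dg_homs_closed[OF u x] dg_homs_closed[OF w x]]
          by (simp add: hom_comp_apply[OF x] hom_apply[OF M M' x] hom_apply[OF M M'' x] ac_simps)
      qed
    next
      fix k u assume k: "k \<in> carrier K" and u: "u \<in> dg_homs K B M M' r"
      show "hom_comp M r v (k \<odot>\<^bsub>?H M M' r\<^esub> u) = k \<odot>\<^bsub>?H M M'' (s + r)\<^esub> hom_comp M r v u"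
      proof (rule dg_homs_eqI)
        show "hom_comp M r v (k \<odot>\<^bsub>?H M M' r\<^esub> u) \<in> dg_homs K B M M'' (s + r)"
          "k \<odot>\<^bsub>?H M M'' (s + r)\<^esub> hom_comp M r v u \<in> dg_homs K B M M'' (s + r)"
          by (intro hom_smult_closed[OF M M'] hom_smult_closed[OF M M''] hom_comp_closed[OF M M' M''] u v k)+
        fix q x assume x: "x \<in> carrier (mgr M q)"
        show "hom_comp M r v (k \<odot>\<^bsub>?H M M' r\<^esub> u) q x = (k \<odot>\<^bsub>?H M M'' (s + r)\<^esub> hom_comp M r v u) q x"
          using linear_maps_smult[OF dg_homs_linear[OF v] k dg_homs_closed[OF u x]]
          by (simp add: hom_comp_apply[OF x] hom_apply[OF M M' x] hom_apply[OF M M'' x] ac_simps)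
      qed
    qed (rule hom_comp_closed[OF M M' M'' v])
    fix u assume u: "u \<in> dg_homs K B M M' r"
    let ?P = "?H M M'' (s + r + 1)"
    show "hom_diff M M'' (s + r) (hom_comp M r v u) =
      hom_comp M r (hom_diff M' M'' s v) u \<oplus>\<^bsub>?P\<^esub> signed ?P s (hom_comp M (r + 1) v (hom_diff M M' r u))"
    proof (rule dg_homs_eqI)
      have dv: "hom_comp M r (hom_diff M' M'' s v) u \<in> dg_homs K B M M'' (s + r + 1)"
        using hom_comp_closed[OF M M' M'' hom_diff_closed[OF M' M'' v] u] by (simp add: ac_simps)
      have du: "hom_comp M (r + 1) v (hom_diff M M' r u) \<in> dg_homs K B M M'' (s + r + 1)"
        using hom_comp_closed[OF M M' M'' v hom_diff_closed[OF M M' u]] by (simp add: ac_simps)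
      then have "hom_comp M (r + 1) v (hom_diff M M' r u) \<in> carrier ?P"
        by (simp add: carrier_hom_module)
      then have "signed ?P s (hom_comp M (r + 1) v (hom_diff M M' r u)) \<in> carrier ?P"
        by (rule signed_closed[OF hom_module_module[OF M M'']])
      then show "hom_comp M r (hom_diff M' M'' s v) u \<oplus>\<^bsub>?P\<^esub> signed ?P s (hom_comp M (r + 1) v (hom_diff M M' r u))
          \<in> dg_homs K B M M'' (s + r + 1)"
        unfolding carrier_hom_module by (rule hom_add_closed[OF M M'' dv])
      show "hom_diff M M'' (s + r) (hom_comp M r v u) \<in> dg_homs K B M M'' (s + r + 1)"
        by (intro hom_diff_closed[OF M M''] hom_comp_closed[OF M M' M''] u v)
      fix q x assume x: "x \<in> carrier (mgr M q)"
      show "hom_diff M M'' (s + r) (hom_comp M r v u) q x =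
        (hom_comp M r (hom_diff M' M'' s v) u \<oplus>\<^bsub>?P\<^esub> signed ?P s (hom_comp M (r + 1) v (hom_diff M M' r u))) q x"
        \<comment> \<open>\<open>hom_module_signed\<close> turns the sign in the morphism module
          into a sign in \<open>M''\<close>, where the pointwise Leibniz rule applies.\<close>
        unfolding hom_apply[OF M M'' x] hom_module_signed[OF M M'' du x] hom_diff_comp[OF M M' M'' v u x]
        by (simp add: ac_simps)
    qed
  next
    fix M M' M'' :: "('k, 'b, 'm) dg_mod" and s r u
    assume M: "dg_module K B M" and M': "dg_module K B M'" and M'': "dg_module K B M''"
      and u: "u \<in> dg_homs K B M M' r"
    show "(\<lambda>v. hom_comp M r v u) \<in> linear_maps K (?H M' M'' s) (?H M M'' (s + r))"
    proof (rule linear_mapsI; unfold carrier_hom_module)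
      fix v w assume v: "v \<in> dg_homs K B M' M'' s" and w: "w \<in> dg_homs K B M' M'' s"
      show "hom_comp M r (v \<oplus>\<^bsub>?H M' M'' s\<^esub> w) u = hom_comp M r v u \<oplus>\<^bsub>?H M M'' (s + r)\<^esub> hom_comp M r w u"
      proof (rule dg_homs_eqI)
        show "hom_comp M r (v \<oplus>\<^bsub>?H M' M'' s\<^esub> w) u \<in> dg_homs K B M M'' (s + r)"
          "hom_comp M r v u \<oplus>\<^bsub>?H M M'' (s + r)\<^esub> hom_comp M r w u \<in> dg_homs K B M M'' (s + r)"
          by (intro hom_add_closed[OF M' M''] hom_add_closed[OF M M''] hom_comp_closed[OF M M' M''] u v w)+
        fix q x assume x: "x \<in> carrier (mgr M q)"
        show "hom_comp M r (v \<oplus>\<^bsub>?H M' M'' s\<^esub> w) u q x = (hom_comp M r v u \<oplus>\<^bsub>?H M M'' (s + r)\<^esub> hom_comp M r w u) q x"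
          by (simp add: hom_comp_apply[OF x] hom_apply[OF M' M'' dg_homs_closed[OF u x]] hom_apply[OF M M'' x] ac_simps)
      qed
    next
      fix k v assume k: "k \<in> carrier K" and v: "v \<in> dg_homs K B M' M'' s"
      show "hom_comp M r (k \<odot>\<^bsub>?H M' M'' s\<^esub> v) u = k \<odot>\<^bsub>?H M M'' (s + r)\<^esub> hom_comp M r v u"
      proof (rule dg_homs_eqI)
        show "hom_comp M r (k \<odot>\<^bsub>?H M' M'' s\<^esub> v) u \<in> dg_homs K B M M'' (s + r)"
          "k \<odot>\<^bsub>?H M M'' (s + r)\<^esub> hom_comp M r v u \<in> dg_homs K B M M'' (s + r)"
          by (intro hom_smult_closed[OF M' M''] hom_smult_closed[OF M M''] hom_comp_closed[OF M M' M''] u v k)+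
        fix q x assume x: "x \<in> carrier (mgr M q)"
        show "hom_comp M r (k \<odot>\<^bsub>?H M' M'' s\<^esub> v) u q x = (k \<odot>\<^bsub>?H M M'' (s + r)\<^esub> hom_comp M r v u) q x"
          by (simp add: hom_comp_apply[OF x] hom_apply[OF M' M'' dg_homs_closed[OF u x]] hom_apply[OF M M'' x] ac_simps)
      qed
    qed (rule hom_comp_closed[OF M M' M'' _ u])
  next
    fix L M M' M'' :: "('k, 'b, 'm) dg_mod" and t s r w v u
    assume L: "dg_module K B L" and M: "dg_module K B M" and M': "dg_module K B M'" and M'': "dg_module K B M''"
      and w: "w \<in> dg_homs K B M' M'' t" and v: "v \<in> dg_homs K B M M' s" and u: "u \<in> dg_homs K B L M r"
    show "hom_comp L r (hom_comp M s w v) u = hom_comp L (s + r) w (hom_comp L r v u)"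
    proof (rule dg_homs_eqI)
      show "hom_comp L r (hom_comp M s w v) u \<in> dg_homs K B L M'' (t + s + r)"
        by (intro hom_comp_closed[OF L M M''] hom_comp_closed[OF M M' M''] u v w)
      show "hom_comp L (s + r) w (hom_comp L r v u) \<in> dg_homs K B L M'' (t + s + r)"
        unfolding add.assoc by (intro hom_comp_closed[OF L M' M''] hom_comp_closed[OF L M M'] u v w)
      fix q x assume x: "x \<in> carrier (mgr L q)"
      show "hom_comp L r (hom_comp M s w v) u q x = hom_comp L (s + r) w (hom_comp L r v u) q x"
        by (simp add: hom_comp_apply[OF x] hom_comp_apply[OF dg_homs_closed[OF u x]] ac_simps)
    qed
  qed
qed

text \<open>Morphism complexes are assumed equal along \<open>Fo\<close>, not merely isomorphic.
  Hence each axiom for \<open>C\<close> is an instance of the same axiom for \<open>D\<close>, and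
  the identity on morphisms is functorial in both directions.\<close>

lemma dg_isomorphism_transport:
  assumes D: "dg_category K D"
    and Fo: "\<And>X. X \<in> Obj C \<Longrightarrow> Fo X \<in> Obj D" and Go: "\<And>X. X \<in> Obj D \<Longrightarrow> Go X \<in> Obj C"
    and GF: "\<And>X. X \<in> Obj C \<Longrightarrow> Go (Fo X) = X" and FG: "\<And>X. X \<in> Obj D \<Longrightarrow> Fo (Go X) = X"
    and Hom: "\<And>X Y r. \<lbrakk>X \<in> Obj C; Y \<in> Obj C\<rbrakk> \<Longrightarrow> Hom C X Y r = Hom D (Fo X) (Fo Y) r"
    and Hdiff: "\<And>X Y r. \<lbrakk>X \<in> Obj C; Y \<in> Obj C\<rbrakk> \<Longrightarrow> Hdiff C X Y r = Hdiff D (Fo X) (Fo Y) r"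
    and Comp: "\<And>X Y Z s r. \<lbrakk>X \<in> Obj C; Y \<in> Obj C; Z \<in> Obj C\<rbrakk> \<Longrightarrow>
      Comp C X Y Z s r = Comp D (Fo X) (Fo Y) (Fo Z) s r"
    and Ident: "\<And>X. X \<in> Obj C \<Longrightarrow> Ident C X = Ident D (Fo X)"
  shows "dg_isomorphism K C D Fo (\<lambda>_ _ _ u. u)"
proof -
  interpret D: dg_category K D by fact
  note transport = Fo Hom Hdiff Comp Ident
  have C: "dg_category K C"
    by (intro dg_category.intro dg_category_axioms.intro)
      (simp_all add: transport D.cring_axioms D.Hom_module D.Hdiff_linear D.Hdiff_square D.Comp_linear_left
        D.Comp_linear_right D.Comp_assoc D.Ident_closed D.Ident_left D.Ident_right D.Hdiff_Comp)
  have id: "(\<lambda>u. u) \<in> linear_maps K H H" for H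
    by (simp add: linear_maps_def)
  have "dg_functor K C D Fo (\<lambda>_ _ _ u. u)"
    by (intro dg_functor.intro dg_functor_axioms.intro C D) (simp_all add: transport id)
  moreover have "dg_functor K D C Go (\<lambda>_ _ _ u. u)"
    by (intro dg_functor.intro dg_functor_axioms.intro C D) (simp_all add: transport Go FG id)
  ultimately show ?thesis
    unfolding dg_isomorphism_def using GF FG by blast
qed

section \<open>The isomorphism\<close>

context dg_module_in
begin

lemma mactA_closed: "\<lbrakk>\<alpha> \<in> carrier A; x \<in> carrier (mgr M q)\<rbrakk> \<Longrightarrow> mactA M q \<alpha> x \<in> carrier (mgr M q)"
  using left_module.act_closed[OF mactA_module] .

text \<open>\<open>\<alpha>(kx) = \<alpha>((k1)x) = (k\<alpha>)x = k(\<alpha>x)\<close>\<close>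

lemma mactA_linear_right:
  assumes \<alpha>: "\<alpha> \<in> carrier A"
  shows "mactA M q \<alpha> \<in> linear_maps K (mgr M q) (mgr M q)"
proof (rule linear_mapsI)
  interpret L: left_module A "mgr M q" "mactA M q" by (rule mactA_module)
  interpret N: module K "mgr M q" by (rule mgr_module)
  fix k x assume k: "k \<in> carrier K" and x: "x \<in> carrier (mgr M q)"
  have k1: "k \<odot>\<^bsub>A\<^esub> \<one>\<^bsub>A\<^esub> \<in> carrier A" using k by simp
  have "mactA M q \<alpha> (k \<odot>\<^bsub>mgr M q\<^esub> x) = mactA M q \<alpha> (mactA M q (k \<odot>\<^bsub>A\<^esub> \<one>\<^bsub>A\<^esub>) x)"
    using k x by (simp add: mactA_smult L.act_one)
  also have "\<dots> = mactA M q (k \<odot>\<^bsub>A\<^esub> \<alpha>) x"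
    using k x \<alpha> k1 by (simp add: L.act_mult[symmetric] A.smult_mult_right)
  finally show "mactA M q \<alpha> (k \<odot>\<^bsub>mgr M q\<^esub> x) = k \<odot>\<^bsub>mgr M q\<^esub> mactA M q \<alpha> x"
    using k x \<alpha> by (simp add: mactA_smult)
qed (use \<alpha> in \<open>simp_all add: left_module.act_closed[OF mactA_module] left_module.act_add_right[OF mactA_module]\<close>)

lemma mactA_linear_left:
  "x \<in> carrier (mgr M q) \<Longrightarrow> (\<lambda>\<alpha>. mactA M q \<alpha> x) \<in> linear_maps K A (mgr M q)"
  by (rule linear_mapsI)
    (simp_all add: mactA_closed left_module.act_add_left[OF mactA_module] mactA_smult)

lemma action_closed: "\<lbrakk>f \<in> carrier (rgr B p); x \<in> carrier (mgr M q)\<rbrakk> \<Longrightarrow> mact M p q f x \<in> carrier (mgr M (p + q))"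
  using linear_maps_closed[OF mact_linear_right] .

text \<open>Makes the lift in \<open>Phi_obj\<close> meaningful. Homogeneity in both arguments rests
  on \<open>mactA_smult\<close>: directly in \<alpha>, and in f through the
  \<open>K\<close>-linearity of the action of \<alpha>.\<close>

lemma action_bilinear:
  assumes x: "x \<in> carrier (mgr M q)"
  shows "(\<lambda>\<alpha> f. mactA M (p + q) \<alpha> (mact M p q f x)) \<in> bilinear_maps K A (rgr B p) (mgr M (p + q))"
  by (intro bilinear_mapsI linear_maps_compose[OF mactA_linear_right mact_linear_left[OF x]]
      mactA_linear_left action_closed x)

sublocale tensor_of_rings K A B ..

abbreviation \<Phi> where "\<Phi> \<equiv> Phi_obj K A B M"

lemma Phi_simps: "mgr \<Phi> = mgr M" "mdiff \<Phi> = mdiff M"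
  "\<lbrakk>t \<in> carrier (T p); x \<in> carrier (mgr M q)\<rbrakk> \<Longrightarrow> mact \<Phi> p q t x =
    tensor_lift K A (rgr B p) (mgr M (p + q)) (\<lambda>\<alpha> f. mactA M (p + q) \<alpha> (mact M p q f x)) t"
  by (simp_all add: Phi_obj_def)

lemma Phi_pure:
  "\<lbrakk>\<alpha> \<in> carrier A; f \<in> carrier (rgr B p); x \<in> carrier (mgr M q)\<rbrakk> \<Longrightarrow>
    mact \<Phi> p q (pt p \<alpha> f) x = mactA M (p + q) \<alpha> (mact M p q f x)"
  by (simp add: Phi_simps pt_closed T_lift_pure[OF mgr_module action_bilinear])

lemma Phi_linear_left:
  assumes x: "x \<in> carrier (mgr M q)"
  shows "(\<lambda>t. mact \<Phi> p q t x) \<in> linear_maps K (T p) (mgr M (p + q))"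
  by (rule linear_maps_congI[OF T_module T_lift_linear[OF mgr_module action_bilinear[OF x], of p]])
    (rule Phi_simps(3)[OF _ x])

text \<open>Linearity in x is not built into a lift over t. Here x is the parameter, and at a pure
  tensor the action is a composite of two linear maps.\<close>

lemma Phi_linear_right:
  assumes t: "t \<in> carrier (T p)"
  shows "mact \<Phi> p q t \<in> linear_maps K (mgr M q) (mgr M (p + q))"
proof (rule module_pair.linear_maps_tensor_parameter[OF pair mgr_module mgr_module Phi_linear_left _ t])
  fix \<alpha> f assume \<alpha>: "\<alpha> \<in> carrier A" and f: "f \<in> carrier (rgr B p)"
  show "(\<lambda>x. mact \<Phi> p q (pt p \<alpha> f) x) \<in> linear_maps K (mgr M q) (mgr M (p + q))"
    by (rule linear_maps_congI[OF mgr_module linear_maps_compose[OF mactA_linear_right[OF \<alpha>] mact_linear_right[OF f]]])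
      (rule Phi_pure[OF \<alpha> f])
qed

lemma Phi_closed: "\<lbrakk>t \<in> carrier (T p); x \<in> carrier (mgr M q)\<rbrakk> \<Longrightarrow> mact \<Phi> p q t x \<in> carrier (mgr M (p + q))"
  using linear_maps_closed[OF Phi_linear_right] .

text \<open>On pure tensors the claim is (\<alpha>\<beta>)(f.(g.x)) = \<alpha>(f.(\<beta>(g.x))),
  where \<beta> is moved past f because the two actions commute.\<close>

lemma Phi_mult:
  assumes s: "s \<in> carrier (T p)" and t: "t \<in> carrier (T p')" and x: "x \<in> carrier (mgr M q)"
  shows "mact \<Phi> (p + p') q (rmult R p p' s t) x = mact \<Phi> p (p' + q) s (mact \<Phi> p' q t x)"
proof (rule bilinear_maps_tensor_eq[OF pair pair _ _ _ s t])
  show "(\<lambda>s t. mact \<Phi> (p + p') q (rmult R p p' s t) x) \<in> bilinear_maps K (T p) (T p') (mgr M (p + p' + q))"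
    by (intro bilinear_mapsI linear_maps_compose[OF Phi_linear_left[OF x]] rmult_R_linear_left rmult_R_linear_right)
  show "(\<lambda>s t. mact \<Phi> p (p' + q) s (mact \<Phi> p' q t x)) \<in> bilinear_maps K (T p) (T p') (mgr M (p + p' + q))"
    unfolding add.assoc
    by (intro bilinear_mapsI linear_maps_compose[OF Phi_linear_right Phi_linear_left[OF x]] Phi_linear_left
        Phi_closed x)
next
  fix \<alpha> f \<beta> g
  assume f: "\<alpha> \<in> carrier A" "f \<in> carrier (rgr B p)" and g: "\<beta> \<in> carrier A" "g \<in> carrier (rgr B p')"
  have gx: "mact M p' q g x \<in> carrier (mgr M (p' + q))" by (rule action_closed[OF g(2) x])
  have fgx: "mact M p (p' + q) f (mact M p' q g x) \<in> carrier (mgr M (p + (p' + q)))"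
    by (rule action_closed[OF f(2) gx])
  have "mact \<Phi> (p + p') q (rmult R p p' (pt p \<alpha> f) (pt p' \<beta> g)) x =
      mactA M (p + (p' + q)) (\<alpha> \<otimes>\<^bsub>A\<^esub> \<beta>) (mact M p (p' + q) f (mact M p' q g x))"
    using f g x by (simp add: rmult_R_pure Phi_pure B_mult_closed mact_mult add.assoc)
  also have "\<dots> = mactA M (p + (p' + q)) \<alpha> (mact M p (p' + q) f (mactA M (p' + q) \<beta> (mact M p' q g x)))"
    using f g gx fgx by (simp add: left_module.act_mult[OF mactA_module] mactA_mact)
  also have "\<dots> = mact \<Phi> p (p' + q) (pt p \<alpha> f) (mact \<Phi> p' q (pt p' \<beta> g) x)"
    using f g x gx by (simp add: Phi_pure mactA_closed)
  finally show "mact \<Phi> (p + p') q (rmult R p p' (pt p \<alpha> f) (pt p' \<beta> g)) x =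
      mact \<Phi> p (p' + q) (pt p \<alpha> f) (mact \<Phi> p' q (pt p' \<beta> g) x)" .
qed

text \<open>The action of \<alpha> is linear and commutes with d, so it passes through the Leibniz
  rule of \<open>M\<close> without a sign of its own.\<close>

lemma Phi_diff:
  assumes t: "t \<in> carrier (T p)" and x: "x \<in> carrier (mgr M q)"
  shows "mdiff M (p + q) (mact \<Phi> p q t x) = mact \<Phi> (p + 1) q (rdiff R p t) x
    \<oplus>\<^bsub>mgr M (p + q + 1)\<^esub> signed (mgr M (p + q + 1)) p (mact \<Phi> p (q + 1) t (mdiff M q x))"
proof (rule module_pair.linear_maps_tensor_eq[OF pair _ _ _ t])
  let ?P = "mgr M (p + q + 1)"
  have dx: "mdiff M q x \<in> carrier (mgr M (q + 1))" by (rule linear_maps_closed[OF mdiff_linear x])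
  show "(\<lambda>t. mdiff M (p + q) (mact \<Phi> p q t x)) \<in> linear_maps K (T p) ?P"
    by (rule linear_maps_compose[OF mdiff_linear Phi_linear_left[OF x]])
  have "(\<lambda>t. mact \<Phi> (p + 1) q (rdiff R p t) x) \<in> linear_maps K (T p) ?P"
    using linear_maps_compose[OF Phi_linear_left[OF x] rdiff_R_linear[of p]] by (simp add: ac_simps)
  moreover have "(\<lambda>t. mact \<Phi> p (q + 1) t (mdiff M q x)) \<in> linear_maps K (T p) ?P"
    using Phi_linear_left[OF dx, of p] by (simp add: ac_simps)
  ultimately show "(\<lambda>t. mact \<Phi> (p + 1) q (rdiff R p t) x
      \<oplus>\<^bsub>?P\<^esub> signed ?P p (mact \<Phi> p (q + 1) t (mdiff M q x))) \<in> linear_maps K (T p) ?P"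
    by (intro linear_maps_plus linear_maps_compose[OF linear_maps_sign] mgr_module)
  fix \<alpha> f assume \<alpha>: "\<alpha> \<in> carrier A" and f: "f \<in> carrier (rgr B p)"
  have fx: "mact M p q f x \<in> carrier (mgr M (p + q))" by (rule action_closed[OF f x])
  have 1: "mact M (p + 1) q (rdiff B p f) x \<in> carrier ?P"
    using action_closed[OF B_diff_closed[OF f] x] by (simp add: ac_simps)
  have 2: "mact M p (q + 1) f (mdiff M q x) \<in> carrier ?P"
    using action_closed[OF f dx] by (simp add: ac_simps)
  have "mdiff M (p + q) (mact \<Phi> p q (pt p \<alpha> f) x) = mactA M (p + q + 1) \<alpha> (mdiff M (p + q) (mact M p q f x))"
    using \<alpha> f x fx by (simp add: Phi_pure mdiff_mactA)
  also have "\<dots> = mactA M (p + q + 1) \<alpha> (mact M (p + 1) q (rdiff B p f) x)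
      \<oplus>\<^bsub>?P\<^esub> signed ?P p (mactA M (p + q + 1) \<alpha> (mact M p (q + 1) f (mdiff M q x)))"
    unfolding mdiff_mact[OF f x]
    by (simp only: linear_maps_add[OF mactA_linear_right[OF \<alpha>] 1 signed_closed[OF mgr_module 2]]
        linear_maps_signed[OF mgr_module mgr_module mactA_linear_right[OF \<alpha>] 2])
  also have "mactA M (p + q + 1) \<alpha> (mact M (p + 1) q (rdiff B p f) x) = mact \<Phi> (p + 1) q (rdiff R p (pt p \<alpha> f)) x"
    using Phi_pure[OF \<alpha> B_diff_closed[OF f] x] rdiff_R_pure[OF \<alpha> f] by (simp add: ac_simps)
  also have "mactA M (p + q + 1) \<alpha> (mact M p (q + 1) f (mdiff M q x)) = mact \<Phi> p (q + 1) (pt p \<alpha> f) (mdiff M q x)"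
    using Phi_pure[OF \<alpha> f dx] by (simp add: ac_simps)
  finally show "mdiff M (p + q) (mact \<Phi> p q (pt p \<alpha> f) x) = mact \<Phi> (p + 1) q (rdiff R p (pt p \<alpha> f)) x
      \<oplus>\<^bsub>?P\<^esub> signed ?P p (mact \<Phi> p (q + 1) (pt p \<alpha> f) (mdiff M q x))" .
qed

lemma Phi_dg_module: "dg_module K R \<Phi>"
proof (intro dg_module.intro dg_module_axioms.intro dg_central_ring_tensor, unfold rgr_R Phi_simps(1,2))
  fix p q
  show "case_prod (mact \<Phi> p q) \<in> extensional (carrier (T p) \<times> carrier (mgr M q))"
    by (auto simp: extensional_def Phi_obj_def)
  fix x assume x: "x \<in> carrier (mgr M q)"
  show "mact \<Phi> 0 q (rone R) x = x"
    using x by (simp add: rone_R Phi_pure rone_closed mact_one left_module.act_one[OF mactA_module])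
qed (simp_all add: mgr_module Phi_linear_left Phi_linear_right Phi_mult Phi_diff mdiff_linear mdiff_square
    mgr_normal mdiff_normal)

end

text \<open>Restriction of scalars along f to 1 \<otimes> f and \<alpha> to \<alpha> \<otimes> 1.
  The value \<open>undefined\<close> outside the domains meets the normal-form conditions on
  objects, so that the inverse laws can be literal equalities.\<close>

definition Psi_obj ::
    "('k, 'z) ring_scheme \<Rightarrow> ('k, 'a) module \<Rightarrow> ('k, 'b) dg_ring \<Rightarrow>
      ('k, ('a \<times> 'b \<Rightarrow>\<^sub>0 int) set, 'm) dg_mod \<Rightarrow> ('k, 'a, 'b, 'm) dg_mod_in" where
  "Psi_obj K A B N =
    \<lparr>mgr = mgr N,
     mact = (\<lambda>p q f x. if f \<in> carrier (rgr B p) \<and> x \<in> carrier (mgr N q)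
       then mact N p q (pure_tensor K A (rgr B p) \<one>\<^bsub>A\<^esub> f) x else undefined),
     mdiff = mdiff N,
     mactA = (\<lambda>q \<alpha> x. if \<alpha> \<in> carrier A \<and> x \<in> carrier (mgr N q)
       then mact N 0 q (pure_tensor K A (rgr B 0) \<alpha> (rone B)) x else undefined)\<rparr>"

locale tensor_dg_module = tensor_of_rings K A B + N: dg_module K "tensor_dg_ring K A B" N
  for K :: "('k, 'z) ring_scheme" and A :: "('k, 'a) module" and B :: "('k, 'b) dg_ring"
    and N :: "('k, ('a \<times> 'b \<Rightarrow>\<^sub>0 int) set, 'm) dg_mod"
begin

abbreviation \<Psi> where "\<Psi> \<equiv> Psi_obj K A B N"

lemma Psi_simps: "mgr \<Psi> = mgr N" "mdiff \<Psi> = mdiff N"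
  "\<lbrakk>f \<in> carrier (rgr B p); x \<in> carrier (mgr N q)\<rbrakk> \<Longrightarrow> mact \<Psi> p q f x = mact N p q (pt p \<one>\<^bsub>A\<^esub> f) x"
  "\<lbrakk>\<alpha> \<in> carrier A; x \<in> carrier (mgr N q)\<rbrakk> \<Longrightarrow> mactA \<Psi> q \<alpha> x = mact N 0 q (pt 0 \<alpha> (rone B)) x"
  by (simp_all add: Psi_obj_def)

lemmas N_linear_right = N.mact_linear_right[unfolded rgr_R]
lemmas N_linear_left = N.mact_linear_left[unfolded rgr_R]
lemmas N_mult = N.mact_mult[unfolded rgr_R]
lemmas N_diff = N.mdiff_mact[unfolded rgr_R]

lemma N_closed: "\<lbrakk>t \<in> carrier (T p); x \<in> carrier (mgr N q)\<rbrakk> \<Longrightarrow> mact N p q t x \<in> carrier (mgr N (p + q))"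
  using linear_maps_closed[OF N_linear_right] .

text \<open>An action of degree 0 lands in degree 0 + q, which \<open>add_0\<close> identifies with
  q.\<close>

lemma N_scalar_linear_left:
  "x \<in> carrier (mgr N q) \<Longrightarrow> (\<lambda>\<alpha>. mact N 0 q (pt 0 \<alpha> (rone B)) x) \<in> linear_maps K A (mgr N q)"
  using linear_maps_compose[OF N_linear_left pt_linear_left[OF B.rone_closed]] by (metis add_0)

lemma N_scalar_linear_right:
  "\<alpha> \<in> carrier A \<Longrightarrow> mact N 0 q (pt 0 \<alpha> (rone B)) \<in> linear_maps K (mgr N q) (mgr N q)"
  using N_linear_right[OF pt_closed[OF _ B.rone_closed]] by (metis add_0)

text \<open>Both (\<alpha> \<otimes> 1)(1 \<otimes> f) and (1 \<otimes> f)(\<alpha> \<otimes> 1)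
  equal \<alpha> \<otimes> f. Together the equations make the two actions commute; the first also
  recovers the given action from them.\<close>

lemma N_scalar_mact:
  assumes "\<alpha> \<in> carrier A" "f \<in> carrier (rgr B p)" "x \<in> carrier (mgr N q)"
  shows "mact N 0 (p + q) (pt 0 \<alpha> (rone B)) (mact N p q (pt p \<one>\<^bsub>A\<^esub> f) x) = mact N p q (pt p \<alpha> f) x"
    and "mact N p q (pt p \<one>\<^bsub>A\<^esub> f) (mact N 0 q (pt 0 \<alpha> (rone B)) x) = mact N p q (pt p \<alpha> f) x"
  using assms N_mult[of "pt 0 \<alpha> (rone B)" 0 "pt p \<one>\<^bsub>A\<^esub> f" p x q]
    N_mult[of "pt p \<one>\<^bsub>A\<^esub> f" p "pt 0 \<alpha> (rone B)" 0 x q]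
  by (simp_all add: pt_closed B.rone_closed rmult_R_pure B.rone_left B.rone_right)

text \<open>The Leibniz rule for the product of 1 with itself gives b(1) = b(1) + b(1). Needed so
  that \<alpha> \<otimes> 1 is a cycle and d becomes \<open>A\<close>-linear.\<close>

lemma rdiff_rone: "rdiff B 0 (rone B) = \<zero>\<^bsub>rgr B 1\<^esub>"
proof -
  interpret B1: module K "rgr B 1" by (rule B.rgr_module)
  have d: "rdiff B 0 (rone B) \<in> carrier (rgr B 1)"
    using B_diff_closed[OF B.rone_closed] by simp
  then have "rdiff B 0 (rone B) = rdiff B 0 (rone B) \<oplus>\<^bsub>rgr B 1\<^esub> rdiff B 0 (rone B)"
    using B.rdiff_mult[OF B.rone_closed B.rone_closed]
    by (simp add: B.rone_left B.rone_right B.rone_closed signed_def)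
  then show ?thesis using d by simp
qed

text \<open>Sending f to 1 \<otimes> f respects product, unit and differential, so these axioms are
  those of \<open>N\<close> at such tensors.\<close>

lemma Psi_dg_module: "dg_module K B \<Psi>"
proof (intro dg_module.intro dg_module_axioms.intro B.dg_central_ring_axioms, unfold Psi_simps(1,2))
  fix p q
  show "case_prod (mact \<Psi> p q) \<in> extensional (carrier (rgr B p) \<times> carrier (mgr N q))"
    by (auto simp: extensional_def Psi_obj_def)
next
  fix f p q assume f: "f \<in> carrier (rgr B p)"
  show "mact \<Psi> p q f \<in> linear_maps K (mgr N q) (mgr N (p + q))"
    by (rule linear_maps_congI[OF N.mgr_module N_linear_right[OF pt_closed[OF A.Alg.one_closed f]]])
      (rule Psi_simps(3)[OF f])
next
  fix x p q assume x: "x \<in> carrier (mgr N q)"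
  show "(\<lambda>f. mact \<Psi> p q f x) \<in> linear_maps K (rgr B p) (mgr N (p + q))"
    by (rule linear_maps_congI[OF B.rgr_module linear_maps_compose[OF N_linear_left[OF x]
          pt_linear_right[OF A.Alg.one_closed, of p]]]) (rule Psi_simps(3)[OF _ x])
next
  fix f p g p' x q
  assume f: "f \<in> carrier (rgr B p)" and g: "g \<in> carrier (rgr B p')" and x: "x \<in> carrier (mgr N q)"
  show "mact \<Psi> (p + p') q (rmult B p p' f g) x = mact \<Psi> p (p' + q) f (mact \<Psi> p' q g x)"
    using f g x N_mult[of "pt p \<one>\<^bsub>A\<^esub> f" p "pt p' \<one>\<^bsub>A\<^esub> g" p' x q] N_closed[of "pt p' \<one>\<^bsub>A\<^esub> g" p' x q]
    by (simp add: Psi_simps B_mult_closed rmult_R_pure pt_closed)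
next
  fix x q assume x: "x \<in> carrier (mgr N q)"
  show "mact \<Psi> 0 q (rone B) x = x"
    using x N.mact_one[OF x] by (simp add: Psi_simps B.rone_closed rone_R)
next
  fix f p x q assume f: "f \<in> carrier (rgr B p)" and x: "x \<in> carrier (mgr N q)"
  show "mdiff N (p + q) (mact \<Psi> p q f x) = mact \<Psi> (p + 1) q (rdiff B p f) x
      \<oplus>\<^bsub>mgr N (p + q + 1)\<^esub> signed (mgr N (p + q + 1)) p (mact \<Psi> p (q + 1) f (mdiff N q x))"
    using f x N_diff[OF pt_closed[OF A.Alg.one_closed f] x]
    by (simp add: Psi_simps rdiff_R_pure B_diff_closed linear_maps_closed[OF N.mdiff_linear])
qed (simp_all add: N.mgr_module N.mdiff_linear N.mdiff_square N.mgr_normal N.mdiff_normal)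

lemma Psi_dg_module_in: "dg_module_in K A B \<Psi>"
proof (intro dg_module_in.intro dg_module_in_axioms.intro Psi_dg_module A.central_ring_axioms, unfold Psi_simps(1,2))
  fix q
  interpret Nq: module K "mgr N q" by (rule N.mgr_module)
  show "left_module A (mgr N q) (mactA \<Psi> q)"
  proof (intro left_module.intro left_module_axioms.intro A.Alg.ring_axioms Nq.abelian_group_axioms)
    fix \<alpha> \<beta> x assume \<alpha>: "\<alpha> \<in> carrier A" and \<beta>: "\<beta> \<in> carrier A" and x: "x \<in> carrier (mgr N q)"
    show "mactA \<Psi> q (\<alpha> \<oplus>\<^bsub>A\<^esub> \<beta>) x = mactA \<Psi> q \<alpha> x \<oplus>\<^bsub>mgr N q\<^esub> mactA \<Psi> q \<beta> x"
      using \<alpha> \<beta> x by (simp add: Psi_simps linear_maps_add[OF N_scalar_linear_left])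
    have "mact N 0 q (pt 0 \<beta> (rone B)) x \<in> carrier (mgr N q)"
      by (rule linear_maps_closed[OF N_scalar_linear_right[OF \<beta>] x])
    then show "mactA \<Psi> q (\<alpha> \<otimes>\<^bsub>A\<^esub> \<beta>) x = mactA \<Psi> q \<alpha> (mactA \<Psi> q \<beta> x)"
      using \<alpha> \<beta> x N_mult[of "pt 0 \<alpha> (rone B)" 0 "pt 0 \<beta> (rone B)" 0 x q]
      by (simp add: Psi_simps pt_closed B.rone_closed rmult_R_pure B.rone_left)
  next
    fix \<alpha> x y assume \<alpha>: "\<alpha> \<in> carrier A" and x: "x \<in> carrier (mgr N q)" and y: "y \<in> carrier (mgr N q)"
    show "mactA \<Psi> q \<alpha> x \<in> carrier (mgr N q)"
      using \<alpha> x linear_maps_closed[OF N_scalar_linear_right] by (simp add: Psi_simps)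
    show "mactA \<Psi> q \<alpha> (x \<oplus>\<^bsub>mgr N q\<^esub> y) = mactA \<Psi> q \<alpha> x \<oplus>\<^bsub>mgr N q\<^esub> mactA \<Psi> q \<alpha> y"
      using \<alpha> x y by (simp add: Psi_simps linear_maps_add[OF N_scalar_linear_right])
  next
    fix x assume x: "x \<in> carrier (mgr N q)"
    then show "mactA \<Psi> q \<one>\<^bsub>A\<^esub> x = x" using N.mact_one by (simp add: Psi_simps rone_R)
  qed
  show "case_prod (mactA \<Psi> q) \<in> extensional (carrier A \<times> carrier (mgr N q))"
    by (auto simp: extensional_def Psi_obj_def)
  fix \<alpha> x assume \<alpha>: "\<alpha> \<in> carrier A" and x: "x \<in> carrier (mgr N q)"
  {
    fix k assume "k \<in> carrier K"
    then show "mactA \<Psi> q (k \<odot>\<^bsub>A\<^esub> \<alpha>) x = k \<odot>\<^bsub>mgr N q\<^esub> mactA \<Psi> q \<alpha> x"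
      using \<alpha> x by (simp add: Psi_simps linear_maps_smult[OF N_scalar_linear_left])
  next
    fix f p assume f: "f \<in> carrier (rgr B p)"
    show "mactA \<Psi> (p + q) \<alpha> (mact \<Psi> p q f x) = mact \<Psi> p q f (mactA \<Psi> q \<alpha> x)"
      using \<alpha> f x linear_maps_closed[OF N_scalar_linear_right[OF \<alpha>] x] N_closed[of "pt p \<one>\<^bsub>A\<^esub> f" p x q]
      by (simp add: Psi_simps N_scalar_mact pt_closed)
  next
    \<comment> \<open>The Leibniz rule for \<alpha> \<otimes> 1: its first term vanishes by
      \<open>rdiff_rone\<close>, and the sign for degree 0 is trivial.\<close>
    interpret N1: module K "mgr N (q + 1)" by (rule N.mgr_module)
    have dx: "mdiff N q x \<in> carrier (mgr N (q + 1))" by (rule linear_maps_closed[OF N.mdiff_linear x])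
    have "(\<lambda>t. mact N 1 q t x) \<in> linear_maps K (T 1) (mgr N (q + 1))"
      using N_linear_left[OF x, of 1] by (simp add: add.commute)
    then have "mact N 1 q (rdiff R 0 (pt 0 \<alpha> (rone B))) x = \<zero>\<^bsub>mgr N (q + 1)\<^esub>"
      using rdiff_R_pure[OF \<alpha> B.rone_closed] linear_maps_zero[OF T_module N.mgr_module]
      by (simp add: rdiff_rone module_pair.pure_tensor_zero_right[OF pair \<alpha>])
    then show "mdiff N q (mactA \<Psi> q \<alpha> x) = mactA \<Psi> (q + 1) \<alpha> (mdiff N q x)"
      using \<alpha> x dx N_diff[OF pt_closed[OF \<alpha> B.rone_closed] x]
        linear_maps_closed[OF N_scalar_linear_right[OF \<alpha>] dx]
      by (simp add: Psi_simps signed_def)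
  }
qed

lemma Phi_Psi: "Phi_obj K A B \<Psi> = N"
proof -
  interpret \<Psi>: dg_module_in K A B \<Psi> by (rule Psi_dg_module_in)
  have "mact (Phi_obj K A B \<Psi>) p q t x = mact N p q t x" for p q t x
  proof (cases "t \<in> carrier (T p) \<and> x \<in> carrier (mgr N q)")
    case True
    have "mact (Phi_obj K A B \<Psi>) p q t x = mact N p q t x"
    proof (rule module_pair.linear_maps_tensor_eq[OF pair _ N_linear_left])
      show "(\<lambda>t. mact (Phi_obj K A B \<Psi>) p q t x) \<in> linear_maps K (T p) (mgr N (p + q))"
        using \<Psi>.Phi_linear_left[of x q p] True by (simp add: Psi_simps)
      fix \<alpha> f assume \<alpha>: "\<alpha> \<in> carrier A" and f: "f \<in> carrier (rgr B p)"
      show "mact (Phi_obj K A B \<Psi>) p q (pt p \<alpha> f) x = mact N p q (pt p \<alpha> f) x"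
        using \<alpha> f True N_closed[of "pt p \<one>\<^bsub>A\<^esub> f" p x q] \<Psi>.Phi_pure[OF \<alpha> f, of x q]
        by (simp add: Psi_simps N_scalar_mact pt_closed)
    qed (use True in auto)
    then show ?thesis .
  next
    \<comment> \<open>Outside the domain \<open>Phi_obj\<close> returns \<open>undefined\<close> by
      definition, and \<open>N\<close> does so by \<open>mact_normal\<close>.\<close>
    case False
    then show ?thesis
      using extensional_arb[OF N.mact_normal[unfolded rgr_R], of "(t, x)" p q]
      by (auto simp: Phi_obj_def Psi_simps)
  qed
  then have "mact (Phi_obj K A B \<Psi>) = mact N" by (intro ext)
  then show ?thesis by (simp add: \<Psi>.Phi_simps Psi_simps)
qed

end

section \<open>Recovering the two actions and comparing morphisms\<close>

context dg_module_in
begin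

lemma Phi_mact_one:
  "\<lbrakk>f \<in> carrier (rgr B p); x \<in> carrier (mgr M q)\<rbrakk> \<Longrightarrow> mact \<Phi> p q (pt p \<one>\<^bsub>A\<^esub> f) x = mact M p q f x"
  by (simp add: Phi_pure left_module.act_one[OF mactA_module] action_closed)

lemma Phi_mactA:
  "\<lbrakk>\<alpha> \<in> carrier A; x \<in> carrier (mgr M q)\<rbrakk> \<Longrightarrow> mact \<Phi> 0 q (pt 0 \<alpha> (rone B)) x = mactA M q \<alpha> x"
  by (simp add: Phi_pure rone_closed mact_one)

text \<open>The units of \<open>A\<close> and \<open>B\<close> act trivially, so 1 \<otimes> f and
  \<alpha> \<otimes> 1 return the original actions; \<open>mact_normal\<close> and
  \<open>mactA_normal\<close> settle the arguments outside the domains.\<close>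

lemma Psi_Phi: "Psi_obj K A B \<Phi> = M"
proof -
  have "mact (Psi_obj K A B \<Phi>) p q f x = mact M p q f x" for p q f x
    using extensional_arb[OF mact_normal, of "(f, x)" p q]
    by (auto simp: Psi_obj_def Phi_simps Phi_mact_one)
  moreover have "mactA (Psi_obj K A B \<Phi>) q \<alpha> x = mactA M q \<alpha> x" for q \<alpha> x
    using extensional_arb[OF mactA_normal, of "(\<alpha>, x)" q]
    by (auto simp: Psi_obj_def Phi_simps Phi_mactA)
  ultimately have "mact (Psi_obj K A B \<Phi>) = mact M" "mactA (Psi_obj K A B \<Phi>) = mactA M"
    by (intro ext; simp)+
  moreover have "mgr (Psi_obj K A B \<Phi>) = mgr M" "mdiff (Psi_obj K A B \<Phi>) = mdiff M"
    by (simp_all add: Psi_obj_def Phi_simps)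
  ultimately show ?thesis by simp
qed

end

text \<open>An equality of sets and not just a bijection, because the underlying modules are
  unchanged; this lets the morphism modules be equal as records.\<close>

lemma dg_homs_Phi:
  assumes M: "dg_module_in K A B M" and M': "dg_module_in K A B M'"
  shows "dg_homs K (tensor_dg_ring K A B) (Phi_obj K A B M) (Phi_obj K A B M') r = dg_homs_in K A B M M' r"
proof -
  interpret M: dg_module_in K A B M by fact
  interpret M': dg_module_in K A B M' by fact
  note simps = M.Phi_simps(1) M'.Phi_simps(1) M.rgr_R
  show ?thesis
  proof (intro equalityI subsetI)
    fix u assume u: "u \<in> dg_homs K M.R M.\<Phi> M'.\<Phi> r"
    have closed: "u q x \<in> carrier (mgr M' (q + r))" if "x \<in> carrier (mgr M q)" for q x
      using dg_homs_closed[OF u, of x q] that by (simp add: simps)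
    have "u \<in> dg_homs K B M M' r"
    proof (rule dg_homsI)
      fix p q f x assume f: "f \<in> carrier (rgr B p)" and x: "x \<in> carrier (mgr M q)"
      show "u (p + q) (mact M p q f x) = signed (mgr M' (p + q + r)) (p * r) (mact M' p (q + r) f (u q x))"
        using dg_homs_mact[OF u, of "M.pt p \<one>\<^bsub>A\<^esub> f" p x q] f x closed[OF x]
        by (simp add: simps M.pt_closed M.Phi_mact_one M'.Phi_mact_one)
    qed (use dg_homs_linear[OF u] dg_homs_extensional[OF u] in \<open>simp_all add: simps\<close>)
    \<comment> \<open>For p = 0 the sign has exponent 0, so the law at \<alpha> \<otimes> 1 is plain
      \<open>A\<close>-linearity.\<close>
    moreover have "u q (mactA M q \<alpha> x) = mactA M' (q + r) \<alpha> (u q x)"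
      if \<alpha>: "\<alpha> \<in> carrier A" and x: "x \<in> carrier (mgr M q)" for q \<alpha> x
      using dg_homs_mact[OF u, of "M.pt 0 \<alpha> (rone B)" 0 x q] \<alpha> x closed[OF x]
      by (simp add: simps M.pt_closed M.rone_closed M.Phi_mactA M'.Phi_mactA signed_def)
    ultimately show "u \<in> dg_homs_in K A B M M' r" by (simp add: dg_homs_in_def)
  next
    fix u assume "u \<in> dg_homs_in K A B M M' r"
    then have u: "u \<in> dg_homs K B M M' r"
      and uA: "\<And>q \<alpha> x. \<lbrakk>\<alpha> \<in> carrier A; x \<in> carrier (mgr M q)\<rbrakk> \<Longrightarrow>
        u q (mactA M q \<alpha> x) = mactA M' (q + r) \<alpha> (u q x)"
      by (simp_all add: dg_homs_in_def)
    show "u \<in> dg_homs K M.R M.\<Phi> M'.\<Phi> r"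
    proof (rule dg_homsI, unfold simps)
      fix p q t x assume t: "t \<in> carrier (M.T p)" and x: "x \<in> carrier (mgr M q)"
      let ?P = "mgr M' (p + q + r)"
      have ux: "u q x \<in> carrier (mgr M' (q + r))" by (rule dg_homs_closed[OF u x])
      show "u (p + q) (mact M.\<Phi> p q t x) = signed ?P (p * r) (mact M'.\<Phi> p (q + r) t (u q x))"
      proof (rule module_pair.linear_maps_tensor_eq[OF M.pair _ _ _ t])
        show "(\<lambda>t. u (p + q) (mact M.\<Phi> p q t x)) \<in> linear_maps K (M.T p) ?P"
          by (rule linear_maps_compose[OF dg_homs_linear[OF u] M.Phi_linear_left[OF x]])
        have "(\<lambda>t. mact M'.\<Phi> p (q + r) t (u q x)) \<in> linear_maps K (M.T p) ?P"
          using M'.Phi_linear_left[OF ux, of p] by (simp add: add.assoc)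
        then show "(\<lambda>t. signed ?P (p * r) (mact M'.\<Phi> p (q + r) t (u q x))) \<in> linear_maps K (M.T p) ?P"
          by (rule linear_maps_compose[OF linear_maps_sign[OF M'.mgr_module]])
        fix \<alpha> f assume \<alpha>: "\<alpha> \<in> carrier A" and f: "f \<in> carrier (rgr B p)"
        have fux: "mact M' p (q + r) f (u q x) \<in> carrier ?P"
          using M'.action_closed[OF f ux] by (simp add: add.assoc)
        have "u (p + q) (mact M.\<Phi> p q (M.pt p \<alpha> f) x) =
            mactA M' (p + q + r) \<alpha> (signed ?P (p * r) (mact M' p (q + r) f (u q x)))"
          using \<alpha> f x by (simp add: M.Phi_pure uA M.action_closed dg_homs_mact[OF u])
        \<comment> \<open>The sign that u produces at f.x stands inside the action of \<alpha> and
          is pulled out by linearity.\<close>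
        also have "\<dots> = signed ?P (p * r) (mactA M' (p + q + r) \<alpha> (mact M' p (q + r) f (u q x)))"
          by (rule linear_maps_signed[OF M'.mgr_module M'.mgr_module M'.mactA_linear_right[OF \<alpha>] fux])
        also have "mactA M' (p + q + r) \<alpha> (mact M' p (q + r) f (u q x)) = mact M'.\<Phi> p (q + r) (M.pt p \<alpha> f) (u q x)"
          using M'.Phi_pure[OF \<alpha> f ux] by (simp add: add.assoc)
        finally show "u (p + q) (mact M.\<Phi> p q (M.pt p \<alpha> f) x) =
            signed ?P (p * r) (mact M'.\<Phi> p (q + r) (M.pt p \<alpha> f) (u q x))" .
      qed
    qed (use dg_homs_linear[OF u] dg_homs_extensional[OF u] in simp_all)
  qed
qed

theorem proposition2p9:
  fixes K :: "'k ring" and A :: "('k, 'a) module" and B :: "('k, 'b) dg_ring"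
  assumes "cring K" and "\<one>\<^bsub>K\<^esub> \<noteq> \<zero>\<^bsub>K\<^esub>"
    and "central_ring K A"
    and "dg_central_ring K B"
  shows "dg_isomorphism K
    (dg_modules_in K A B :: ('k, ('k, 'a, 'b, 'm) dg_mod_in, int \<Rightarrow> 'm \<Rightarrow> 'm) dg_cat)
    (dg_modules K (tensor_dg_ring K A B))
    (Phi_obj K A B)
    Phi_hom"
proof -
  interpret tensor_of_rings K A B
    using assms(3,4) by (rule tensor_of_rings.intro)
  have Phi_hom: "(Phi_hom :: ('k, 'a, 'b, 'm) dg_mod_in \<Rightarrow> _) = (\<lambda>_ _ _ u. u)"
    by (intro ext) (simp add: Phi_hom_def)
  have Phi_simps: "mgr (Phi_obj K A B M) = mgr M" "mdiff (Phi_obj K A B M) = mdiff M"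
    for M :: "('k, 'a, 'b, 'm) dg_mod_in"
    by (simp_all add: Phi_obj_def)
  show ?thesis
    unfolding Phi_hom
  proof (rule dg_isomorphism_transport[where Go = "Psi_obj K A B", OF dg_category_dg_modules[OF dg_central_ring_tensor]])
    fix X :: "('k, 'a, 'b, 'm) dg_mod_in"
    assume "X \<in> Obj (dg_modules_in K A B)"
    then interpret dg_module_in K A B X by (simp add: dg_modules_in_def)
    show "Phi_obj K A B X \<in> Obj (dg_modules K R)" "Psi_obj K A B (Phi_obj K A B X) = X"
      "Ident (dg_modules_in K A B) X = Ident (dg_modules K R) (Phi_obj K A B X)"
      by (simp_all add: dg_modules_def dg_modules_in_def Phi_dg_module Psi_Phi hom_ident_def Phi_simps)
  next
    fix X :: "('k, ('a \<times> 'b \<Rightarrow>\<^sub>0 int) set, 'm) dg_mod"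
    assume "X \<in> Obj (dg_modules K R)"
    then have "dg_module K R X" by (simp add: dg_modules_def)
    then interpret tensor_dg_module K A B X
      by (intro tensor_dg_module.intro tensor_of_rings_axioms)
    show "Psi_obj K A B X \<in> Obj (dg_modules_in K A B)" "Phi_obj K A B (Psi_obj K A B X) = X"
      by (simp_all add: dg_modules_in_def Psi_dg_module_in Phi_Psi)
  \<comment> \<open>The remaining goals compare morphism modules, differentials and compositions.
    These depend only on the graded modules, the differentials and the sets treated in
    \<open>dg_homs_Phi\<close>.\<close>
  qed (auto simp: dg_modules_def dg_modules_in_def dg_homs_Phi hom_module_def Phi_simps
      fun_eq_iff hom_diff_def hom_comp_def)
qed

end
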